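(* Let $K$ be a field and let $\mathbb M$ be a functor of $\mathcal K$-modules. Then $\mathbb M$ is reflexive if and only if $\mathbb M$ is equal to the inverse limit of its quasi-coherent quotients (that is, the natural morphism $\mathbb M\to\varprojlim_{i}\mathcal M_i$, where $\{\mathcal M_i\}$ is the system of all quasi-coherent quotients of $\mathbb M$, is an isomorphism). In particular, reflexive functors of $\mathcal K$-modules are proquasi-coherent.
   Context: $K$ is a field. All functors are covariant functors on the category of commutative $K$-algebras. $\mathcal K$ is the functor of rings $\mathcal K(S)=S$. A functor of $\mathcal K$-modules $\mathbb M$ is a functor of sets with morphisms of functors $\mathbb M\times\mathbb M\to\mathbb M$, $\mathcal K\times\mathbb M\to\mathbb M$ making $\mathbb M(S)$ an $S$-module for every commutative $K$-algebra $S$. A morphism is a natural transformation $f$ with every $f_S$ $S$-linear. Limits, quotients, etc. are computed pointwise: $(\varprojlim \mathbb M_i)(S)=\varprojlim(\mathbb M_i(S))$; an epimorphism is a morphism surjective on every $S$. $\mathbb M^*(S):=\operatorname{Hom}_{\mathcal S}(\mathbb M_{|S},\mathcal S)$, where $\mathbb M_{|S}$ is the restriction of $\mathbb M$ to commutative $S$-algebras and $\mathcal S(T)=T$. Convention: one only considers functors for which the Hom's involved are sets. $\mathbb M$ is reflexive if the natural morphism $\mathbb M\to\mathbb M^{**}$ is an isomorphism. For a $K$-vector space $V$, the associated quasi-coherent module is $\mathcal V(S)=V\otimes_K S$. A quasi-coherent quotient of $\mathbb M$ is a quotient $\mathbb M\to\mathcal M_i$ (epimorphism, up to isomorphism under $\mathbb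 M$) with $\mathcal M_i$ quasi-coherent; these are ordered by $i\ge j$ when $\mathbb M\to\mathcal M_j$ factors through $\mathbb M\to\mathcal M_i$. A functor of $\mathcal K$-modules is proquasi-coherent if it is an inverse limit of quasi-coherent modules. *)

theory Defs
  imports "HOL-Algebra.Module" "HOL-Algebra.Free_Abelian_Groups"
begin

text \<open>
  The carriers of all commutative algebras, and of the vector spaces that give rise to
  quasi-coherent modules, are subsets of one fixed type \<open>'u\<close>, which plays the role of the
  universe of sets; if \<open>'u\<close> is infinite, this universe is closed under tensor products and
  square-zero extensions. Functors of modules take values in an arbitrary type \<open>'m\<close>; it is not tied to
  \<open>'u\<close>, so that duals and limits of such functors are again functors of the same kind.

  Every morphism (of algebras or of functors) is an extensional function, so that equal morphisms
  are equal as HOL functions.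
\<close>


section \<open>Commutative algebras\<close>

text \<open>
  The scalar multiplication of an object is \<^term>\<open>undefined\<close> outside its domain, so that
  changing scalars twice, or along an identity, gives an equality of objects.
\<close>

definition comm_algebras :: "('u, 'r) ring_scheme \<Rightarrow> ('u, 'u) module set" where
  "comm_algebras R = {A. algebra R A \<and>
     (\<forall>a x. a \<notin> carrier R \<or> x \<notin> carrier A \<longrightarrow> a \<odot>\<^bsub>A\<^esub> x = undefined)}"

definition alg_hom ::
  "('u, 'r) ring_scheme \<Rightarrow> ('u, 'u) module \<Rightarrow> ('u, 'u) module \<Rightarrow> ('u \<Rightarrow> 'u) set" where
  "alg_hom R A B = {h \<in> ring_hom A B \<inter> extensional (carrier A).
     \<forall>a \<in> carrier R. \<forall>x \<in> carrier A. h (a \<odot>\<^bsub>A\<^esub> x) = a \<odot>\<^bsub>B\<^esub> h x}"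

definition restrict_scalars ::
  "('u, 'r) ring_scheme \<Rightarrow> ('u \<Rightarrow> 'u) \<Rightarrow> ('u, 'u) module \<Rightarrow> ('u, 'u) module" where
  "restrict_scalars R \<phi> A =
     A \<lparr>smult := (\<lambda>a x. if a \<in> carrier R \<and> x \<in> carrier A then \<phi> a \<odot>\<^bsub>A\<^esub> x else undefined)\<rparr>"

definition structure_map ::
  "('u, 'r) ring_scheme \<Rightarrow> ('u, 'u) module \<Rightarrow> 'u \<Rightarrow> 'u" where
  "structure_map R A = (\<lambda>a \<in> carrier R. a \<odot>\<^bsub>A\<^esub> \<one>\<^bsub>A\<^esub>)"

text \<open>An algebra over \<open>S\<close>, where \<open>S\<close> is an algebra over \<open>R\<close>, viewed as an algebra over \<open>R\<close>:\<close>

definition base_alg ::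
  "('u, 'r) ring_scheme \<Rightarrow> ('u, 'u) module \<Rightarrow> ('u, 'u) module \<Rightarrow> ('u, 'u) module" where
  "base_alg R S T = restrict_scalars R (structure_map R S) T"

text \<open>A commutative ring as an algebra over itself:\<close>

definition self_alg :: "('u, 'u) module \<Rightarrow> ('u, 'u) module" where
  "self_alg T = T \<lparr>smult :=
     (\<lambda>a x. if a \<in> carrier T \<and> x \<in> carrier T then a \<otimes>\<^bsub>T\<^esub> x else undefined)\<rparr>"


section \<open>Functors of modules\<close>

definition linear_maps ::
  "('u, 'r) ring_scheme \<Rightarrow> ('u, 'm) module \<Rightarrow> ('u, 'n) module \<Rightarrow> ('m \<Rightarrow> 'n) set" where
  "linear_maps R M N = {f \<in> carrier M \<rightarrow>\<^sub>E carrier N.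
     (\<forall>x \<in> carrier M. \<forall>y \<in> carrier M. f (x \<oplus>\<^bsub>M\<^esub> y) = f x \<oplus>\<^bsub>N\<^esub> f y) \<and>
     (\<forall>a \<in> carrier R. \<forall>x \<in> carrier M. f (a \<odot>\<^bsub>M\<^esub> x) = a \<odot>\<^bsub>N\<^esub> f x)}"

record ('u, 'm) mfunctor =
  Ob :: "('u, 'u) module \<Rightarrow> ('u, 'm) module"
  Ar :: "('u, 'u) module \<Rightarrow> ('u, 'u) module \<Rightarrow> ('u \<Rightarrow> 'u) \<Rightarrow> 'm \<Rightarrow> 'm"

text \<open>
  The laws \<open>Ar_add\<close> and \<open>Ar_smult\<close> say that addition \<open>M \<times> M \<rightarrow> M\<close> and scalar multiplication
  \<open>R \<times> M \<rightarrow> M\<close> are morphisms of functors of sets.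
\<close>

locale module_functor = cring R for R :: "('u, 'r) ring_scheme" (structure) +
  fixes M :: "('u, 'm) mfunctor"
  assumes Ob_module: "S \<in> comm_algebras R \<Longrightarrow> module S (Ob M S)"
    and Ar_closed: "\<lbrakk>S \<in> comm_algebras R; T \<in> comm_algebras R; h \<in> alg_hom R S T;
           x \<in> carrier (Ob M S)\<rbrakk> \<Longrightarrow> Ar M S T h x \<in> carrier (Ob M T)"
    and Ar_id: "\<lbrakk>S \<in> comm_algebras R; x \<in> carrier (Ob M S)\<rbrakk> \<Longrightarrow>
           Ar M S S (\<lambda>s \<in> carrier S. s) x = x"
    and Ar_comp: "\<lbrakk>S \<in> comm_algebras R; T \<in> comm_algebras R; U \<in> comm_algebras R;
           h \<in> alg_hom R S T; k \<in> alg_hom R T U; x \<in> carrier (Ob M S)\<rbrakk> \<Longrightarrow>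
           Ar M S U (compose (carrier S) k h) x = Ar M T U k (Ar M S T h x)"
    and Ar_add: "\<lbrakk>S \<in> comm_algebras R; T \<in> comm_algebras R; h \<in> alg_hom R S T;
           x \<in> carrier (Ob M S); y \<in> carrier (Ob M S)\<rbrakk> \<Longrightarrow>
           Ar M S T h (x \<oplus>\<^bsub>Ob M S\<^esub> y) = Ar M S T h x \<oplus>\<^bsub>Ob M T\<^esub> Ar M S T h y"
    and Ar_smult: "\<lbrakk>S \<in> comm_algebras R; T \<in> comm_algebras R; h \<in> alg_hom R S T;
           s \<in> carrier S; x \<in> carrier (Ob M S)\<rbrakk> \<Longrightarrow>
           Ar M S T h (s \<odot>\<^bsub>Ob M S\<^esub> x) = h s \<odot>\<^bsub>Ob M T\<^esub> Ar M S T h x"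

definition mor ::
  "('u, 'r) ring_scheme \<Rightarrow> ('u, 'm) mfunctor \<Rightarrow> ('u, 'n) mfunctor \<Rightarrow>
   (('u, 'u) module \<Rightarrow> 'm \<Rightarrow> 'n) set" where
  "mor R M N = {f \<in> extensional (comm_algebras R).
     (\<forall>S \<in> comm_algebras R. f S \<in> linear_maps S (Ob M S) (Ob N S)) \<and>
     (\<forall>S \<in> comm_algebras R. \<forall>T \<in> comm_algebras R. \<forall>h \<in> alg_hom R S T.
        \<forall>x \<in> carrier (Ob M S). f T (Ar M S T h x) = Ar N S T h (f S x))}"

definition id_mor ::
  "('u, 'r) ring_scheme \<Rightarrow> ('u, 'm) mfunctor \<Rightarrow> ('u, 'u) module \<Rightarrow> 'm \<Rightarrow> 'm" where
  "id_mor R M = (\<lambda>S \<in> comm_algebras R. \<lambda>x \<in> carrier (Ob M S). x)"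

definition comp_mor ::
  "('u, 'r) ring_scheme \<Rightarrow> ('u, 'l) mfunctor \<Rightarrow> (('u, 'u) module \<Rightarrow> 'm \<Rightarrow> 'n) \<Rightarrow>
   (('u, 'u) module \<Rightarrow> 'l \<Rightarrow> 'm) \<Rightarrow> ('u, 'u) module \<Rightarrow> 'l \<Rightarrow> 'n" where
  "comp_mor R L g f = (\<lambda>S \<in> comm_algebras R. compose (carrier (Ob L S)) (g S) (f S))"

definition functor_iso ::
  "('u, 'r) ring_scheme \<Rightarrow> ('u, 'm) mfunctor \<Rightarrow> ('u, 'n) mfunctor \<Rightarrow>
   (('u, 'u) module \<Rightarrow> 'm \<Rightarrow> 'n) \<Rightarrow> bool" where
  "functor_iso R M N f \<longleftrightarrow> f \<in> mor R M N \<and>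
     (\<exists>g \<in> mor R N M. comp_mor R M g f = id_mor R M \<and> comp_mor R N f g = id_mor R N)"

definition functor_epi ::
  "('u, 'r) ring_scheme \<Rightarrow> ('u, 'm) mfunctor \<Rightarrow> ('u, 'n) mfunctor \<Rightarrow>
   (('u, 'u) module \<Rightarrow> 'm \<Rightarrow> 'n) \<Rightarrow> bool" where
  "functor_epi R M N f \<longleftrightarrow> f \<in> mor R M N \<and>
     (\<forall>S \<in> comm_algebras R. f S ` carrier (Ob M S) = carrier (Ob N S))"


section \<open>Duals and reflexivity\<close>

text \<open>The functor \<open>T \<mapsto> T\<close> of modules over itself:\<close>

definition ring_functor :: "('u, 'u) mfunctor" where
  "ring_functor = \<lparr>Ob = self_alg, Ar = (\<lambda>S T h. h)\<rparr>"

definition restrict_functor ::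
  "('u, 'r) ring_scheme \<Rightarrow> ('u, 'm) mfunctor \<Rightarrow> ('u, 'u) module \<Rightarrow> ('u, 'm) mfunctor" where
  "restrict_functor R M S =
     \<lparr>Ob = (\<lambda>T. Ob M (base_alg R S T)),
      Ar = (\<lambda>T T' h. Ar M (base_alg R S T) (base_alg R S T') h)\<rparr>"

text \<open>
  Modules are records extending rings; the ring multiplication and unit of a module are
  irrelevant, and are left \<^term>\<open>undefined\<close> in the modules constructed below.
\<close>

definition dual ::
  "('u, 'r) ring_scheme \<Rightarrow> ('u, 'm) mfunctor \<Rightarrow>
   ('u, ('u, 'u) module \<Rightarrow> 'm \<Rightarrow> 'u) mfunctor" where
  "dual R M =
     \<lparr>Ob = (\<lambda>S.
        \<lparr>carrier = mor S (restrict_functor R M S) ring_functor,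
         mult = undefined,
         one = undefined,
         ring.zero = (\<lambda>T \<in> comm_algebras S. \<lambda>x \<in> carrier (Ob M (base_alg R S T)). \<zero>\<^bsub>T\<^esub>),
         add = (\<lambda>f g. \<lambda>T \<in> comm_algebras S. \<lambda>x \<in> carrier (Ob M (base_alg R S T)).
                  f T x \<oplus>\<^bsub>T\<^esub> g T x),
         smult = (\<lambda>s f. \<lambda>T \<in> comm_algebras S. \<lambda>x \<in> carrier (Ob M (base_alg R S T)).
                  s \<odot>\<^bsub>T\<^esub> f T x)\<rparr>),
      Ar = (\<lambda>S S' h f. \<lambda>T \<in> comm_algebras S'. \<lambda>x \<in> carrier (Ob M (base_alg R S' T)).
              f (restrict_scalars S h T) x)\<rparr>"

text \<open>
  The natural morphism into the bidual sends \<open>m \<in> M(S)\<close> to the family of maps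
  \<open>M\<^sup>*(T) \<rightarrow> T, f \<mapsto> f\<^sub>T(m\<^sub>T)\<close>, indexed by the commutative \<open>S\<close>-algebras \<open>T\<close>, where \<open>m\<^sub>T\<close> is the
  image of \<open>m\<close> in \<open>M(T)\<close> and \<open>f\<^sub>T\<close> is the component of \<open>f\<close> at the \<open>T\<close>-algebra \<open>T\<close>.
\<close>

definition bidual_map ::
  "('u, 'r) ring_scheme \<Rightarrow> ('u, 'm) mfunctor \<Rightarrow> ('u, 'u) module \<Rightarrow> 'm \<Rightarrow>
   ('u, 'u) module \<Rightarrow> (('u, 'u) module \<Rightarrow> 'm \<Rightarrow> 'u) \<Rightarrow> 'u" where
  "bidual_map R M = (\<lambda>S \<in> comm_algebras R. \<lambda>m \<in> carrier (Ob M S).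
     \<lambda>T \<in> comm_algebras S. \<lambda>f \<in> carrier (Ob (dual R M) (base_alg R S T)).
       f (self_alg T) (Ar M S (base_alg R S T) (structure_map S T) m))"

definition reflexive :: "('u, 'r) ring_scheme \<Rightarrow> ('u, 'm) mfunctor \<Rightarrow> bool" where
  "reflexive R M \<longleftrightarrow> functor_iso R M (dual R (dual R M)) (bidual_map R M)"


section \<open>Quasi-coherent modules\<close>

text \<open>
  \<open>V \<otimes>\<^sub>K S\<close> is the quotient of the free abelian group on \<open>V \<times> S\<close> by the subgroup generated by
  the usual relations, with \<open>S\<close> acting on the second factor.
\<close>

abbreviation tensor_free ::
  "('u, 'u) module \<Rightarrow> ('u, 'u) module \<Rightarrow> ('u \<times> 'u \<Rightarrow>\<^sub>0 int) monoid" where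
  "tensor_free V S \<equiv> free_Abelian_group (carrier V \<times> carrier S)"

definition tensor_relations ::
  "('u, 'r) ring_scheme \<Rightarrow> ('u, 'u) module \<Rightarrow> ('u, 'u) module \<Rightarrow> ('u \<times> 'u \<Rightarrow>\<^sub>0 int) set" where
  "tensor_relations K V S = generate (tensor_free V S)
     ({frag_of (v \<oplus>\<^bsub>V\<^esub> w, s) - frag_of (v, s) - frag_of (w, s) | v w s.
         v \<in> carrier V \<and> w \<in> carrier V \<and> s \<in> carrier S} \<union>
      {frag_of (v, s \<oplus>\<^bsub>S\<^esub> t) - frag_of (v, s) - frag_of (v, t) | v s t.
         v \<in> carrier V \<and> s \<in> carrier S \<and> t \<in> carrier S} \<union>
      {frag_of (a \<odot>\<^bsub>V\<^esub> v, s) - frag_of (v, a \<odot>\<^bsub>S\<^esub> s) | a v s.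
         a \<in> carrier K \<and> v \<in> carrier V \<and> s \<in> carrier S})"

text \<open>
  The map \<open>v \<otimes> s \<mapsto> v \<otimes> g s\<close> into \<open>V \<otimes>\<^sub>K T\<close>, for \<open>g\<close> additive and
  \<open>K\<close>-linear. The image of a coset under
  the induced map of free groups lies in a single coset, which the product with the subgroup of
  relations fills up.
\<close>

definition tensor_map ::
  "('u, 'r) ring_scheme \<Rightarrow> ('u, 'u) module \<Rightarrow> ('u, 'u) module \<Rightarrow> ('u \<Rightarrow> 'u) \<Rightarrow>
   ('u \<times> 'u \<Rightarrow>\<^sub>0 int) set \<Rightarrow> ('u \<times> 'u \<Rightarrow>\<^sub>0 int) set" where
  "tensor_map K V T g X = tensor_relations K V T
     <#>\<^bsub>tensor_free V T\<^esub> (frag_extend (\<lambda>(v, s). frag_of (v, g s)) ` X)"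

definition tensor ::
  "('u, 'r) ring_scheme \<Rightarrow> ('u, 'u) module \<Rightarrow> ('u, 'u) module \<Rightarrow>
   ('u, ('u \<times> 'u \<Rightarrow>\<^sub>0 int) set) module" where
  "tensor K V S =
     (let G = tensor_free V S Mod tensor_relations K V S in
     \<lparr>carrier = carrier G, mult = undefined, one = undefined,
      ring.zero = one G, add = monoid.mult G,
      smult = (\<lambda>t. tensor_map K V S (\<lambda>s. t \<otimes>\<^bsub>S\<^esub> s))\<rparr>)"

definition quasi_coherent ::
  "('u, 'r) ring_scheme \<Rightarrow> ('u, 'u) module \<Rightarrow> ('u, ('u \<times> 'u \<Rightarrow>\<^sub>0 int) set) mfunctor" where
  "quasi_coherent K V = \<lparr>Ob = tensor K V, Ar = (\<lambda>S T h. tensor_map K V T h)\<rparr>"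


section \<open>Inverse limits\<close>

definition inverse_system ::
  "('u, 'r) ring_scheme \<Rightarrow> 'i set \<Rightarrow> ('i \<Rightarrow> 'i \<Rightarrow> bool) \<Rightarrow> ('i \<Rightarrow> ('u, 'n) mfunctor) \<Rightarrow>
   ('i \<Rightarrow> 'i \<Rightarrow> ('u, 'u) module \<Rightarrow> 'n \<Rightarrow> 'n) \<Rightarrow> bool" where
  "inverse_system R I ge X \<rho> \<longleftrightarrow>
     (\<forall>i \<in> I. module_functor R (X i)) \<and>
     (\<forall>i \<in> I. ge i i) \<and>
     (\<forall>i \<in> I. \<forall>j \<in> I. \<forall>k \<in> I. ge i j \<longrightarrow> ge j k \<longrightarrow> ge i k) \<and>
     (\<forall>i \<in> I. \<forall>j \<in> I. ge i j \<longrightarrow> \<rho> i j \<in> mor R (X i) (X j)) \<and>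
     (\<forall>i \<in> I. \<rho> i i = id_mor R (X i)) \<and>
     (\<forall>i \<in> I. \<forall>j \<in> I. \<forall>k \<in> I. ge i j \<longrightarrow> ge j k \<longrightarrow>
        \<rho> i k = comp_mor R (X i) (\<rho> j k) (\<rho> i j))"

definition inverse_limit ::
  "'i set \<Rightarrow> ('i \<Rightarrow> 'i \<Rightarrow> bool) \<Rightarrow> ('i \<Rightarrow> ('u, 'n) mfunctor) \<Rightarrow>
   ('i \<Rightarrow> 'i \<Rightarrow> ('u, 'u) module \<Rightarrow> 'n \<Rightarrow> 'n) \<Rightarrow> ('u, 'i \<Rightarrow> 'n) mfunctor" where
  "inverse_limit I ge X \<rho> =
     \<lparr>Ob = (\<lambda>S.
        \<lparr>carrier = {x \<in> \<Pi>\<^sub>E i \<in> I. carrier (Ob (X i) S).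
                     \<forall>i \<in> I. \<forall>j \<in> I. ge i j \<longrightarrow> \<rho> i j S (x i) = x j},
         mult = undefined,
         one = undefined,
         ring.zero = (\<lambda>i \<in> I. \<zero>\<^bsub>Ob (X i) S\<^esub>),
         add = (\<lambda>x y. \<lambda>i \<in> I. x i \<oplus>\<^bsub>Ob (X i) S\<^esub> y i),
         smult = (\<lambda>s x. \<lambda>i \<in> I. s \<odot>\<^bsub>Ob (X i) S\<^esub> x i)\<rparr>),
      Ar = (\<lambda>S T h x. \<lambda>i \<in> I. Ar (X i) S T h (x i))\<rparr>"

text \<open>
  The index set of the inverse system is drawn from the type given as first argument.
\<close>

definition proquasi_coherent ::
  "'i itself \<Rightarrow> ('u, 'r) ring_scheme \<Rightarrow> ('u, 'm) mfunctor \<Rightarrow> bool" where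
  "proquasi_coherent _ K M \<longleftrightarrow>
     (\<exists>(I :: 'i set) ge V \<rho> f.
        (\<forall>i \<in> I. module K (V i)) \<and>
        inverse_system K I ge (\<lambda>i. quasi_coherent K (V i)) \<rho> \<and>
        functor_iso K M (inverse_limit I ge (\<lambda>i. quasi_coherent K (V i)) \<rho>) f)"


section \<open>The system of quasi-coherent quotients\<close>

type_synonym ('u, 'm) quotient =
  "('u, 'u) module \<times> (('u, 'u) module \<Rightarrow> 'm \<Rightarrow> ('u \<times> 'u \<Rightarrow>\<^sub>0 int) set)"

text \<open>
  No representatives of isomorphism classes are chosen: isomorphic quotients \<open>i, j\<close> satisfy
  \<open>i \<ge> j\<close> and \<open>j \<ge> i\<close>, so the limit over this preorder is the limit over the ordered set of
  isomorphism classes.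
\<close>

definition qc_quotients ::
  "('u, 'r) ring_scheme \<Rightarrow> ('u, 'm) mfunctor \<Rightarrow> ('u, 'm) quotient set" where
  "qc_quotients K M = {(V, \<pi>). module K V \<and> functor_epi K M (quasi_coherent K V) \<pi>}"

definition qc_factors ::
  "('u, 'r) ring_scheme \<Rightarrow> ('u, 'm) mfunctor \<Rightarrow> ('u, 'm) quotient \<Rightarrow> ('u, 'm) quotient \<Rightarrow>
   (('u, 'u) module \<Rightarrow> ('u \<times> 'u \<Rightarrow>\<^sub>0 int) set \<Rightarrow> ('u \<times> 'u \<Rightarrow>\<^sub>0 int) set) \<Rightarrow> bool" where
  "qc_factors K M i j g \<longleftrightarrow>
     g \<in> mor K (quasi_coherent K (fst i)) (quasi_coherent K (fst j)) \<and>
     comp_mor K M g (snd i) = snd j"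

definition qc_ge ::
  "('u, 'r) ring_scheme \<Rightarrow> ('u, 'm) mfunctor \<Rightarrow> ('u, 'm) quotient \<Rightarrow> ('u, 'm) quotient \<Rightarrow> bool"
  where "qc_ge K M i j \<longleftrightarrow> (\<exists>g. qc_factors K M i j g)"

text \<open>The factorization is unique because \<^term>\<open>snd i\<close> is an epimorphism.\<close>

definition qc_transition ::
  "('u, 'r) ring_scheme \<Rightarrow> ('u, 'm) mfunctor \<Rightarrow> ('u, 'm) quotient \<Rightarrow> ('u, 'm) quotient \<Rightarrow>
   ('u, 'u) module \<Rightarrow> ('u \<times> 'u \<Rightarrow>\<^sub>0 int) set \<Rightarrow> ('u \<times> 'u \<Rightarrow>\<^sub>0 int) set" where
  "qc_transition K M i j = (THE g. qc_factors K M i j g)"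

definition qc_limit ::
  "('u, 'r) ring_scheme \<Rightarrow> ('u, 'm) mfunctor \<Rightarrow>
   ('u, ('u, 'm) quotient \<Rightarrow> ('u \<times> 'u \<Rightarrow>\<^sub>0 int) set) mfunctor" where
  "qc_limit K M = inverse_limit (qc_quotients K M) (qc_ge K M)
     (\<lambda>i. quasi_coherent K (fst i)) (qc_transition K M)"

definition to_qc_limit ::
  "('u, 'r) ring_scheme \<Rightarrow> ('u, 'm) mfunctor \<Rightarrow>
   ('u, 'u) module \<Rightarrow> 'm \<Rightarrow> ('u, 'm) quotient \<Rightarrow> ('u \<times> 'u \<Rightarrow>\<^sub>0 int) set" where
  "to_qc_limit K M = (\<lambda>S \<in> comm_algebras K. \<lambda>m \<in> carrier (Ob M S).
     \<lambda>i \<in> qc_quotients K M. snd i S m)"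

end

theory Submission
  imports Defs
begin

text \<open>
  An element of \<open>M\<^sup>*(T)\<close> is the same thing as a morphism \<open>f : M \<rightarrow> T\<close> into the quasi-coherent module
  of the vector space underlying the algebra \<open>T\<close>: on \<open>x \<in> M(U)\<close>, for a \<open>T\<close>-algebra \<open>U\<close>, it takes
  the image of \<open>f(x) \<in> T \<otimes> U\<close> under the multiplication \<open>T \<otimes> U \<rightarrow> U\<close>, and \<open>f\<close> is recovered by
  evaluation at the \<open>T\<close>-algebra \<open>T \<otimes> U\<close> (\<open>dual_element_is_functional\<close>,
  \<open>functional_determines\<close>). An element of \<open>M\<^sup>*\<^sup>*(S)\<close> is therefore the same thing as a family of
  elements \<open>z\<^sub>f \<in> V \<otimes> S\<close>, one for each morphism \<open>f\<close> from \<open>M\<close> into a quasi-coherent module \<open>V\<close>, that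
  is natural in \<open>V\<close> (\<open>represents_exists\<close>, \<open>bidual_element_from_family\<close>). So \<open>M\<close> is reflexive if and
  only if it is the limit of all quasi-coherent modules that receive a morphism from it. Duals
  only see algebras, whereas the spaces \<open>V\<close> carry no multiplication; square-zero extensions bridge
  this gap, because a linear map \<open>N \<rightarrow> A\<close> into an algebra is the same as a homomorphism
  \<open>R \<oplus> N \<rightarrow> A[\<epsilon>]\<close> that maps \<open>N\<close> into \<open>A \<epsilon>\<close>.

  It remains to pass from all morphisms \<open>f : M \<rightarrow> V\<close> to the epimorphisms among them. The condition
  that makes this possible is \<open>scalar_liftable\<close>: for \<open>x \<in> M(S)\<close> and a linear form \<open>\<xi>\<close> on \<open>S\<close> there is
  \<open>y \<in> M(K)\<close> such that \<open>f(y) = (1 \<otimes> \<xi>)(f(x))\<close> for all \<open>f\<close>. Let \<open>V' \<subseteq> V\<close> be the image of \<open>M(K)\<close> under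
  \<open>f\<close>. The condition puts \<open>(1 \<otimes> \<xi>)(f(x))\<close> into \<open>V'\<close> for every linear form \<open>\<xi>\<close>, and over a field this
  forces \<open>f(x) \<in> V' \<otimes> S\<close>; so \<open>f\<close> factors through an epimorphism onto the quasi-coherent module of
  \<open>V'\<close> (\<open>factor_through_quotient\<close>), and the compatible families indexed by the quotients are the
  natural families indexed by all morphisms.

  Both sides of the equivalence imply the condition. If \<open>M\<close> is reflexive, the elements
  \<open>(1 \<otimes> \<xi>)(f(x))\<close> form a natural family, hence come from some \<open>y\<close>. If \<open>M\<close> is the limit of its
  quotients \<open>V\<^sub>i\<close>, the maps \<open>1 \<otimes> \<xi> : V\<^sub>i \<otimes> S \<rightarrow> V\<^sub>i\<close> induce a map \<open>M(S) \<rightarrow> M(K)\<close>, and an arbitrary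
  morphism \<open>M \<rightarrow> V\<close> commutes with it by naturality along the homomorphisms
  \<open>K \<oplus> S \<rightarrow> S[\<epsilon>]\<close> and \<open>K \<oplus> S \<rightarrow> K[\<epsilon>]\<close> given by the identity of \<open>S\<close> and by \<open>\<xi>\<close>
  (\<open>limit_scalar_liftable\<close>).

  All algebras have their carriers in one infinite type; tensor products of algebras and
  square-zero extensions are built on other types and then transported along injections.
\<close>

section \<open>Additive and linear maps\<close>

text \<open>
  Linear maps occur here mostly as terms of composites, so that, unlike the members of
  \<open>linear_maps\<close>, they are not required to be extensional.
\<close>

definition additive :: "('a, 'x) ring_scheme \<Rightarrow> ('b, 'y) ring_scheme \<Rightarrow> ('a \<Rightarrow> 'b) \<Rightarrow> bool" where
  "additive A B F \<longleftrightarrow> (\<forall>x \<in> carrier A. F x \<in> carrier B) \<and>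
     (\<forall>x \<in> carrier A. \<forall>y \<in> carrier A. F (x \<oplus>\<^bsub>A\<^esub> y) = F x \<oplus>\<^bsub>B\<^esub> F y)"

definition lin ::
  "('a, 'r) ring_scheme \<Rightarrow> ('a, 'm) module \<Rightarrow> ('a, 'n) module \<Rightarrow> ('m \<Rightarrow> 'n) \<Rightarrow> bool" where
  "lin R V W u \<longleftrightarrow> additive V W u \<and>
     (\<forall>a \<in> carrier R. \<forall>v \<in> carrier V. u (a \<odot>\<^bsub>V\<^esub> v) = a \<odot>\<^bsub>W\<^esub> u v)"

lemma additiveI:
  assumes "\<And>x. x \<in> carrier A \<Longrightarrow> F x \<in> carrier B"
    and "\<And>x y. x \<in> carrier A \<Longrightarrow> y \<in> carrier A \<Longrightarrow> F (x \<oplus>\<^bsub>A\<^esub> y) = F x \<oplus>\<^bsub>B\<^esub> F y"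
  shows "additive A B F"
  using assms by (simp add: additive_def)

lemma additive_closed: "additive A B F \<Longrightarrow> x \<in> carrier A \<Longrightarrow> F x \<in> carrier B"
  by (simp add: additive_def)

lemma additive_add:
  "additive A B F \<Longrightarrow> x \<in> carrier A \<Longrightarrow> y \<in> carrier A \<Longrightarrow> F (x \<oplus>\<^bsub>A\<^esub> y) = F x \<oplus>\<^bsub>B\<^esub> F y"
  by (simp add: additive_def)

lemma additive_zero:
  assumes "additive A B F" "abelian_group A" "abelian_group B"
  shows "F \<zero>\<^bsub>A\<^esub> = \<zero>\<^bsub>B\<^esub>"
proof -
  interpret A: abelian_group A by fact
  interpret B: abelian_group B by fact
  have "F \<zero>\<^bsub>A\<^esub> \<oplus>\<^bsub>B\<^esub> F \<zero>\<^bsub>A\<^esub> = F \<zero>\<^bsub>A\<^esub>"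
    using additive_add[OF assms(1), of "\<zero>\<^bsub>A\<^esub>" "\<zero>\<^bsub>A\<^esub>"] by simp
  then show ?thesis
    using additive_closed[OF assms(1) A.zero_closed] by (metis B.add.r_cancel_one' )
qed

lemma additive_minus:
  assumes "additive A B F" "abelian_group A" "abelian_group B" "x \<in> carrier A"
  shows "F (\<ominus>\<^bsub>A\<^esub> x) = \<ominus>\<^bsub>B\<^esub> F x"
proof -
  interpret A: abelian_group A by fact
  interpret B: abelian_group B by fact
  have "F (\<ominus>\<^bsub>A\<^esub> x) \<oplus>\<^bsub>B\<^esub> F x = \<zero>\<^bsub>B\<^esub>"
    using additive_add[OF assms(1), of "\<ominus>\<^bsub>A\<^esub> x" x] assms additive_zero[OF assms(1-3)]
    by (simp add: A.l_neg)
  then show ?thesis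
    using assms additive_closed[OF assms(1)] by (metis A.a_inv_closed B.minus_equality)
qed

lemma additive_diff:
  assumes "additive A B F" "abelian_group A" "abelian_group B" "x \<in> carrier A" "y \<in> carrier A"
  shows "F (x \<ominus>\<^bsub>A\<^esub> y) = F x \<ominus>\<^bsub>B\<^esub> F y"
proof -
  interpret A: abelian_group A by fact
  interpret B: abelian_group B by fact
  show ?thesis
    using assms additive_add[OF assms(1), of x "\<ominus>\<^bsub>A\<^esub> y"] additive_minus[OF assms(1-3), of y]
    by (simp add: A.minus_eq B.minus_eq)
qed

lemma additive_comp:
  "additive A B F \<Longrightarrow> additive B C G \<Longrightarrow> additive A C (\<lambda>x. G (F x))"
  by (simp add: additive_def)

lemma linI:
  assumes "\<And>x. x \<in> carrier V \<Longrightarrow> u x \<in> carrier W"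
    and "\<And>x y. x \<in> carrier V \<Longrightarrow> y \<in> carrier V \<Longrightarrow> u (x \<oplus>\<^bsub>V\<^esub> y) = u x \<oplus>\<^bsub>W\<^esub> u y"
    and "\<And>a x. a \<in> carrier R \<Longrightarrow> x \<in> carrier V \<Longrightarrow> u (a \<odot>\<^bsub>V\<^esub> x) = a \<odot>\<^bsub>W\<^esub> u x"
  shows "lin R V W u"
  using assms by (simp add: additive_def lin_def)

lemma lin_additive: "lin R V W u \<Longrightarrow> additive V W u"
  by (simp add: lin_def)

lemma lin_closed: "lin R V W u \<Longrightarrow> x \<in> carrier V \<Longrightarrow> u x \<in> carrier W"
  by (simp add: lin_def additive_def)

lemma lin_add:
  "lin R V W u \<Longrightarrow> x \<in> carrier V \<Longrightarrow> y \<in> carrier V \<Longrightarrow> u (x \<oplus>\<^bsub>V\<^esub> y) = u x \<oplus>\<^bsub>W\<^esub> u y"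
  by (simp add: lin_def additive_def)

lemma lin_smult:
  "lin R V W u \<Longrightarrow> a \<in> carrier R \<Longrightarrow> x \<in> carrier V \<Longrightarrow> u (a \<odot>\<^bsub>V\<^esub> x) = a \<odot>\<^bsub>W\<^esub> u x"
  by (simp add: lin_def)

lemma lin_zero:
  assumes "lin R V W u" "module R V" "module R W"
  shows "u \<zero>\<^bsub>V\<^esub> = \<zero>\<^bsub>W\<^esub>"
  using additive_zero[OF lin_additive[OF assms(1)]] assms(2,3) by (simp add: module_def)

lemma lin_id: "lin R V V (\<lambda>x. x)"
  by (simp add: lin_def additive_def)

lemma lin_comp: "lin R U V u \<Longrightarrow> lin R V W w \<Longrightarrow> lin R U W (\<lambda>x. w (u x))"
  by (simp add: lin_def additive_def)

lemma lin_cong: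
  assumes u: "lin R V W u" and eq: "\<And>x. x \<in> carrier V \<Longrightarrow> u' x = u x" and "module R V"
  shows "lin R V W u'"
proof -
  interpret module R V by fact
  show ?thesis
    by (rule linI) (simp_all add: eq lin_closed[OF u] lin_add[OF u] lin_smult[OF u])
qed

lemma lin_plus:
  assumes "lin R V W u" "lin R V W u'" "module R V" "module R W"
  shows "lin R V W (\<lambda>x. u x \<oplus>\<^bsub>W\<^esub> u' x)"
proof -
  interpret V: module R V by fact
  interpret W: module R W by fact
  show ?thesis
    using lin_closed[OF assms(1)] lin_closed[OF assms(2)]
    by (intro linI) (auto simp: lin_add[OF assms(1)] lin_add[OF assms(2)] lin_smult[OF assms(1)]
        lin_smult[OF assms(2)] W.add.m_ac W.smult_r_distr)
qed

lemma linear_maps_iff: "f \<in> linear_maps R M N \<longleftrightarrow> f \<in> extensional (carrier M) \<and> lin R M N f"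
  by (auto simp: linear_maps_def lin_def additive_def PiE_def)

section \<open>The tensor product\<close>

text \<open>
  The tensor \<open>v \<otimes> s\<close>. Once the universal property and \<open>tensor_map\<close> have been described in terms of
  these elements, cosets in the free group do not occur any more.
\<close>

definition pure ::
  "('u, 'r) ring_scheme \<Rightarrow> ('u, 'u) module \<Rightarrow> ('u, 'u) module \<Rightarrow> 'u \<Rightarrow> 'u \<Rightarrow> ('u \<times> 'u \<Rightarrow>\<^sub>0 int) set"
  where "pure K V S v s = tensor_relations K V S #>\<^bsub>tensor_free V S\<^esub> frag_of (v, s)"

definition balanced ::
  "('u, 'r) ring_scheme \<Rightarrow> ('u, 'u) module \<Rightarrow> ('u, 'u) module \<Rightarrow> ('n, 'x) ring_scheme \<Rightarrow>
   ('u \<Rightarrow> 'u \<Rightarrow> 'n) \<Rightarrow> bool" where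
  "balanced K V S N \<beta> \<longleftrightarrow>
     (\<forall>v \<in> carrier V. \<forall>s \<in> carrier S. \<beta> v s \<in> carrier N) \<and>
     (\<forall>v \<in> carrier V. \<forall>w \<in> carrier V. \<forall>s \<in> carrier S. \<beta> (v \<oplus>\<^bsub>V\<^esub> w) s = \<beta> v s \<oplus>\<^bsub>N\<^esub> \<beta> w s) \<and>
     (\<forall>v \<in> carrier V. \<forall>s \<in> carrier S. \<forall>t \<in> carrier S. \<beta> v (s \<oplus>\<^bsub>S\<^esub> t) = \<beta> v s \<oplus>\<^bsub>N\<^esub> \<beta> v t) \<and>
     (\<forall>a \<in> carrier K. \<forall>v \<in> carrier V. \<forall>s \<in> carrier S. \<beta> (a \<odot>\<^bsub>V\<^esub> v) s = \<beta> v (a \<odot>\<^bsub>S\<^esub> s))"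

lemma balancedI:
  assumes "\<And>v s. v \<in> carrier V \<Longrightarrow> s \<in> carrier S \<Longrightarrow> \<beta> v s \<in> carrier N"
    and "\<And>v w s. v \<in> carrier V \<Longrightarrow> w \<in> carrier V \<Longrightarrow> s \<in> carrier S \<Longrightarrow>
           \<beta> (v \<oplus>\<^bsub>V\<^esub> w) s = \<beta> v s \<oplus>\<^bsub>N\<^esub> \<beta> w s"
    and "\<And>v s t. v \<in> carrier V \<Longrightarrow> s \<in> carrier S \<Longrightarrow> t \<in> carrier S \<Longrightarrow>
           \<beta> v (s \<oplus>\<^bsub>S\<^esub> t) = \<beta> v s \<oplus>\<^bsub>N\<^esub> \<beta> v t"
    and "\<And>a v s. a \<in> carrier K \<Longrightarrow> v \<in> carrier V \<Longrightarrow> s \<in> carrier S \<Longrightarrow>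
           \<beta> (a \<odot>\<^bsub>V\<^esub> v) s = \<beta> v (a \<odot>\<^bsub>S\<^esub> s)"
  shows "balanced K V S N \<beta>"
  using assms by (simp add: balanced_def)

definition tensor_lift ::
  "('u, 'r) ring_scheme \<Rightarrow> ('u, 'u) module \<Rightarrow> ('u, 'u) module \<Rightarrow> ('n, 'x) ring_scheme \<Rightarrow>
   ('u \<Rightarrow> 'u \<Rightarrow> 'n) \<Rightarrow> ('u \<times> 'u \<Rightarrow>\<^sub>0 int) set \<Rightarrow> 'n" where
  "tensor_lift K V S N \<beta> = (SOME F. additive (tensor K V S) N F \<and>
     (\<forall>v \<in> carrier V. \<forall>s \<in> carrier S. F (pure K V S v s) = \<beta> v s))"

locale tensor_pair =
  fixes K :: "('u, 'r) ring_scheme" and V S :: "('u, 'u) module"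
  assumes V_module: "module K V" and S_module: "module K S"
begin

interpretation V: module K V by (rule V_module)
interpretation S: module K S by (rule S_module)

abbreviation "F \<equiv> tensor_free V S"
abbreviation "rel \<equiv> tensor_relations K V S"

lemma comm_group_F: "comm_group F"
  by (rule abelian_free_Abelian_group)

interpretation F: comm_group F by (rule comm_group_F)

lemma generators_closed:
  "({frag_of (v \<oplus>\<^bsub>V\<^esub> w, s) - frag_of (v, s) - frag_of (w, s) | v w s.
         v \<in> carrier V \<and> w \<in> carrier V \<and> s \<in> carrier S} \<union>
      {frag_of (v, s \<oplus>\<^bsub>S\<^esub> t) - frag_of (v, s) - frag_of (v, t) | v s t.
         v \<in> carrier V \<and> s \<in> carrier S \<and> t \<in> carrier S} \<union>
      {frag_of (a \<odot>\<^bsub>V\<^esub> v, s) - frag_of (v, a \<odot>\<^bsub>S\<^esub> s) | a v s.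
         a \<in> carrier K \<and> v \<in> carrier V \<and> s \<in> carrier S}) \<subseteq> carrier F"
proof -
  have diff: "x - y \<in> carrier F" if "x \<in> carrier F" "y \<in> carrier F" for x y
    using that keys_diff[of x y] by auto
  show ?thesis
    by (safe; intro diff; simp)
qed

lemma subgroup_rel: "subgroup rel F"
  unfolding tensor_relations_def by (rule F.generate_is_subgroup[OF generators_closed])

lemma normal_rel: "rel \<lhd> F"
  by (rule F.subgroup_imp_normal[OF subgroup_rel])

interpretation rel: normal rel F by (rule normal_rel)

lemma carrier_tensor: "carrier (tensor K V S) = (\<lambda>x. rel #>\<^bsub>F\<^esub> x) ` carrier F"
  by (auto simp: tensor_def Let_def FactGroup_def RCOSETS_def)

lemma add_tensor_coset:
  "x \<in> carrier F \<Longrightarrow> y \<in> carrier F \<Longrightarrow>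
   (rel #>\<^bsub>F\<^esub> x) \<oplus>\<^bsub>tensor K V S\<^esub> (rel #>\<^bsub>F\<^esub> y) = rel #>\<^bsub>F\<^esub> (x + y)"
  using rel.rcos_sum[of x y] by (simp add: tensor_def Let_def FactGroup_def)

lemma zero_tensor: "\<zero>\<^bsub>tensor K V S\<^esub> = rel"
  by (simp add: tensor_def Let_def FactGroup_def)

lemma coset_eqI:
  assumes "x \<in> carrier F" "y \<in> carrier F" "x - y \<in> rel"
  shows "rel #>\<^bsub>F\<^esub> x = rel #>\<^bsub>F\<^esub> y"
proof -
  have "x \<in> rel #>\<^bsub>F\<^esub> y"
    using assms by (auto simp: r_coset_def intro!: bexI[of _ "x - y"])
  then show ?thesis
    using F.repr_independence[OF _ assms(2) subgroup_rel] by metis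
qed

lemma abelian_tensor: "abelian_group (tensor K V S)"
proof -
  interpret G: comm_group "F Mod rel"
    by (rule F.abelian_FactGroup[OF subgroup_rel])
  have eqs: "carrier (tensor K V S) = carrier (F Mod rel)"
    "add (tensor K V S) = monoid.mult (F Mod rel)" "\<zero>\<^bsub>tensor K V S\<^esub> = \<one>\<^bsub>F Mod rel\<^esub>"
    by (simp_all only: tensor_def Let_def partial_object.simps ring.simps)
  show ?thesis
    by (rule abelian_groupI; unfold eqs)
      (rule G.m_closed G.one_closed G.m_assoc G.m_comm G.l_one G.l_inv_ex; assumption)+
qed

lemma pure_closed [simp]:
  "v \<in> carrier V \<Longrightarrow> s \<in> carrier S \<Longrightarrow> pure K V S v s \<in> carrier (tensor K V S)"
  by (auto simp: pure_def carrier_tensor)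

lemma pure_add_left:
  assumes "v \<in> carrier V" "w \<in> carrier V" "s \<in> carrier S"
  shows "pure K V S (v \<oplus>\<^bsub>V\<^esub> w) s = pure K V S v s \<oplus>\<^bsub>tensor K V S\<^esub> pure K V S w s"
proof -
  have "frag_of (v \<oplus>\<^bsub>V\<^esub> w, s) - frag_of (v, s) - frag_of (w, s) \<in> rel"
    unfolding tensor_relations_def by (rule generate.incl) (use assms in blast)
  then have "rel #>\<^bsub>F\<^esub> frag_of (v \<oplus>\<^bsub>V\<^esub> w, s) = rel #>\<^bsub>F\<^esub> (frag_of (v, s) + frag_of (w, s))"
    using assms F.m_closed[of "frag_of (v,s)" "frag_of (w,s)"]
    by (intro coset_eqI) (auto simp: algebra_simps)
  then show ?thesis
    using assms by (simp add: pure_def add_tensor_coset)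
qed

lemma pure_add_right:
  assumes "v \<in> carrier V" "s \<in> carrier S" "t \<in> carrier S"
  shows "pure K V S v (s \<oplus>\<^bsub>S\<^esub> t) = pure K V S v s \<oplus>\<^bsub>tensor K V S\<^esub> pure K V S v t"
proof -
  have "frag_of (v, s \<oplus>\<^bsub>S\<^esub> t) - frag_of (v, s) - frag_of (v, t) \<in> rel"
    unfolding tensor_relations_def by (rule generate.incl) (use assms in blast)
  then have "rel #>\<^bsub>F\<^esub> frag_of (v, s \<oplus>\<^bsub>S\<^esub> t) = rel #>\<^bsub>F\<^esub> (frag_of (v, s) + frag_of (v, t))"
    using assms F.m_closed[of "frag_of (v,s)" "frag_of (v,t)"]
    by (intro coset_eqI) (auto simp: algebra_simps)
  then show ?thesis
    using assms by (simp add: pure_def add_tensor_coset)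
qed

lemma pure_balanced:
  assumes "a \<in> carrier K" "v \<in> carrier V" "s \<in> carrier S"
  shows "pure K V S (a \<odot>\<^bsub>V\<^esub> v) s = pure K V S v (a \<odot>\<^bsub>S\<^esub> s)"
proof -
  have "frag_of (a \<odot>\<^bsub>V\<^esub> v, s) - frag_of (v, a \<odot>\<^bsub>S\<^esub> s) \<in> rel"
    unfolding tensor_relations_def by (rule generate.incl) (use assms in blast)
  then show ?thesis
    unfolding pure_def using assms by (intro coset_eqI) auto
qed

lemma pure_zero_left:
  assumes "s \<in> carrier S"
  shows "pure K V S \<zero>\<^bsub>V\<^esub> s = \<zero>\<^bsub>tensor K V S\<^esub>"
proof -
  interpret T: abelian_group "tensor K V S" by (rule abelian_tensor)
  show ?thesis
    using pure_add_left[of "\<zero>\<^bsub>V\<^esub>" "\<zero>\<^bsub>V\<^esub>" s] assms pure_closed[of "\<zero>\<^bsub>V\<^esub>" s]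
    by (metis T.add.r_cancel_one' V.M.zero_closed V.M.l_zero)
qed

lemma pure_zero_right:
  assumes "v \<in> carrier V"
  shows "pure K V S v \<zero>\<^bsub>S\<^esub> = \<zero>\<^bsub>tensor K V S\<^esub>"
proof -
  interpret T: abelian_group "tensor K V S" by (rule abelian_tensor)
  show ?thesis
    using pure_add_right[of v "\<zero>\<^bsub>S\<^esub>" "\<zero>\<^bsub>S\<^esub>"] assms pure_closed[of v "\<zero>\<^bsub>S\<^esub>"]
    by (metis T.add.r_cancel_one' S.M.zero_closed S.M.l_zero)
qed

text \<open>
  Sums of pure tensors suffice, as differences are absorbed by \<open>- (v \<otimes> s) = (- v) \<otimes> s\<close>.
\<close>

lemma tensor_induct [consumes 1, case_names pure add]:
  assumes "z \<in> carrier (tensor K V S)"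
    and pure: "\<And>v s. v \<in> carrier V \<Longrightarrow> s \<in> carrier S \<Longrightarrow> P (pure K V S v s)"
    and add: "\<And>x y. x \<in> carrier (tensor K V S) \<Longrightarrow> y \<in> carrier (tensor K V S) \<Longrightarrow> P x \<Longrightarrow> P y \<Longrightarrow>
                P (x \<oplus>\<^bsub>tensor K V S\<^esub> y)"
  shows "P z"
proof -
  interpret T: abelian_group "tensor K V S" by (rule abelian_tensor)
  obtain x where x: "x \<in> carrier F" and z: "z = rel #>\<^bsub>F\<^esub> x"
    using assms(1) by (auto simp: carrier_tensor)
  have neg: "rel #>\<^bsub>F\<^esub> (- frag_of (v, s)) = pure K V S (\<ominus>\<^bsub>V\<^esub> v) s"
    if "v \<in> carrier V" "s \<in> carrier S" for v s
  proof -
    have "pure K V S (\<ominus>\<^bsub>V\<^esub> v) s \<oplus>\<^bsub>tensor K V S\<^esub> pure K V S v s = \<zero>\<^bsub>tensor K V S\<^esub>"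
      using that by (simp add: V.M.l_neg pure_zero_left flip: pure_add_left)
    moreover have "(rel #>\<^bsub>F\<^esub> (- frag_of (v, s))) \<oplus>\<^bsub>tensor K V S\<^esub> pure K V S v s = \<zero>\<^bsub>tensor K V S\<^esub>"
      using that rel.subset F.coset_mult_one by (simp add: pure_def add_tensor_coset zero_tensor)
    moreover have "rel #>\<^bsub>F\<^esub> (- frag_of (v, s)) \<in> carrier (tensor K V S)"
      using that by (auto simp: carrier_tensor)
    ultimately show ?thesis
      using that by (metis T.add.inv_equality V.M.a_inv_closed pure_closed T.minus_equality)
  qed
  have "Poly_Mapping.keys x \<subseteq> carrier V \<times> carrier S" using x by simp
  then have "P (rel #>\<^bsub>F\<^esub> x) \<and> P (rel #>\<^bsub>F\<^esub> (- x))"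
  proof (induction rule: free_Abelian_group_induct[consumes 1])
    case 1
    have "rel #>\<^bsub>F\<^esub> 0 = pure K V S \<zero>\<^bsub>V\<^esub> \<zero>\<^bsub>S\<^esub>"
      using pure_zero_left[of "\<zero>\<^bsub>S\<^esub>"] rel.subset F.coset_mult_one by (simp add: zero_tensor)
    then show ?case using pure[of "\<zero>\<^bsub>V\<^esub>" "\<zero>\<^bsub>S\<^esub>"] by simp
  next
    case (2 x y)
    have "rel #>\<^bsub>F\<^esub> (x - y) = (rel #>\<^bsub>F\<^esub> x) \<oplus>\<^bsub>tensor K V S\<^esub> (rel #>\<^bsub>F\<^esub> (- y))"
      "rel #>\<^bsub>F\<^esub> (- (x - y)) = (rel #>\<^bsub>F\<^esub> y) \<oplus>\<^bsub>tensor K V S\<^esub> (rel #>\<^bsub>F\<^esub> (- x))"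
      using 2 by (simp_all add: add_tensor_coset)
    moreover have "rel #>\<^bsub>F\<^esub> x \<in> carrier (tensor K V S)" "rel #>\<^bsub>F\<^esub> y \<in> carrier (tensor K V S)"
      "rel #>\<^bsub>F\<^esub> (- x) \<in> carrier (tensor K V S)" "rel #>\<^bsub>F\<^esub> (- y) \<in> carrier (tensor K V S)"
      using 2 by (auto simp: carrier_tensor)
    ultimately show ?case
      using 2 add by presburger
  next
    case (3 a)
    then obtain v s where "a = (v, s)" "v \<in> carrier V" "s \<in> carrier S" by auto
    then show ?case
      using pure[of v s] pure[of "\<ominus>\<^bsub>V\<^esub> v" s] neg[of v s] by (simp add: pure_def)
  qed
  then show ?thesis by (simp add: z)
qed

lemma additive_tensor_eqI:
  assumes "additive (tensor K V S) N F1" "additive (tensor K V S) N F2"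
    and "\<And>v s. v \<in> carrier V \<Longrightarrow> s \<in> carrier S \<Longrightarrow> F1 (pure K V S v s) = F2 (pure K V S v s)"
    and "z \<in> carrier (tensor K V S)"
  shows "F1 z = F2 z"
  using assms(4)
  by (induction rule: tensor_induct)
    (simp_all add: assms(3) additive_add[OF assms(1)] additive_add[OF assms(2)])

text \<open>
  This is what makes the homomorphism on the free group that extends a balanced map descend to
  the tensor product.
\<close>

lemma hom_kills_relations:
  assumes "abelian_group N" and \<beta>: "balanced K V S N \<beta>"
    and h: "h \<in> hom F (add_monoid N)"
    and h_of: "\<And>x. x \<in> carrier V \<times> carrier S \<Longrightarrow> h (frag_of x) = \<beta> (fst x) (snd x)"
    and "r \<in> rel"
  shows "h r = \<zero>\<^bsub>N\<^esub>"
proof -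
  interpret N: abelian_group N by fact
  interpret h: group_hom F "add_monoid N" h
    using h by (auto simp: group_hom_def group_hom_axioms_def N.a_group F.is_group)
  have diff: "h (x - y) = \<zero>\<^bsub>N\<^esub>" if "x \<in> carrier F" "y \<in> carrier F" "h x = h y" for x y
  proof -
    have "h (x - y) = h (x \<otimes>\<^bsub>F\<^esub> inv\<^bsub>F\<^esub> y)"
      using that by simp
    also have "\<dots> = h x \<oplus>\<^bsub>N\<^esub> h (inv\<^bsub>F\<^esub> y)"
      using that h.hom_mult[of x "inv\<^bsub>F\<^esub> y"] F.inv_closed[OF that(2)] by simp
    also have "\<dots> = \<zero>\<^bsub>N\<^esub>"
      using that h.hom_inv[OF that(2)] h.hom_closed[OF that(1)] h.hom_closed[OF that(2)]
        N.add.r_inv[of "h y"] by (simp add: a_inv_def)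
    finally show ?thesis .
  qed
  have plus: "h (x + y) = h x \<oplus>\<^bsub>N\<^esub> h y" if "x \<in> carrier F" "y \<in> carrier F" for x y
    using that h.hom_mult[of x y] by simp
  have r: "r \<in> generate F ({frag_of (v \<oplus>\<^bsub>V\<^esub> w, s) - frag_of (v, s) - frag_of (w, s) | v w s.
         v \<in> carrier V \<and> w \<in> carrier V \<and> s \<in> carrier S} \<union>
      {frag_of (v, s \<oplus>\<^bsub>S\<^esub> t) - frag_of (v, s) - frag_of (v, t) | v s t.
         v \<in> carrier V \<and> s \<in> carrier S \<and> t \<in> carrier S} \<union>
      {frag_of (a \<odot>\<^bsub>V\<^esub> v, s) - frag_of (v, a \<odot>\<^bsub>S\<^esub> s) | a v s.
         a \<in> carrier K \<and> v \<in> carrier V \<and> s \<in> carrier S})" (is "r \<in> generate F ?G")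
    using assms(5) by (simp add: tensor_relations_def)
  have gen: "h g = \<zero>\<^bsub>N\<^esub>" if "g \<in> ?G" for g
  proof -
    have b: "\<beta> v s \<in> carrier N" if "v \<in> carrier V" "s \<in> carrier S" for v s
      using \<beta> that by (simp add: balanced_def)
    consider v w s where "g = frag_of (v \<oplus>\<^bsub>V\<^esub> w, s) - (frag_of (v, s) + frag_of (w, s))"
        "v \<in> carrier V" "w \<in> carrier V" "s \<in> carrier S"
      | v s t where "g = frag_of (v, s \<oplus>\<^bsub>S\<^esub> t) - (frag_of (v, s) + frag_of (v, t))"
        "v \<in> carrier V" "s \<in> carrier S" "t \<in> carrier S"
      | a v s where "g = frag_of (a \<odot>\<^bsub>V\<^esub> v, s) - frag_of (v, a \<odot>\<^bsub>S\<^esub> s)"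
        "a \<in> carrier K" "v \<in> carrier V" "s \<in> carrier S"
      using \<open>g \<in> ?G\<close> by (fastforce simp: diff_diff_eq)
    then show ?thesis
    proof cases
      case 1
      have "h (frag_of (v, s) + frag_of (w, s)) = \<beta> v s \<oplus>\<^bsub>N\<^esub> \<beta> w s"
        using 1 by (simp add: plus h_of)
      then show ?thesis
        using 1 \<beta> F.m_closed[of "frag_of (v,s)" "frag_of (w,s)"]
        by (auto intro!: diff simp: h_of balanced_def)
    next
      case 2
      have "h (frag_of (v, s) + frag_of (v, t)) = \<beta> v s \<oplus>\<^bsub>N\<^esub> \<beta> v t"
        using 2 by (simp add: plus h_of)
      then show ?thesis
        using 2 \<beta> F.m_closed[of "frag_of (v,s)" "frag_of (v,t)"]
        by (auto intro!: diff simp: h_of balanced_def)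
    next
      case 3
      then show ?thesis
        using \<beta> by (auto intro!: diff simp: h_of balanced_def)
    qed
  qed
  from r show ?thesis
  proof (induction rule: generate.induct)
    case one
    then show ?case using h.hom_one by simp
  next
    case (incl x)
    then show ?case by (rule gen)
  next
    case (inv x)
    have "x \<in> carrier F" by (rule subsetD[OF generators_closed inv(1)])
    then show ?case using h.hom_inv[of x] gen[OF inv(1)] N.add.inv_one by simp
  next
    case (eng x y)
    have "x \<in> carrier F" "y \<in> carrier F"
      using F.generate_in_carrier[OF generators_closed eng(1)]
        F.generate_in_carrier[OF generators_closed eng(2)] .
    then show ?case using h.hom_mult[of x y] eng by simp
  qed
qed

lemma lift_exists:
  assumes "abelian_group N" and \<beta>: "balanced K V S N \<beta>"
  shows "\<exists>L. additive (tensor K V S) N L \<and>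
     (\<forall>v \<in> carrier V. \<forall>s \<in> carrier S. L (pure K V S v s) = \<beta> v s)"
proof -
  interpret N: abelian_group N by fact
  have \<beta>_closed: "(\<lambda>x. \<beta> (fst x) (snd x)) ` (carrier V \<times> carrier S) \<subseteq> carrier (add_monoid N)"
    using \<beta> by (auto simp: balanced_def)
  obtain h where h: "h \<in> hom F (add_monoid N)"
    and h_of: "\<And>x. x \<in> carrier V \<times> carrier S \<Longrightarrow> h (frag_of x) = \<beta> (fst x) (snd x)"
    by (rule comm_group.free_Abelian_group_universal[OF N.a_comm_group \<beta>_closed])
      (blast intro: that)
  note kills = hom_kills_relations[OF assms h h_of]
  have h_add: "h (x + y) = h x \<oplus>\<^bsub>N\<^esub> h y" if "x \<in> carrier F" "y \<in> carrier F" for x y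
    using hom_mult[OF h that] by simp
  have h_closed: "h x \<in> carrier N" if "x \<in> carrier F" for x
    using hom_in_carrier[OF h that] by simp
  define L where "L X = h (SOME x. x \<in> X)" for X
  have L: "L (rel #>\<^bsub>F\<^esub> x) = h x" if x: "x \<in> carrier F" for x
  proof -
    have "(SOME y. y \<in> rel #>\<^bsub>F\<^esub> x) \<in> rel #>\<^bsub>F\<^esub> x"
      using F.rcos_self[OF x subgroup_rel] by (rule someI)
    then obtain r where r: "r \<in> rel" "(SOME y. y \<in> rel #>\<^bsub>F\<^esub> x) = r + x"
      by (auto simp: r_coset_def)
    then show ?thesis
      using h_add[of r x] x kills[OF _ r(1)] h_closed[OF x] rel.subset
      by (auto simp: L_def)
  qed
  have "additive (tensor K V S) N L"
  proof (rule additiveI)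
    fix X assume "X \<in> carrier (tensor K V S)"
    then obtain x where "x \<in> carrier F" "X = rel #>\<^bsub>F\<^esub> x" unfolding carrier_tensor by blast
    then show "L X \<in> carrier N" using L h_closed by simp
  next
    fix X Y assume "X \<in> carrier (tensor K V S)" "Y \<in> carrier (tensor K V S)"
    then obtain x y where xy: "x \<in> carrier F" "X = rel #>\<^bsub>F\<^esub> x" "y \<in> carrier F" "Y = rel #>\<^bsub>F\<^esub> y"
      unfolding carrier_tensor by blast
    have "x + y \<in> carrier F"
      using F.m_closed[OF xy(1,3)] by simp
    then show "L (X \<oplus>\<^bsub>tensor K V S\<^esub> Y) = L X \<oplus>\<^bsub>N\<^esub> L Y"
      using xy by (simp only: add_tensor_coset L h_add)
  qed
  moreover have "L (pure K V S v s) = \<beta> v s" if "v \<in> carrier V" "s \<in> carrier S" for v s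
    using L[of "frag_of (v, s)"] h_of[of "(v, s)"] that by (simp add: pure_def)
  ultimately show ?thesis by blast
qed

lemma tensor_lift_additive:
  "abelian_group N \<Longrightarrow> balanced K V S N \<beta> \<Longrightarrow> additive (tensor K V S) N (tensor_lift K V S N \<beta>)"
  using someI_ex[OF lift_exists] unfolding tensor_lift_def by blast

lemma tensor_lift_pure:
  "abelian_group N \<Longrightarrow> balanced K V S N \<beta> \<Longrightarrow> v \<in> carrier V \<Longrightarrow> s \<in> carrier S \<Longrightarrow>
   tensor_lift K V S N \<beta> (pure K V S v s) = \<beta> v s"
  using someI_ex[OF lift_exists] unfolding tensor_lift_def by blast

text \<open>
  A tensor product is a quotient of a free abelian group, and the free abelian group on an
  infinite set has the cardinality of that set.
\<close>

lemma tensor_inj_into_universe: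
  assumes "infinite (UNIV :: 'u set)"
  shows "\<exists>e :: ('u \<times> 'u \<Rightarrow>\<^sub>0 int) set \<Rightarrow> 'u. inj_on e (carrier (tensor K V S))"
proof -
  have U: "(UNIV :: ('u \<times> 'u) set) \<approx> (UNIV :: 'u set)"
    using card_of_Times_same_infinite[OF assms] by (simp add: eqpoll_iff_card_of_ordIso)
  have inf2: "infinite (UNIV :: ('u \<times> 'u) set)"
    using assms U eqpoll_finite_iff by blast
  have "carrier (tensor K V S) \<lesssim> carrier F"
    unfolding carrier_tensor by (rule image_lepoll)
  also have "\<dots> \<lesssim> carrier (free_Abelian_group (UNIV :: ('u \<times> 'u) set))"
    by (rule subset_imp_lepoll) auto
  also have "\<dots> \<approx> (UNIV :: ('u \<times> 'u) set)"
    by (rule eqpoll_free_Abelian_group_infinite[OF inf2])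
  also note U
  finally show ?thesis by (auto simp: lepoll_def)
qed

end

section \<open>Commutative algebras\<close>

lemma comm_algebras_algebra: "A \<in> comm_algebras R \<Longrightarrow> algebra R A"
  by (simp add: comm_algebras_def)

lemma comm_algebras_module: "A \<in> comm_algebras R \<Longrightarrow> module R A"
  by (simp add: comm_algebras_def algebra.module)

lemma comm_algebras_cring: "A \<in> comm_algebras R \<Longrightarrow> cring A"
  by (rule algebra.M_cring[OF comm_algebras_algebra])

lemma alg_homI:
  assumes "h \<in> extensional (carrier A)"
    and "\<And>x. x \<in> carrier A \<Longrightarrow> h x \<in> carrier B"
    and "\<And>x y. x \<in> carrier A \<Longrightarrow> y \<in> carrier A \<Longrightarrow> h (x \<oplus>\<^bsub>A\<^esub> y) = h x \<oplus>\<^bsub>B\<^esub> h y"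
    and "\<And>x y. x \<in> carrier A \<Longrightarrow> y \<in> carrier A \<Longrightarrow> h (x \<otimes>\<^bsub>A\<^esub> y) = h x \<otimes>\<^bsub>B\<^esub> h y"
    and "h \<one>\<^bsub>A\<^esub> = \<one>\<^bsub>B\<^esub>"
    and "\<And>a x. a \<in> carrier R \<Longrightarrow> x \<in> carrier A \<Longrightarrow> h (a \<odot>\<^bsub>A\<^esub> x) = a \<odot>\<^bsub>B\<^esub> h x"
  shows "h \<in> alg_hom R A B"
  using assms by (auto simp: alg_hom_def ring_hom_def)

lemma alg_hom_lin: "h \<in> alg_hom R A B \<Longrightarrow> lin R A B h"
  by (auto simp: alg_hom_def ring_hom_def lin_def additive_def Pi_iff)

lemma alg_hom_mult:
  "h \<in> alg_hom R A B \<Longrightarrow> x \<in> carrier A \<Longrightarrow> y \<in> carrier A \<Longrightarrow> h (x \<otimes>\<^bsub>A\<^esub> y) = h x \<otimes>\<^bsub>B\<^esub> h y"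
  by (simp add: alg_hom_def ring_hom_def)

lemma alg_hom_one: "h \<in> alg_hom R A B \<Longrightarrow> h \<one>\<^bsub>A\<^esub> = \<one>\<^bsub>B\<^esub>"
  by (simp add: alg_hom_def ring_hom_def)

lemma alg_hom_extensional: "h \<in> alg_hom R A B \<Longrightarrow> h \<in> extensional (carrier A)"
  by (simp add: alg_hom_def)

lemma algebra_lin_mult:
  assumes "algebra K S" "t \<in> carrier S"
  shows "lin K S S (\<lambda>s. t \<otimes>\<^bsub>S\<^esub> s)"
proof -
  interpret algebra K S by fact
  show ?thesis
    using assms(2) by (intro linI) (auto simp: r_distr, metis m_comm smult_assoc2 smult_closed)
qed

definition scalar_alg :: "('u, 'r) ring_scheme \<Rightarrow> ('u, 'u) module" where
  "scalar_alg K = \<lparr>carrier = carrier K, mult = monoid.mult K, one = \<one>\<^bsub>K\<^esub>, ring.zero = \<zero>\<^bsub>K\<^esub>,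
     add = ring.add K,
     smult = (\<lambda>a x. if a \<in> carrier K \<and> x \<in> carrier K then a \<otimes>\<^bsub>K\<^esub> x else undefined)\<rparr>"

lemma scalar_alg_simps [simp]:
  "carrier (scalar_alg K) = carrier K" "monoid.mult (scalar_alg K) = monoid.mult K"
  "\<one>\<^bsub>scalar_alg K\<^esub> = \<one>\<^bsub>K\<^esub>" "\<zero>\<^bsub>scalar_alg K\<^esub> = \<zero>\<^bsub>K\<^esub>" "ring.add (scalar_alg K) = ring.add K"
  "a \<in> carrier K \<Longrightarrow> x \<in> carrier K \<Longrightarrow> a \<odot>\<^bsub>scalar_alg K\<^esub> x = a \<otimes>\<^bsub>K\<^esub> x"
  by (simp_all add: scalar_alg_def)

lemma cring_transfer:
  assumes "cring A" "carrier B = carrier A" "monoid.mult B = monoid.mult A" "\<one>\<^bsub>B\<^esub> = \<one>\<^bsub>A\<^esub>"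
    "\<zero>\<^bsub>B\<^esub> = \<zero>\<^bsub>A\<^esub>" "ring.add B = ring.add A"
  shows "cring B"
proof -
  interpret A: cring A by fact
  have "abelian_group B"
    by (rule abelian_groupI; unfold assms(2-6))
      (rule A.add.m_closed A.zero_closed A.add.m_assoc A.add.m_comm A.l_zero
        A.add.l_inv_ex[simplified]; assumption)+
  moreover have "Group.comm_monoid B"
    by (rule comm_monoidI; unfold assms(2-6))
      (rule A.m_closed A.one_closed A.m_assoc A.m_comm A.l_one; assumption)+
  ultimately show ?thesis
    by (rule cringI; unfold assms(2-6)) (rule A.l_distr; assumption)
qed

lemma scalar_alg_closed:
  assumes "cring K"
  shows "scalar_alg K \<in> comm_algebras K"
proof -
  interpret cring K by fact
  have "cring (scalar_alg K)"
    by (rule cring_transfer[OF assms]) simp_all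
  then have "algebra K (scalar_alg K)"
    by (intro algebraI) (simp_all add: assms l_distr r_distr m_assoc)
  then show ?thesis
    by (auto simp: comm_algebras_def scalar_alg_def)
qed

lemma structure_map_apply [simp]:
  "a \<in> carrier R \<Longrightarrow> structure_map R A a = a \<odot>\<^bsub>A\<^esub> \<one>\<^bsub>A\<^esub>"
  by (simp add: structure_map_def)

lemma structure_map_scalar_alg:
  assumes "A \<in> comm_algebras K"
  shows "structure_map K A \<in> alg_hom K (scalar_alg K) A"
proof -
  interpret algebra K A by (rule comm_algebras_algebra[OF assms])
  show ?thesis
    by (rule alg_homI)
      (simp_all add: structure_map_def smult_l_distr smult_assoc1 smult_assoc2)
qed

section \<open>Functoriality of the tensor product\<close>

text \<open>
  The map \<open>(v, s) \<mapsto> (v, g s)\<close> of free groups sends each generating relation to a relation of the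
  same kind, so \<open>tensor_map\<close> acts on cosets through representatives.
\<close>

lemma tensor_map_coset:
  assumes V: "module K V" and S: "module K S" and T: "module K T" and g: "lin K S T g"
    and x: "x \<in> carrier (tensor_free V S)"
  defines "E \<equiv> frag_extend (\<lambda>(v, s). frag_of (v, g s))"
  shows "E x \<in> carrier (tensor_free V T)"
    and "tensor_map K V T g (tensor_relations K V S #>\<^bsub>tensor_free V S\<^esub> x)
           = tensor_relations K V T #>\<^bsub>tensor_free V T\<^esub> E x"
proof -
  interpret S: tensor_pair K V S by (intro tensor_pair.intro V S)
  interpret T: tensor_pair K V T by (intro tensor_pair.intro V T)
  interpret FS: comm_group "tensor_free V S" by (rule S.comm_group_F)
  interpret FT: comm_group "tensor_free V T" by (rule T.comm_group_F)
  interpret RS: subgroup "tensor_relations K V S" "tensor_free V S" by (rule S.subgroup_rel)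
  interpret RT: subgroup "tensor_relations K V T" "tensor_free V T" by (rule T.subgroup_rel)
  have E_closed: "E y \<in> carrier (tensor_free V T)" if "y \<in> carrier (tensor_free V S)" for y
    using that keys_frag_extend[of "\<lambda>(v, s). frag_of (v, g s)" y]
    by (fastforce simp: E_def dest: lin_closed[OF g])
  then show "E x \<in> carrier (tensor_free V T)" using x by blast
  have E_diff: "E (a - b) = E a - E b" and E_add: "E (a + b) = E a + E b"
    and E_of: "E (frag_of (v, s)) = frag_of (v, g s)" for a b v s
    by (simp_all add: E_def frag_extend_diff frag_extend_add)
  have E_rel: "E r \<in> tensor_relations K V T" if "r \<in> tensor_relations K V S" for r
    using that unfolding tensor_relations_def[of K V S]
  proof (induction rule: generate.induct)
    case one
    then show ?case using RT.one_closed by (simp add: E_def)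
  next
    case (incl h)
    then show ?case
      unfolding tensor_relations_def
      by (intro generate.incl)
        (auto simp: E_diff E_of lin_add[OF g] lin_smult[OF g] dest: lin_closed[OF g], (blast dest: lin_closed[OF g])+)
  next
    case (inv h)
    have h: "h \<in> carrier (tensor_free V S)" by (rule subsetD[OF S.generators_closed inv])
    have "E h \<in> tensor_relations K V T"
      unfolding tensor_relations_def using inv
      by (intro generate.incl)
        (auto simp: E_diff E_of lin_add[OF g] lin_smult[OF g] dest: lin_closed[OF g], (blast dest: lin_closed[OF g])+)
    moreover have "E (inv\<^bsub>tensor_free V S\<^esub> h) = inv\<^bsub>tensor_free V T\<^esub> (E h)"
      using h E_closed[OF h] by (simp add: E_def frag_extend_minus)
    ultimately show ?case using RT.m_inv_closed by simp
  next
    case (eng h1 h2)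
    then show ?case using RT.m_closed by (simp add: E_add)
  qed
  show "tensor_map K V T g (tensor_relations K V S #>\<^bsub>tensor_free V S\<^esub> x)
           = tensor_relations K V T #>\<^bsub>tensor_free V T\<^esub> E x" (is "?l = ?r")
  proof
    have "r' + E (r + x) \<in> ?r" if "r' \<in> tensor_relations K V T" "r \<in> tensor_relations K V S" for r r'
    proof -
      have "r' + E r \<in> tensor_relations K V T"
        using RT.m_closed[OF that(1) E_rel[OF that(2)]] by simp
      then show ?thesis
        by (auto simp: r_coset_def E_add add.assoc intro!: bexI[of _ "r' + E r"])
    qed
    then show "?l \<subseteq> ?r"
      by (auto simp: tensor_map_def set_mult_def r_coset_def[of "tensor_free V S"] simp flip: E_def)
    show "?r \<subseteq> ?l"
    proof
      fix y assume "y \<in> ?r"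
      then obtain r' where "r' \<in> tensor_relations K V T" "y = r' + E x"
        by (auto simp: r_coset_def)
      moreover have "x \<in> tensor_relations K V S #>\<^bsub>tensor_free V S\<^esub> x"
        by (rule FS.rcos_self[OF x S.subgroup_rel])
      ultimately show "y \<in> ?l"
        by (auto simp: tensor_map_def set_mult_def simp flip: E_def)
    qed
  qed
qed

lemma tensor_map_pure:
  assumes V: "module K V" and S: "module K S" and T: "module K T" and g: "lin K S T g"
    and "v \<in> carrier V" "s \<in> carrier S"
  shows "tensor_map K V T g (pure K V S v s) = pure K V T v (g s)"
  using tensor_map_coset(2)[OF V S T g, of "frag_of (v, s)"] assms(5,6) by (simp add: pure_def)

lemma tensor_map_additive:
  assumes V: "module K V" and S: "module K S" and T: "module K T" and g: "lin K S T g"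
  shows "additive (tensor K V S) (tensor K V T) (tensor_map K V T g)"
proof -
  interpret S: tensor_pair K V S by (intro tensor_pair.intro V S)
  interpret T: tensor_pair K V T by (intro tensor_pair.intro V T)
  interpret FS: comm_group "tensor_free V S" by (rule S.comm_group_F)
  note c = tensor_map_coset[OF assms]
  show ?thesis
  proof (rule additiveI)
    fix X assume "X \<in> carrier (tensor K V S)"
    then obtain x where x: "x \<in> carrier (tensor_free V S)"
      "X = tensor_relations K V S #>\<^bsub>tensor_free V S\<^esub> x"
      unfolding S.carrier_tensor by blast
    show "tensor_map K V T g X \<in> carrier (tensor K V T)"
      unfolding T.carrier_tensor x(2) c(2)[OF x(1)] using c(1)[OF x(1)] by blast
  next
    fix X Y assume "X \<in> carrier (tensor K V S)" "Y \<in> carrier (tensor K V S)"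
    then obtain x y where x: "x \<in> carrier (tensor_free V S)"
      "X = tensor_relations K V S #>\<^bsub>tensor_free V S\<^esub> x" and y: "y \<in> carrier (tensor_free V S)"
      "Y = tensor_relations K V S #>\<^bsub>tensor_free V S\<^esub> y"
      unfolding S.carrier_tensor by blast
    have xy: "x + y \<in> carrier (tensor_free V S)"
      using FS.m_closed[OF x(1) y(1)] by simp
    show "tensor_map K V T g (X \<oplus>\<^bsub>tensor K V S\<^esub> Y)
        = tensor_map K V T g X \<oplus>\<^bsub>tensor K V T\<^esub> tensor_map K V T g Y"
      unfolding x(2) y(2) S.add_tensor_coset[OF x(1) y(1)] c(2)[OF x(1)] c(2)[OF y(1)] c(2)[OF xy]
        T.add_tensor_coset[OF c(1)[OF x(1)] c(1)[OF y(1)]]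
      by (simp only: frag_extend_add)
  qed
qed

lemma tensor_smult_eq:
  "t \<odot>\<^bsub>tensor K V S\<^esub> z = tensor_map K V S (\<lambda>s. t \<otimes>\<^bsub>S\<^esub> s) z"
  by (simp add: tensor_def Let_def)

lemma tensor_smult_pure:
  assumes "module K V" "algebra K S" "t \<in> carrier S" "v \<in> carrier V" "s \<in> carrier S"
  shows "t \<odot>\<^bsub>tensor K V S\<^esub> pure K V S v s = pure K V S v (t \<otimes>\<^bsub>S\<^esub> s)"
  using assms
  by (simp add: tensor_smult_eq tensor_map_pure[OF _ _ _ algebra_lin_mult] algebra.module)

lemma tensor_module:
  assumes V: "module K V" and S: "algebra K S"
  shows "module S (tensor K V S)"
proof -
  interpret S: algebra K S by fact
  interpret tp: tensor_pair K V S by (intro tensor_pair.intro V S.module)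
  interpret T: abelian_group "tensor K V S" by (rule tp.abelian_tensor)
  have add: "additive (tensor K V S) (tensor K V S) (\<lambda>z. t \<odot>\<^bsub>tensor K V S\<^esub> z)" if "t \<in> carrier S" for t
    unfolding tensor_smult_eq
    by (rule tensor_map_additive[OF V S.module S.module algebra_lin_mult[OF S that]])
  note [simp] = additive_closed[OF add] additive_add[OF add] tensor_smult_pure[OF V S]
  show ?thesis
  proof (rule moduleI)
    show "cring S" by (rule S.M_cring)
    show "abelian_group (tensor K V S)" by (rule tp.abelian_tensor)
  next
    fix a b z assume ab: "a \<in> carrier S" "b \<in> carrier S" and z: "z \<in> carrier (tensor K V S)"
    from z show "(a \<oplus>\<^bsub>S\<^esub> b) \<odot>\<^bsub>tensor K V S\<^esub> z = a \<odot>\<^bsub>tensor K V S\<^esub> z \<oplus>\<^bsub>tensor K V S\<^esub> b \<odot>\<^bsub>tensor K V S\<^esub> z"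
      using ab
      by (induction z rule: tp.tensor_induct)
        (simp_all add: S.l_distr tp.pure_add_right T.a_ac)
    show "a \<otimes>\<^bsub>S\<^esub> b \<odot>\<^bsub>tensor K V S\<^esub> z = a \<odot>\<^bsub>tensor K V S\<^esub> (b \<odot>\<^bsub>tensor K V S\<^esub> z)"
      using z ab
      by (induction z rule: tp.tensor_induct) (simp_all add: S.m_assoc)
  next
    fix z assume "z \<in> carrier (tensor K V S)"
    then show "\<one>\<^bsub>S\<^esub> \<odot>\<^bsub>tensor K V S\<^esub> z = z"
      by (induction z rule: tp.tensor_induct) simp_all
  qed simp_all
qed

definition left_map ::
  "('u, 'r) ring_scheme \<Rightarrow> ('u, 'u) module \<Rightarrow> ('u, 'u) module \<Rightarrow> ('u, 'u) module \<Rightarrow> ('u \<Rightarrow> 'u) \<Rightarrow>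
   ('u \<times> 'u \<Rightarrow>\<^sub>0 int) set \<Rightarrow> ('u \<times> 'u \<Rightarrow>\<^sub>0 int) set" where
  "left_map K V S W u = tensor_lift K V S (tensor K W S) (\<lambda>v s. pure K W S (u v) s)"

lemma
  assumes V: "module K V" and S: "module K S" and W: "module K W" and u: "lin K V W u"
  shows left_map_additive: "additive (tensor K V S) (tensor K W S) (left_map K V S W u)"
    and left_map_pure: "\<And>v s. v \<in> carrier V \<Longrightarrow> s \<in> carrier S \<Longrightarrow>
      left_map K V S W u (pure K V S v s) = pure K W S (u v) s"
proof -
  interpret V: tensor_pair K V S by (intro tensor_pair.intro V S)
  interpret W: tensor_pair K W S by (intro tensor_pair.intro W S)
  have "balanced K V S (tensor K W S) (\<lambda>v s. pure K W S (u v) s)"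
    by (rule balancedI)
      (auto simp: lin_add[OF u] lin_smult[OF u] lin_closed[OF u] W.pure_add_left W.pure_add_right
        W.pure_balanced)
  from V.tensor_lift_additive[OF W.abelian_tensor this] V.tensor_lift_pure[OF W.abelian_tensor this]
  show "additive (tensor K V S) (tensor K W S) (left_map K V S W u)"
    "\<And>v s. v \<in> carrier V \<Longrightarrow> s \<in> carrier S \<Longrightarrow>
      left_map K V S W u (pure K V S v s) = pure K W S (u v) s"
    by (simp_all add: left_map_def)
qed

lemma left_map_closed:
  assumes "module K V" "module K S" "module K W" "lin K V W u" "z \<in> carrier (tensor K V S)"
  shows "left_map K V S W u z \<in> carrier (tensor K W S)"
  using additive_closed[OF left_map_additive] assms by blast

lemma tensor_map_closed:
  assumes "module K V" "module K S" "module K T" "lin K S T g" "z \<in> carrier (tensor K V S)"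
  shows "tensor_map K V T g z \<in> carrier (tensor K V T)"
  using additive_closed[OF tensor_map_additive] assms by blast

lemma left_map_lin:
  assumes V: "module K V" and S: "algebra K S" and W: "module K W" and u: "lin K V W u"
  shows "lin S (tensor K V S) (tensor K W S) (left_map K V S W u)"
proof -
  interpret S: algebra K S by fact
  interpret V: tensor_pair K V S by (intro tensor_pair.intro V S.module)
  interpret TV: module S "tensor K V S" by (rule tensor_module[OF V S])
  interpret TW: module S "tensor K W S" by (rule tensor_module[OF W S])
  note add = left_map_additive[OF V S.module W u]
  show ?thesis
  proof (rule linI)
    fix a z assume a: "a \<in> carrier S" and "z \<in> carrier (tensor K V S)"
    from this(2) show "left_map K V S W u (a \<odot>\<^bsub>tensor K V S\<^esub> z) = a \<odot>\<^bsub>tensor K W S\<^esub> left_map K V S W u z"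
      by (induction rule: V.tensor_induct)
        (use a in \<open>simp_all add: tensor_smult_pure[OF V S] tensor_smult_pure[OF W S]
          left_map_pure[OF V S.module W u] lin_closed[OF u] TV.smult_r_distr TW.smult_r_distr
          additive_add[OF add] additive_closed[OF add]\<close>)
  qed (simp_all add: additive_closed[OF add] additive_add[OF add])
qed

lemma left_map_comp:
  assumes V: "module K V" and S: "module K S" and W: "module K W" and X: "module K X"
    and u: "lin K V W u" and w: "lin K W X w" and z: "z \<in> carrier (tensor K V S)"
  shows "left_map K W S X w (left_map K V S W u z) = left_map K V S X (\<lambda>v. w (u v)) z"
proof -
  interpret V: tensor_pair K V S by (intro tensor_pair.intro V S)
  show ?thesis
    by (rule V.additive_tensor_eqI[OF additive_comp[OF left_map_additive left_map_additive]
          left_map_additive _ z])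
      (auto intro: assms lin_comp simp: left_map_pure assms lin_comp[OF u w] lin_closed[OF u])
qed

lemma left_map_cong:
  assumes V: "module K V" and S: "module K S" and W: "module K W"
    and u: "lin K V W u" and eq: "\<And>v. v \<in> carrier V \<Longrightarrow> w v = u v" and z: "z \<in> carrier (tensor K V S)"
  shows "left_map K V S W w z = left_map K V S W u z"
proof -
  interpret V: tensor_pair K V S by (intro tensor_pair.intro V S)
  have w: "lin K V W w" by (rule lin_cong[OF u eq V])
  show ?thesis
    by (rule V.additive_tensor_eqI[OF left_map_additive left_map_additive _ z])
      (auto intro: assms w simp: left_map_pure assms w)
qed

lemma left_map_id:
  assumes V: "module K V" and S: "module K S" and z: "z \<in> carrier (tensor K V S)"
  shows "left_map K V S V (\<lambda>v. v) z = z"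
proof -
  interpret V: tensor_pair K V S by (intro tensor_pair.intro V S)
  have "additive (tensor K V S) (tensor K V S) (\<lambda>z. z)" by (simp add: additive_def)
  then show ?thesis
    by (rule V.additive_tensor_eqI[OF left_map_additive[OF V S V lin_id] _ _ z])
      (simp add: left_map_pure[OF V S V lin_id])
qed

lemma left_map_tensor_map:
  assumes V: "module K V" and S: "module K S" and W: "module K W" and T: "module K T"
    and u: "lin K V W u" and g: "lin K S T g" and z: "z \<in> carrier (tensor K V S)"
  shows "left_map K V T W u (tensor_map K V T g z) = tensor_map K W T g (left_map K V S W u z)"
proof -
  interpret V: tensor_pair K V S by (intro tensor_pair.intro V S)
  show ?thesis
    by (rule V.additive_tensor_eqI[OF additive_comp[OF tensor_map_additive left_map_additive]
          additive_comp[OF left_map_additive tensor_map_additive] _ z])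
      (auto intro: assms simp: left_map_pure[OF V _ W u] tensor_map_pure[OF _ S T g] assms
        lin_closed[OF u] lin_closed[OF g])
qed

lemma tensor_map_comp:
  assumes V: "module K V" and S: "module K S" and T: "module K T" and U: "module K U"
    and g: "lin K S T g" and h: "lin K T U h" and z: "z \<in> carrier (tensor K V S)"
  shows "tensor_map K V U h (tensor_map K V T g z) = tensor_map K V U (\<lambda>s. h (g s)) z"
proof -
  interpret V: tensor_pair K V S by (intro tensor_pair.intro V S)
  show ?thesis
    by (rule V.additive_tensor_eqI[OF additive_comp[OF tensor_map_additive tensor_map_additive]
          tensor_map_additive _ z])
      (auto intro: assms lin_comp simp: tensor_map_pure[OF V] S T U g h lin_comp[OF g h]
        lin_closed[OF g])
qed

lemma tensor_map_cong:
  assumes V: "module K V" and S: "module K S" and T: "module K T"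
    and g: "lin K S T g" and eq: "\<And>s. s \<in> carrier S \<Longrightarrow> h s = g s" and z: "z \<in> carrier (tensor K V S)"
  shows "tensor_map K V T h z = tensor_map K V T g z"
proof -
  interpret V: tensor_pair K V S by (intro tensor_pair.intro V S)
  have h: "lin K S T h" by (rule lin_cong[OF g eq S])
  show ?thesis
    by (rule V.additive_tensor_eqI[OF tensor_map_additive tensor_map_additive _ z])
      (auto intro: assms h simp: tensor_map_pure[OF V S T] eq g h)
qed

lemma tensor_map_id:
  assumes V: "module K V" and S: "module K S" and z: "z \<in> carrier (tensor K V S)"
  shows "tensor_map K V S (\<lambda>s. s) z = z"
proof -
  interpret V: tensor_pair K V S by (intro tensor_pair.intro V S)
  have "additive (tensor K V S) (tensor K V S) (\<lambda>z. z)" by (simp add: additive_def)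
  then show ?thesis
    by (rule V.additive_tensor_eqI[OF tensor_map_additive[OF V S S lin_id] _ _ z])
      (simp add: tensor_map_pure[OF V S S lin_id])
qed

lemma tensor_map_smult:
  assumes V: "module K V" and S: "S \<in> comm_algebras K" and T: "T \<in> comm_algebras K"
    and h: "h \<in> alg_hom K S T" and s: "s \<in> carrier S" and z: "z \<in> carrier (tensor K V S)"
  shows "tensor_map K V T h (s \<odot>\<^bsub>tensor K V S\<^esub> z) = h s \<odot>\<^bsub>tensor K V T\<^esub> tensor_map K V T h z"
proof -
  note SA = comm_algebras_algebra[OF S] and TA = comm_algebras_algebra[OF T]
  note SM = comm_algebras_module[OF S] and TM = comm_algebras_module[OF T]
  interpret S: algebra K S by (rule SA)
  interpret T: algebra K T by (rule TA)
  interpret V: tensor_pair K V S by (intro tensor_pair.intro V SM)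
  interpret TS: module S "tensor K V S" by (rule tensor_module[OF V SA])
  interpret TT: module T "tensor K V T" by (rule tensor_module[OF V TA])
  note l = alg_hom_lin[OF h]
  note add = tensor_map_additive[OF V SM TM l]
  from z show ?thesis
    by (induction rule: V.tensor_induct)
      (use s in \<open>simp_all add: tensor_smult_pure[OF V] SA TA tensor_map_pure[OF V SM TM l]
        lin_closed[OF l] alg_hom_mult[OF h] TS.smult_r_distr TT.smult_r_distr additive_add[OF add]
        additive_closed[OF add]\<close>)
qed

section \<open>Quasi-coherent modules\<close>

lemma quasi_coherent_simps [simp]:
  "Ob (quasi_coherent K V) S = tensor K V S"
  "Ar (quasi_coherent K V) S T h = tensor_map K V T h"
  by (simp_all add: quasi_coherent_def)

lemma quasi_coherent_functor:
  assumes "cring K" and V: "module K V"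
  shows "module_functor K (quasi_coherent K V)"
proof (intro module_functor.intro module_functor_axioms.intro, goal_cases)
  case 1
  show ?case by fact
next
  case (2 S)
  then show ?case by (simp add: tensor_module[OF V comm_algebras_algebra])
next
  case (3 S T h x)
  then show ?case
    using tensor_map_closed[OF V comm_algebras_module comm_algebras_module alg_hom_lin] by simp
next
  case (4 S x)
  note m = comm_algebras_module[OF 4(1)]
  have "tensor_map K V S (\<lambda>s\<in>carrier S. s) x = tensor_map K V S (\<lambda>s. s) x"
    by (rule tensor_map_cong[OF V m m lin_id]) (use 4 in simp_all)
  then show ?case
    using 4 by (simp add: tensor_map_id[OF V m])
next
  case (5 S T U h k x)
  note l = alg_hom_lin[OF 5(4)] alg_hom_lin[OF 5(5)] and m = 5(1-3)[THEN comm_algebras_module]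
  have "tensor_map K V U (compose (carrier S) k h) x = tensor_map K V U (\<lambda>s. k (h s)) x"
    by (rule tensor_map_cong[OF V m(1,3) lin_comp[OF l]]) (use 5 in \<open>simp_all add: compose_eq\<close>)
  then show ?case
    using 5 by (simp add: tensor_map_comp[OF V m l])
next
  case (6 S T h x y)
  then show ?case
    using additive_add[OF tensor_map_additive[OF V]] by (simp add: comm_algebras_module alg_hom_lin)
next
  case (7 S T h s x)
  then show ?case by (simp add: tensor_map_smult[OF V])
qed

lemma morI:
  assumes "f \<in> extensional (comm_algebras R)"
    and "\<And>S. S \<in> comm_algebras R \<Longrightarrow> f S \<in> extensional (carrier (Ob M S))"
    and "\<And>S. S \<in> comm_algebras R \<Longrightarrow> lin S (Ob M S) (Ob N S) (f S)"
    and "\<And>S T h x. S \<in> comm_algebras R \<Longrightarrow> T \<in> comm_algebras R \<Longrightarrow> h \<in> alg_hom R S T \<Longrightarrow>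
          x \<in> carrier (Ob M S) \<Longrightarrow> f T (Ar M S T h x) = Ar N S T h (f S x)"
  shows "f \<in> mor R M N"
  using assms by (simp add: mor_def linear_maps_iff)

lemma mor_lin: "f \<in> mor R M N \<Longrightarrow> S \<in> comm_algebras R \<Longrightarrow> lin S (Ob M S) (Ob N S) (f S)"
  by (simp add: mor_def linear_maps_iff)

lemma mor_closed:
  "f \<in> mor R M N \<Longrightarrow> S \<in> comm_algebras R \<Longrightarrow> x \<in> carrier (Ob M S) \<Longrightarrow> f S x \<in> carrier (Ob N S)"
  by (rule lin_closed[OF mor_lin])

lemma mor_natural:
  "f \<in> mor R M N \<Longrightarrow> S \<in> comm_algebras R \<Longrightarrow> T \<in> comm_algebras R \<Longrightarrow> h \<in> alg_hom R S T \<Longrightarrow>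
   x \<in> carrier (Ob M S) \<Longrightarrow> f T (Ar M S T h x) = Ar N S T h (f S x)"
  by (simp add: mor_def)

lemma mor_extensional:
  "f \<in> mor R M N \<Longrightarrow> f \<in> extensional (comm_algebras R)"
  "f \<in> mor R M N \<Longrightarrow> S \<in> comm_algebras R \<Longrightarrow> f S \<in> extensional (carrier (Ob M S))"
  by (simp_all add: mor_def linear_maps_iff)

lemma mor_eqI:
  assumes "f \<in> mor R M N" "g \<in> mor R M N'"
    and "\<And>S x. S \<in> comm_algebras R \<Longrightarrow> x \<in> carrier (Ob M S) \<Longrightarrow> f S x = g S x"
  shows "f = g"
proof (rule extensionalityI[OF mor_extensional(1)[OF assms(1)] mor_extensional(1)[OF assms(2)]])
  fix S assume S: "S \<in> comm_algebras R"
  show "f S = g S"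
    by (rule extensionalityI[OF mor_extensional(2)[OF assms(1) S] mor_extensional(2)[OF assms(2) S]])
      (rule assms(3)[OF S])
qed

text \<open>The composite of \<open>f : M \<rightarrow> V\<close> with the morphism \<open>u \<otimes> 1 : V \<rightarrow> W\<close> of quasi-coherent modules.\<close>

definition push ::
  "('u, 'r) ring_scheme \<Rightarrow> ('u, 'm) mfunctor \<Rightarrow> ('u, 'u) module \<Rightarrow> ('u, 'u) module \<Rightarrow> ('u \<Rightarrow> 'u) \<Rightarrow>
   (('u, 'u) module \<Rightarrow> 'm \<Rightarrow> ('u \<times> 'u \<Rightarrow>\<^sub>0 int) set) \<Rightarrow>
   ('u, 'u) module \<Rightarrow> 'm \<Rightarrow> ('u \<times> 'u \<Rightarrow>\<^sub>0 int) set" where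
  "push K M V W u f = (\<lambda>S \<in> comm_algebras K. \<lambda>x \<in> carrier (Ob M S). left_map K V S W u (f S x))"

lemma push_apply [simp]:
  "S \<in> comm_algebras K \<Longrightarrow> x \<in> carrier (Ob M S) \<Longrightarrow> push K M V W u f S x = left_map K V S W u (f S x)"
  by (simp add: push_def)

lemma push_mor:
  assumes M: "module_functor K M" and V: "module K V" and W: "module K W" and u: "lin K V W u"
    and f: "f \<in> mor K M (quasi_coherent K V)"
  shows "push K M V W u f \<in> mor K M (quasi_coherent K W)"
proof -
  interpret M: module_functor K M by fact
  have f_closed: "f S x \<in> carrier (tensor K V S)" if "S \<in> comm_algebras K" "x \<in> carrier (Ob M S)" for S x
    using mor_closed[OF f that] by simp
  show ?thesis
  proof (rule morI)
    fix S assume S: "S \<in> comm_algebras K"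
    interpret MS: module S "Ob M S" by (rule M.Ob_module[OF S])
    have l: "lin S (Ob M S) (tensor K V S) (f S)" using mor_lin[OF f S] by simp
    have "lin S (Ob M S) (tensor K W S) (\<lambda>x. left_map K V S W u (f S x))"
      by (rule lin_comp[OF l left_map_lin[OF V comm_algebras_algebra[OF S] W u]])
    then have "lin S (Ob M S) (tensor K W S) (push K M V W u f S)"
      by (rule lin_cong) (simp_all add: S MS.module_axioms)
    then show "lin S (Ob M S) (Ob (quasi_coherent K W) S) (push K M V W u f S)" by simp
  next
    fix S T h x assume *: "S \<in> comm_algebras K" "T \<in> comm_algebras K" "h \<in> alg_hom K S T"
      "x \<in> carrier (Ob M S)"
    then show "push K M V W u f T (Ar M S T h x) = Ar (quasi_coherent K W) S T h (push K M V W u f S x)"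
      using mor_natural[OF f *]
        left_map_tensor_map[OF V _ W _ u alg_hom_lin, of S T h "f S x"] f_closed
      by (simp add: M.Ar_closed comm_algebras_module)
  qed (simp_all add: push_def)
qed

section \<open>Extension of scalars along the ground ring\<close>

text \<open>
  The isomorphism \<open>V \<otimes> K \<rightarrow> V\<close>.
\<close>

definition scalar_part ::
  "('u, 'r) ring_scheme \<Rightarrow> ('u, 'u) module \<Rightarrow> ('u \<times> 'u \<Rightarrow>\<^sub>0 int) set \<Rightarrow> 'u" where
  "scalar_part K V = tensor_lift K V (scalar_alg K) V (\<lambda>v a. a \<odot>\<^bsub>V\<^esub> v)"

lemma
  assumes V: "module K V"
  shows scalar_part_additive: "additive (tensor K V (scalar_alg K)) V (scalar_part K V)"
    and scalar_part_pure: "\<And>v a. v \<in> carrier V \<Longrightarrow> a \<in> carrier K \<Longrightarrow>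
      scalar_part K V (pure K V (scalar_alg K) v a) = a \<odot>\<^bsub>V\<^esub> v"
    and pure_scalar_part: "\<And>z. z \<in> carrier (tensor K V (scalar_alg K)) \<Longrightarrow>
      pure K V (scalar_alg K) (scalar_part K V z) \<one>\<^bsub>K\<^esub> = z"
proof -
  interpret V: module K V by fact
  note K1 = comm_algebras_module[OF scalar_alg_closed[OF V.is_cring]]
  interpret tp: tensor_pair K V "scalar_alg K" by (intro tensor_pair.intro V K1)
  have "balanced K V (scalar_alg K) V (\<lambda>v a. a \<odot>\<^bsub>V\<^esub> v)"
    by (rule balancedI) (simp_all add: V.smult_r_distr V.smult_l_distr V.R.m_comm flip: V.smult_assoc1)
  from tp.tensor_lift_additive[OF V.abelian_group_axioms this]
    tp.tensor_lift_pure[OF V.abelian_group_axioms this]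
  show sp_add: "additive (tensor K V (scalar_alg K)) V (scalar_part K V)"
    and sp_pure: "\<And>v a. v \<in> carrier V \<Longrightarrow> a \<in> carrier K \<Longrightarrow>
      scalar_part K V (pure K V (scalar_alg K) v a) = a \<odot>\<^bsub>V\<^esub> v"
    by (simp_all add: scalar_part_def)
  show "pure K V (scalar_alg K) (scalar_part K V z) \<one>\<^bsub>K\<^esub> = z"
    if "z \<in> carrier (tensor K V (scalar_alg K))" for z
    using that
  proof (induction rule: tp.tensor_induct)
    case (pure v s)
    then show ?case
      using tp.pure_balanced[of s v "\<one>\<^bsub>K\<^esub>"]

      by (simp add: sp_pure)
  next
    case (add x y)
    then show ?case
      using tp.pure_add_left[of "scalar_part K V x" "scalar_part K V y" "\<one>\<^bsub>K\<^esub>"]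
      by (simp add: additive_add[OF sp_add] additive_closed[OF sp_add])
  qed
qed

lemma scalar_part_smult:
  assumes V: "module K V" and a: "a \<in> carrier K" and z: "z \<in> carrier (tensor K V (scalar_alg K))"
  shows "scalar_part K V (a \<odot>\<^bsub>tensor K V (scalar_alg K)\<^esub> z) = a \<odot>\<^bsub>V\<^esub> scalar_part K V z"
proof -
  interpret V: module K V by fact
  note K1 = comm_algebras_algebra[OF scalar_alg_closed[OF V.is_cring]]
  note c = additive_closed[OF scalar_part_additive[OF V] z]
  have "scalar_part K V (a \<odot>\<^bsub>tensor K V (scalar_alg K)\<^esub> (pure K V (scalar_alg K) (scalar_part K V z) \<one>\<^bsub>K\<^esub>))
      = a \<odot>\<^bsub>V\<^esub> scalar_part K V z"
    using a c by (simp add: tensor_smult_pure[OF V K1] scalar_part_pure[OF V])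
  then show ?thesis by (simp add: pure_scalar_part[OF V z])
qed

lemma pure_as_scalar_extension:
  assumes V: "module K V" and S: "S \<in> comm_algebras K" and v: "v \<in> carrier V" and s: "s \<in> carrier S"
  shows "pure K V S v s
    = s \<odot>\<^bsub>tensor K V S\<^esub> tensor_map K V S (structure_map K S) (pure K V (scalar_alg K) v \<one>\<^bsub>K\<^esub>)"
proof -
  interpret V: module K V by fact
  interpret S: algebra K S by (rule comm_algebras_algebra[OF S])
  note K1 = scalar_alg_closed[OF V.is_cring]
  show ?thesis
    using v s
    by (simp add: tensor_map_pure[OF V comm_algebras_module[OF K1] S.module
        alg_hom_lin[OF structure_map_scalar_alg[OF S]]] tensor_smult_pure[OF V S.algebra_axioms])
qed

text \<open>
  The value on \<open>v \<otimes> s\<close> of a morphism of quasi-coherent modules is \<open>s\<close> times the image under \<open>K \<rightarrow> S\<close> of its value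
  on \<open>v \<otimes> 1 \<in> V \<otimes> K = V\<close>.
\<close>

lemma quasi_coherent_mor_linear:
  assumes V: "module K V" and W: "module K W"
    and \<phi>: "\<phi> \<in> mor K (quasi_coherent K V) (quasi_coherent K W)"
  obtains u where "lin K V W u"
    and "\<And>S z. S \<in> comm_algebras K \<Longrightarrow> z \<in> carrier (tensor K V S) \<Longrightarrow> \<phi> S z = left_map K V S W u z"
proof
  interpret V: module K V by fact
  interpret W: module K W by fact
  let ?K1 = "scalar_alg K"
  note K1 = scalar_alg_closed[OF V.is_cring]
  note K1M = comm_algebras_module[OF K1] and K1A = comm_algebras_algebra[OF K1]
  interpret tp: tensor_pair K V ?K1 by (intro tensor_pair.intro V K1M)
  have l: "lin S (tensor K V S) (tensor K W S) (\<phi> S)" if "S \<in> comm_algebras K" for S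
    using mor_lin[OF \<phi> that] by simp
  define u where "u v = scalar_part K W (\<phi> ?K1 (pure K V ?K1 v \<one>\<^bsub>K\<^esub>))" for v
  have c: "\<phi> ?K1 (pure K V ?K1 v \<one>\<^bsub>K\<^esub>) \<in> carrier (tensor K W ?K1)" if "v \<in> carrier V" for v
    using lin_closed[OF l[OF K1]] that by simp
  show u: "lin K V W u"
  proof (rule linI)
    fix v assume v: "v \<in> carrier V"
    show "u v \<in> carrier W"
      using additive_closed[OF scalar_part_additive[OF W] c[OF v]] by (simp add: u_def)
    fix a assume a: "a \<in> carrier K"
    have "pure K V ?K1 (a \<odot>\<^bsub>V\<^esub> v) \<one>\<^bsub>K\<^esub> = a \<odot>\<^bsub>tensor K V ?K1\<^esub> pure K V ?K1 v \<one>\<^bsub>K\<^esub>"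
      using a v tp.pure_balanced[of a v "\<one>\<^bsub>K\<^esub>"] by (simp add: tensor_smult_pure[OF V K1A])
    then show "u (a \<odot>\<^bsub>V\<^esub> v) = a \<odot>\<^bsub>W\<^esub> u v"
      using a v lin_smult[OF l[OF K1], of a "pure K V ?K1 v \<one>\<^bsub>K\<^esub>"]
      by (simp add: u_def scalar_part_smult[OF W] c)
  next
    fix v w assume "v \<in> carrier V" "w \<in> carrier V"
    then show "u (v \<oplus>\<^bsub>V\<^esub> w) = u v \<oplus>\<^bsub>W\<^esub> u w"
      by (simp add: u_def tp.pure_add_left lin_add[OF l[OF K1]] additive_add[OF scalar_part_additive[OF W]] c)
  qed
  fix S z assume S: "S \<in> comm_algebras K" and z: "z \<in> carrier (tensor K V S)"
  note SM = comm_algebras_module[OF S] and SA = comm_algebras_algebra[OF S]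
  interpret tS: tensor_pair K V S by (intro tensor_pair.intro V SM)
  note str = structure_map_scalar_alg[OF S]
  show "\<phi> S z = left_map K V S W u z"
  proof (rule tS.additive_tensor_eqI[OF lin_additive[OF l[OF S]] left_map_additive[OF V SM W u] _ z])
    fix v s assume v: "v \<in> carrier V" and s: "s \<in> carrier S"
    have "\<phi> S (pure K V S v s)
        = s \<odot>\<^bsub>tensor K W S\<^esub> \<phi> S (tensor_map K V S (structure_map K S) (pure K V ?K1 v \<one>\<^bsub>K\<^esub>))"
      using v s tensor_map_closed[OF V K1M SM alg_hom_lin[OF str], of "pure K V ?K1 v \<one>\<^bsub>K\<^esub>"]
      by (simp add: pure_as_scalar_extension[OF V S] lin_smult[OF l[OF S]])
    also have "\<phi> S (tensor_map K V S (structure_map K S) (pure K V ?K1 v \<one>\<^bsub>K\<^esub>))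
        = tensor_map K W S (structure_map K S) (pure K W ?K1 (u v) \<one>\<^bsub>K\<^esub>)"
      using mor_natural[OF \<phi> K1 S str, of "pure K V ?K1 v \<one>\<^bsub>K\<^esub>"] v
      by (simp add: u_def pure_scalar_part[OF W c])
    also have "s \<odot>\<^bsub>tensor K W S\<^esub> \<dots> = pure K W S (u v) s"
      using pure_as_scalar_extension[OF W S lin_closed[OF u v] s] by simp
    finally show "\<phi> S (pure K V S v s) = left_map K V S W u (pure K V S v s)"
      using v s by (simp add: left_map_pure[OF V SM W u])
  qed
qed

section \<open>Change of scalars\<close>

lemma restrict_scalars_simps [simp]:
  "carrier (restrict_scalars R \<phi> A) = carrier A"
  "monoid.mult (restrict_scalars R \<phi> A) = monoid.mult A"
  "\<one>\<^bsub>restrict_scalars R \<phi> A\<^esub> = \<one>\<^bsub>A\<^esub>" "\<zero>\<^bsub>restrict_scalars R \<phi> A\<^esub> = \<zero>\<^bsub>A\<^esub>"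
  "ring.add (restrict_scalars R \<phi> A) = ring.add A"
  "a \<in> carrier R \<Longrightarrow> x \<in> carrier A \<Longrightarrow> a \<odot>\<^bsub>restrict_scalars R \<phi> A\<^esub> x = \<phi> a \<odot>\<^bsub>A\<^esub> x"
  by (simp_all add: restrict_scalars_def)

lemma restrict_scalars_closed:
  assumes R: "cring R" and \<phi>: "\<phi> \<in> ring_hom R S" and A: "A \<in> comm_algebras S"
  shows "restrict_scalars R \<phi> A \<in> comm_algebras R"
proof -
  interpret A: algebra S A by (rule comm_algebras_algebra[OF A])
  interpret R: cring R by (rule R)
  have "cring (restrict_scalars R \<phi> A)"
    by (rule cring_transfer[OF A.M_cring]) simp_all
  then have "algebra R (restrict_scalars R \<phi> A)"
    using ring_hom_closed[OF \<phi>] ring_hom_add[OF \<phi>] ring_hom_mult[OF \<phi>] ring_hom_one[OF \<phi>]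
    by (intro algebraI R)
      (simp_all add: A.smult_l_distr A.smult_r_distr A.smult_assoc1 A.smult_assoc2)
  then show ?thesis
    by (auto simp: comm_algebras_def restrict_scalars_def)
qed

lemma structure_map_ring_hom:
  assumes A: "A \<in> comm_algebras R"
  shows "structure_map R A \<in> ring_hom R A"
proof -
  interpret A: algebra R A by (rule comm_algebras_algebra[OF A])
  show ?thesis
    by (rule ring_hom_memI) (simp_all add: A.smult_l_distr A.smult_assoc1 A.smult_assoc2)
qed

lemma base_alg_simps [simp]:
  "carrier (base_alg R S T) = carrier T"
  "monoid.mult (base_alg R S T) = monoid.mult T"
  "\<one>\<^bsub>base_alg R S T\<^esub> = \<one>\<^bsub>T\<^esub>" "\<zero>\<^bsub>base_alg R S T\<^esub> = \<zero>\<^bsub>T\<^esub>"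
  "ring.add (base_alg R S T) = ring.add T"
  "a \<in> carrier R \<Longrightarrow> x \<in> carrier T \<Longrightarrow> a \<odot>\<^bsub>base_alg R S T\<^esub> x = (a \<odot>\<^bsub>S\<^esub> \<one>\<^bsub>S\<^esub>) \<odot>\<^bsub>T\<^esub> x"
  by (simp_all add: base_alg_def)

lemma base_alg_closed:
  assumes S: "S \<in> comm_algebras R" and T: "T \<in> comm_algebras S"
  shows "base_alg R S T \<in> comm_algebras R"
proof -
  interpret S: algebra R S by (rule comm_algebras_algebra[OF S])
  show ?thesis
    unfolding base_alg_def
    by (rule restrict_scalars_closed[OF S.R_cring structure_map_ring_hom[OF S] T])
qed

lemma alg_hom_ring_hom: "h \<in> alg_hom R A B \<Longrightarrow> h \<in> ring_hom A B"
  by (simp add: alg_hom_def)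

text \<open>
  The dual functor moves a functional along \<open>h : S \<rightarrow> S'\<close> by restriction of scalars; the second
  statement says that this does not change the values of \<open>M\<close> that are involved.
\<close>

lemma restrict_scalars_alg_hom:
  assumes S: "S \<in> comm_algebras R" and S': "S' \<in> comm_algebras R" and h: "h \<in> alg_hom R S S'"
    and T: "T \<in> comm_algebras S'"
  shows "restrict_scalars S h T \<in> comm_algebras S"
    and "base_alg R S (restrict_scalars S h T) = base_alg R S' T"
proof -
  show "restrict_scalars S h T \<in> comm_algebras S"
    by (rule restrict_scalars_closed[OF comm_algebras_cring[OF S] alg_hom_ring_hom[OF h] T])
  interpret S: algebra R S by (rule comm_algebras_algebra[OF S])
  interpret S': algebra R S' by (rule comm_algebras_algebra[OF S'])
  have "h (a \<odot>\<^bsub>S\<^esub> \<one>\<^bsub>S\<^esub>) = a \<odot>\<^bsub>S'\<^esub> \<one>\<^bsub>S'\<^esub>" if "a \<in> carrier R" for a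
    using that lin_smult[OF alg_hom_lin[OF h], of a "\<one>\<^bsub>S\<^esub>"] alg_hom_one[OF h] by simp
  then show "base_alg R S (restrict_scalars S h T) = base_alg R S' T"
    by (simp add: base_alg_def restrict_scalars_def fun_eq_iff cong: if_cong)
qed

lemma base_alg_hom:
  assumes T: "T \<in> comm_algebras R" and h: "h \<in> alg_hom T U U'"
    and U: "U \<in> comm_algebras T"
  shows "h \<in> alg_hom R (base_alg R T U) (base_alg R T U')"
proof -
  interpret T: algebra R T by (rule comm_algebras_algebra[OF T])
  interpret U: algebra T U by (rule comm_algebras_algebra[OF U])
  show ?thesis
    using alg_hom_extensional[OF h] lin_closed[OF alg_hom_lin[OF h]] lin_add[OF alg_hom_lin[OF h]]
      lin_smult[OF alg_hom_lin[OF h]] alg_hom_mult[OF h] alg_hom_one[OF h]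
    by (intro alg_homI) simp_all
qed

lemma structure_map_base_alg:
  assumes S: "S \<in> comm_algebras R" and T: "T \<in> comm_algebras S"
  shows "structure_map S T \<in> alg_hom R S (base_alg R S T)"
proof -
  interpret S: algebra R S by (rule comm_algebras_algebra[OF S])
  interpret T: algebra S T by (rule comm_algebras_algebra[OF T])
  note h = structure_map_ring_hom[OF T]
  show ?thesis
  proof (rule alg_homI)
    fix a x assume ax: "a \<in> carrier R" "x \<in> carrier S"
    have "(a \<odot>\<^bsub>S\<^esub> x) = (a \<odot>\<^bsub>S\<^esub> \<one>\<^bsub>S\<^esub>) \<otimes>\<^bsub>S\<^esub> x"
      using ax by (simp add: S.smult_assoc2)
    then show "structure_map S T (a \<odot>\<^bsub>S\<^esub> x) = a \<odot>\<^bsub>base_alg R S T\<^esub> structure_map S T x"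
      using ax by (simp add: T.smult_assoc1)
  qed (use ring_hom_closed[OF h] ring_hom_add[OF h] ring_hom_mult[OF h] ring_hom_one[OF h]
      in \<open>simp_all add: structure_map_def\<close>)
qed

lemma self_alg_simps [simp]:
  "carrier (self_alg T) = carrier T" "monoid.mult (self_alg T) = monoid.mult T"
  "\<one>\<^bsub>self_alg T\<^esub> = \<one>\<^bsub>T\<^esub>" "\<zero>\<^bsub>self_alg T\<^esub> = \<zero>\<^bsub>T\<^esub>" "ring.add (self_alg T) = ring.add T"
  "a \<in> carrier T \<Longrightarrow> x \<in> carrier T \<Longrightarrow> a \<odot>\<^bsub>self_alg T\<^esub> x = a \<otimes>\<^bsub>T\<^esub> x"
  by (simp_all add: self_alg_def)

lemma self_alg_base_alg: "self_alg (base_alg R S T) = self_alg T"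
  unfolding self_alg_def base_alg_simps by (simp add: base_alg_def restrict_scalars_def)

lemma self_alg_closed:
  assumes "cring T"
  shows "self_alg T \<in> comm_algebras T"
proof -
  interpret cring T by fact
  have "cring (self_alg T)"
    by (rule cring_transfer[OF assms]) simp_all
  then have "algebra T (self_alg T)"
    by (intro algebraI) (simp_all add: assms l_distr r_distr m_assoc)
  then show ?thesis
    by (auto simp: comm_algebras_def self_alg_def)
qed

text \<open>
  The scalar multiplication of \<open>T\<close> is \<open>undefined\<close> off its domain, so this is an equality of
  records and not just an isomorphism.
\<close>

lemma base_alg_self_alg:
  assumes T: "T \<in> comm_algebras R"
  shows "base_alg R T (self_alg T) = T"
proof -
  interpret T: algebra R T by (rule comm_algebras_algebra[OF T])
  have "(\<lambda>a x. if a \<in> carrier R \<and> x \<in> carrier T then (a \<odot>\<^bsub>T\<^esub> \<one>\<^bsub>T\<^esub>) \<otimes>\<^bsub>T\<^esub> x else undefined)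
      = smult T"
    using T by (auto simp: fun_eq_iff comm_algebras_def T.smult_assoc2)
  then show ?thesis
    by (simp add: base_alg_def restrict_scalars_def self_alg_def structure_map_def cong: if_cong)
qed

section \<open>Transport of structure into the universe\<close>

text \<open>
  Transport along a map \<open>e\<close> that is injective on the carrier of \<open>A\<close>.
\<close>

definition encode ::
  "('u, 'r) ring_scheme \<Rightarrow> ('u, 'c) module \<Rightarrow> ('c \<Rightarrow> 'u) \<Rightarrow> ('u, 'u) module" where
  "encode R A e = (let d = inv_into (carrier A) e in
     \<lparr>carrier = e ` carrier A, mult = (\<lambda>x y. e (d x \<otimes>\<^bsub>A\<^esub> d y)), one = e \<one>\<^bsub>A\<^esub>,
      ring.zero = e \<zero>\<^bsub>A\<^esub>, add = (\<lambda>x y. e (d x \<oplus>\<^bsub>A\<^esub> d y)),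
      smult = (\<lambda>a x. if a \<in> carrier R \<and> x \<in> e ` carrier A then e (a \<odot>\<^bsub>A\<^esub> d x) else undefined)\<rparr>)"

lemma encode_simps:
  assumes "inj_on e (carrier A)"
  shows "carrier (encode R A e) = e ` carrier A"
    and "\<one>\<^bsub>encode R A e\<^esub> = e \<one>\<^bsub>A\<^esub>" "\<zero>\<^bsub>encode R A e\<^esub> = e \<zero>\<^bsub>A\<^esub>"
    and "x \<in> carrier A \<Longrightarrow> y \<in> carrier A \<Longrightarrow> e x \<otimes>\<^bsub>encode R A e\<^esub> e y = e (x \<otimes>\<^bsub>A\<^esub> y)"
    and "x \<in> carrier A \<Longrightarrow> y \<in> carrier A \<Longrightarrow> e x \<oplus>\<^bsub>encode R A e\<^esub> e y = e (x \<oplus>\<^bsub>A\<^esub> y)"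
    and "a \<in> carrier R \<Longrightarrow> x \<in> carrier A \<Longrightarrow> a \<odot>\<^bsub>encode R A e\<^esub> e x = e (a \<odot>\<^bsub>A\<^esub> x)"
  using assms by (simp_all add: encode_def Let_def)

lemma encode_closed:
  assumes A: "algebra R A" and e: "inj_on e (carrier A)"
  shows "encode R A e \<in> comm_algebras R"
proof -
  interpret A: algebra R A by fact
  note s = encode_simps[OF e]
  have "abelian_group (encode R A e)"
  proof (rule abelian_groupI)
    fix x assume "x \<in> carrier (encode R A e)"
    then obtain a where "x = e a" "a \<in> carrier A" by (auto simp: s)
    then show "\<exists>y\<in>carrier (encode R A e). y \<oplus>\<^bsub>encode R A e\<^esub> x = \<zero>\<^bsub>encode R A e\<^esub>"
      by (intro bexI[of _ "e (\<ominus>\<^bsub>A\<^esub> a)"]) (simp_all add: s A.l_neg)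
  qed (auto simp: s A.a_ac)
  moreover have "Group.comm_monoid (encode R A e)"
    by (rule comm_monoidI) (auto simp: s A.m_ac)
  ultimately have "cring (encode R A e)"
    by (rule cringI) (auto simp: s A.l_distr)
  then have "algebra R (encode R A e)"
    by (intro algebraI A.R_cring)
      (auto simp: s A.smult_l_distr A.smult_r_distr A.smult_assoc1 A.smult_assoc2)
  then show ?thesis
    by (auto simp: comm_algebras_def encode_def Let_def)
qed

section \<open>Square-zero extensions\<close>

definition raw_square_zero ::
  "('u, 'r) ring_scheme \<Rightarrow> ('u, 'n) module \<Rightarrow> ('u, 'u \<times> 'n) module" where
  "raw_square_zero R N =
     \<lparr>carrier = carrier R \<times> carrier N,
      mult = (\<lambda>x y. (fst x \<otimes>\<^bsub>R\<^esub> fst y, fst x \<odot>\<^bsub>N\<^esub> snd y \<oplus>\<^bsub>N\<^esub> fst y \<odot>\<^bsub>N\<^esub> snd x)),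
      one = (\<one>\<^bsub>R\<^esub>, \<zero>\<^bsub>N\<^esub>), ring.zero = (\<zero>\<^bsub>R\<^esub>, \<zero>\<^bsub>N\<^esub>),
      add = (\<lambda>x y. (fst x \<oplus>\<^bsub>R\<^esub> fst y, snd x \<oplus>\<^bsub>N\<^esub> snd y)),
      smult = (\<lambda>a x. (a \<otimes>\<^bsub>R\<^esub> fst x, a \<odot>\<^bsub>N\<^esub> snd x))\<rparr>"

lemma raw_square_zero_algebra:
  assumes "module R N"
  shows "algebra R (raw_square_zero R N)"
proof -
  interpret module R N by fact
  let ?A = "raw_square_zero R N"
  have "abelian_group ?A"
  proof (rule abelian_groupI)
    fix x assume "x \<in> carrier ?A"
    then show "\<exists>y\<in>carrier ?A. y \<oplus>\<^bsub>?A\<^esub> x = \<zero>\<^bsub>?A\<^esub>"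
      by (intro bexI[of _ "(\<ominus>\<^bsub>R\<^esub> fst x, \<ominus>\<^bsub>N\<^esub> snd x)"])
        (auto simp: raw_square_zero_def R.l_neg M.l_neg)
  qed (auto simp: raw_square_zero_def R.a_ac M.a_ac)
  moreover have "Group.comm_monoid ?A"
    by (rule comm_monoidI)
      (auto simp: raw_square_zero_def R.m_ac M.a_ac smult_r_distr simp flip: smult_assoc1)
  ultimately have "cring ?A"
    by (rule cringI)
      (auto simp: raw_square_zero_def R.l_distr M.a_ac smult_r_distr smult_l_distr)
  then show ?thesis
    by (intro algebraI R.is_cring)
      (auto simp: raw_square_zero_def R.l_distr R.r_distr R.m_ac smult_r_distr smult_l_distr
        simp flip: smult_assoc1)
qed

text \<open>The element \<open>r + n\<close> of the extension \<open>R \<oplus> N\<close>.\<close>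

definition sq :: "('u, 'r) ring_scheme \<Rightarrow> ('u, 'n) module \<Rightarrow> 'u \<Rightarrow> 'n \<Rightarrow> 'u" where
  "sq R N r n = (SOME e. inj_on e (carrier R \<times> carrier N)) (r, n)"

definition square_zero :: "('u, 'r) ring_scheme \<Rightarrow> ('u, 'n) module \<Rightarrow> ('u, 'u) module" where
  "square_zero R N = encode R (raw_square_zero R N) (\<lambda>(r, n). sq R N r n)"

definition sq_snd :: "('u, 'r) ring_scheme \<Rightarrow> ('u, 'n) module \<Rightarrow> 'u \<Rightarrow> 'n" where
  "sq_snd R N x = snd (inv_into (carrier R \<times> carrier N) (\<lambda>(r, n). sq R N r n) x)"

lemma infinite_times_inj:
  assumes "infinite (UNIV :: 'u set)"
  shows "\<exists>p :: 'u \<times> 'u \<Rightarrow> 'u. inj p"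
  using card_of_ordLeq[THEN iffD2, OF ordIso_imp_ordLeq[OF card_of_Times_same_infinite[OF assms]]]
  by auto

text \<open>
  The last assumption holds for the modules \<open>N\<close> that are needed: vector spaces and algebras in
  the universe, and tensor products of such.
\<close>

locale square_zero_ext = module R N for R :: "('u, 'r) ring_scheme" and N :: "('u, 'n) module" +
  assumes infinite_universe: "infinite (UNIV :: 'u set)"
    and embeds: "\<exists>e :: 'n \<Rightarrow> 'u. inj_on e (carrier N)"
begin

lemma inj_sq: "inj_on (\<lambda>(r, n). sq R N r n) (carrier R \<times> carrier N)"
proof -
  obtain p :: "'u \<times> 'u \<Rightarrow> 'u" where p: "inj p"
    using infinite_times_inj[OF infinite_universe] by blast
  obtain e :: "'n \<Rightarrow> 'u" where e: "inj_on e (carrier N)"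
    using embeds by blast
  have "inj_on (\<lambda>(r, n). p (r, e n)) (carrier R \<times> carrier N)"
    by (rule inj_onI) (auto dest: injD[OF p] inj_onD[OF e])
  then have "inj_on (SOME e :: 'u \<times> 'n \<Rightarrow> 'u. inj_on e (carrier R \<times> carrier N)) (carrier R \<times> carrier N)"
    by (rule someI[where P = "\<lambda>e. inj_on e (carrier R \<times> carrier N)"])
  then show ?thesis by (simp add: sq_def)
qed

lemma inj_raw: "inj_on (\<lambda>(r, n). sq R N r n) (carrier (raw_square_zero R N))"
  using inj_sq by (simp add: raw_square_zero_def)

lemma square_zero_closed: "square_zero R N \<in> comm_algebras R"
  unfolding square_zero_def by (rule encode_closed[OF raw_square_zero_algebra[OF module_axioms] inj_raw])

lemma carrier_square_zero:
  "carrier (square_zero R N) = (\<lambda>(r, n). sq R N r n) ` (carrier R \<times> carrier N)"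
  unfolding square_zero_def encode_simps(1)[OF inj_raw] by (simp add: raw_square_zero_def)

lemma sq_closed [simp]: "r \<in> carrier R \<Longrightarrow> n \<in> carrier N \<Longrightarrow> sq R N r n \<in> carrier (square_zero R N)"
  by (force simp: carrier_square_zero)

lemma sq_cases [elim]:
  assumes "x \<in> carrier (square_zero R N)"
  obtains r n where "x = sq R N r n" "r \<in> carrier R" "n \<in> carrier N"
  using assms by (auto simp: carrier_square_zero)

lemma sq_eq_iff:
  "r \<in> carrier R \<Longrightarrow> n \<in> carrier N \<Longrightarrow> r' \<in> carrier R \<Longrightarrow> n' \<in> carrier N \<Longrightarrow>
   sq R N r n = sq R N r' n' \<longleftrightarrow> r = r' \<and> n = n'"
  using inj_onD[OF inj_sq, of "(r, n)" "(r', n')"] by auto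

lemma sq_snd_sq [simp]:
  assumes "r \<in> carrier R" "n \<in> carrier N"
  shows "sq_snd R N (sq R N r n) = n"
  using inv_into_f_f[OF inj_sq, of "(r, n)"] assms by (simp add: sq_snd_def)

lemma sq_one: "\<one>\<^bsub>square_zero R N\<^esub> = sq R N \<one>\<^bsub>R\<^esub> \<zero>\<^bsub>N\<^esub>"
  by (simp add: square_zero_def encode_simps[OF inj_raw]) (simp add: raw_square_zero_def)

lemma sq_add:
  assumes "r \<in> carrier R" "n \<in> carrier N" "r' \<in> carrier R" "n' \<in> carrier N"
  shows "sq R N r n \<oplus>\<^bsub>square_zero R N\<^esub> sq R N r' n' = sq R N (r \<oplus>\<^bsub>R\<^esub> r') (n \<oplus>\<^bsub>N\<^esub> n')"
  using encode_simps(5)[OF inj_raw, of "(r, n)" "(r', n')" R] assms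
  by (simp add: square_zero_def raw_square_zero_def)

lemma sq_mult:
  assumes "r \<in> carrier R" "n \<in> carrier N" "r' \<in> carrier R" "n' \<in> carrier N"
  shows "sq R N r n \<otimes>\<^bsub>square_zero R N\<^esub> sq R N r' n'
    = sq R N (r \<otimes>\<^bsub>R\<^esub> r') (r \<odot>\<^bsub>N\<^esub> n' \<oplus>\<^bsub>N\<^esub> r' \<odot>\<^bsub>N\<^esub> n)"
  using encode_simps(4)[OF inj_raw, of "(r, n)" "(r', n')" R] assms
  by (simp add: square_zero_def raw_square_zero_def)

lemma sq_smult:
  assumes "a \<in> carrier R" "r \<in> carrier R" "n \<in> carrier N"
  shows "a \<odot>\<^bsub>square_zero R N\<^esub> sq R N r n = sq R N (a \<otimes>\<^bsub>R\<^esub> r) (a \<odot>\<^bsub>N\<^esub> n)"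
  using encode_simps(6)[OF inj_raw, of a R "(r, n)"] assms
  by (simp add: square_zero_def raw_square_zero_def)

lemma sq_snd_lin: "lin R (square_zero R N) N (sq_snd R N)"
  by (rule linI) (auto elim!: sq_cases simp: sq_add sq_smult)

lemma sq_zero_lin: "lin R N (square_zero R N) (\<lambda>n. sq R N \<zero>\<^bsub>R\<^esub> n)"
  by (rule linI) (auto simp: sq_add sq_smult)

end

text \<open>The algebra of dual numbers \<open>A[\<epsilon>]\<close>, with \<open>dn A a b = a + b \<epsilon>\<close>.\<close>

abbreviation dual_numbers :: "('u, 'u) module \<Rightarrow> ('u, 'u) module" where
  "dual_numbers A \<equiv> square_zero A (self_alg A)"

abbreviation dn :: "('u, 'u) module \<Rightarrow> 'u \<Rightarrow> 'u \<Rightarrow> 'u" where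
  "dn A \<equiv> sq A (self_alg A)"

abbreviation dn_snd :: "('u, 'u) module \<Rightarrow> 'u \<Rightarrow> 'u" where
  "dn_snd A \<equiv> sq_snd A (self_alg A)"

lemma dual_numbers_square_zero:
  fixes A :: "('u, 'u) module"
  assumes "cring A" "infinite (UNIV :: 'u set)"
  shows "square_zero_ext A (self_alg A)"
proof -
  have "\<exists>e :: 'u \<Rightarrow> 'u. inj_on e (carrier (self_alg A))"
    by (rule exI[of _ id]) simp
  then show ?thesis
    using assms comm_algebras_module[OF self_alg_closed[OF assms(1)]]
    by (simp add: square_zero_ext_def square_zero_ext_axioms_def)
qed

text \<open>
  A linear map \<open>\<mu> : N \<rightarrow> A\<close> into an algebra need not be multiplicative, but it extends to the
  homomorphism of algebras \<open>R \<oplus> N \<rightarrow> A[\<epsilon>], r + n \<mapsto> r + \<mu>(n) \<epsilon>\<close>.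
\<close>

definition square_zero_hom ::
  "('u, 'r) ring_scheme \<Rightarrow> ('u, 'n) module \<Rightarrow> ('u, 'u) module \<Rightarrow> ('n \<Rightarrow> 'u) \<Rightarrow> 'u \<Rightarrow> 'u" where
  "square_zero_hom R N A \<mu> = (\<lambda>x \<in> carrier (square_zero R N).
     (\<lambda>(r, n). dn A (r \<odot>\<^bsub>A\<^esub> \<one>\<^bsub>A\<^esub>) (\<mu> n)) (inv_into (carrier R \<times> carrier N) (\<lambda>(r, n). sq R N r n) x))"

context square_zero_ext
begin

lemma square_zero_hom_sq:
  assumes "r \<in> carrier R" "n \<in> carrier N"
  shows "square_zero_hom R N A \<mu> (sq R N r n) = dn A (r \<odot>\<^bsub>A\<^esub> \<one>\<^bsub>A\<^esub>) (\<mu> n)"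
  using inv_into_f_f[OF inj_sq, of "(r, n)"] assms by (simp add: square_zero_hom_def)

lemma square_zero_hom_alg_hom:
  assumes A: "A \<in> comm_algebras R" and \<mu>: "lin R N A \<mu>"
  shows "square_zero_hom R N A \<mu> \<in> alg_hom R (square_zero R N) (base_alg R A (dual_numbers A))"
proof -
  interpret A: algebra R A by (rule comm_algebras_algebra[OF A])
  interpret D: square_zero_ext A "self_alg A"
    by (rule dual_numbers_square_zero[OF A.M_cring infinite_universe])
  have z: "\<mu> \<zero>\<^bsub>N\<^esub> = \<zero>\<^bsub>A\<^esub>"
    by (rule lin_zero[OF \<mu> module_axioms A.module])
  have scal: "(r \<odot>\<^bsub>A\<^esub> \<one>\<^bsub>A\<^esub>) \<otimes>\<^bsub>A\<^esub> a = r \<odot>\<^bsub>A\<^esub> a" if "r \<in> carrier R" "a \<in> carrier A" for r a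
    using that by (simp add: A.smult_assoc2)
  show ?thesis
  proof (rule alg_homI)
    show "square_zero_hom R N A \<mu> \<in> extensional (carrier (square_zero R N))"
      by (simp add: square_zero_hom_def)
    show "square_zero_hom R N A \<mu> \<one>\<^bsub>square_zero R N\<^esub> = \<one>\<^bsub>base_alg R A (dual_numbers A)\<^esub>"
      by (simp add: sq_one D.sq_one square_zero_hom_sq z)
    fix x assume "x \<in> carrier (square_zero R N)"
    then obtain r n where x: "x = sq R N r n" "r \<in> carrier R" "n \<in> carrier N" by (rule sq_cases)
    then show "square_zero_hom R N A \<mu> x \<in> carrier (base_alg R A (dual_numbers A))"
      by (simp add: square_zero_hom_sq lin_closed[OF \<mu>])
    fix a assume a: "a \<in> carrier R"
    then show "square_zero_hom R N A \<mu> (a \<odot>\<^bsub>square_zero R N\<^esub> x)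
        = a \<odot>\<^bsub>base_alg R A (dual_numbers A)\<^esub> square_zero_hom R N A \<mu> x"
      using x by (simp add: square_zero_hom_sq lin_closed[OF \<mu>] sq_smult D.sq_smult scal
          lin_smult[OF \<mu>] A.smult_assoc1)
  next
    fix x y assume "x \<in> carrier (square_zero R N)" "y \<in> carrier (square_zero R N)"
    then obtain r n s m where x: "x = sq R N r n" "r \<in> carrier R" "n \<in> carrier N"
      and y: "y = sq R N s m" "s \<in> carrier R" "m \<in> carrier N" by (metis sq_cases)
    show "square_zero_hom R N A \<mu> (x \<oplus>\<^bsub>square_zero R N\<^esub> y)
        = square_zero_hom R N A \<mu> x \<oplus>\<^bsub>base_alg R A (dual_numbers A)\<^esub> square_zero_hom R N A \<mu> y"
      using x y by (simp add: square_zero_hom_sq lin_closed[OF \<mu>] sq_add D.sq_add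
          lin_add[OF \<mu>] A.smult_l_distr)
    show "square_zero_hom R N A \<mu> (x \<otimes>\<^bsub>square_zero R N\<^esub> y)
        = square_zero_hom R N A \<mu> x \<otimes>\<^bsub>base_alg R A (dual_numbers A)\<^esub> square_zero_hom R N A \<mu> y"
      using x y by (simp add: square_zero_hom_sq lin_closed[OF \<mu>] sq_mult D.sq_mult
          lin_add[OF \<mu>] lin_smult[OF \<mu>] A.smult_assoc1 scal)
  qed
qed

end

section \<open>Contractions\<close>

definition contr ::
  "('u, 'r) ring_scheme \<Rightarrow> ('u, 'u) module \<Rightarrow> ('u, 'u) module \<Rightarrow> ('u \<Rightarrow> 'u) \<Rightarrow>
   ('u \<times> 'u \<Rightarrow>\<^sub>0 int) set \<Rightarrow> 'u" where
  "contr K V U k = tensor_lift K V U U (\<lambda>v u. k v \<otimes>\<^bsub>U\<^esub> u)"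

lemma
  assumes V: "module K V" and U: "U \<in> comm_algebras K" and k: "lin K V U k"
  shows contr_additive: "additive (tensor K V U) U (contr K V U k)"
    and contr_pure: "\<And>v u. v \<in> carrier V \<Longrightarrow> u \<in> carrier U \<Longrightarrow> contr K V U k (pure K V U v u) = k v \<otimes>\<^bsub>U\<^esub> u"
proof -
  interpret U: algebra K U by (rule comm_algebras_algebra[OF U])
  interpret tp: tensor_pair K V U by (intro tensor_pair.intro V U.module)
  have "balanced K V U U (\<lambda>v u. k v \<otimes>\<^bsub>U\<^esub> u)"
  proof (rule balancedI)
    fix a v u assume *: "a \<in> carrier K" "v \<in> carrier V" "u \<in> carrier U"
    show "k (a \<odot>\<^bsub>V\<^esub> v) \<otimes>\<^bsub>U\<^esub> u = k v \<otimes>\<^bsub>U\<^esub> (a \<odot>\<^bsub>U\<^esub> u)"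
      using * lin_closed[OF k] lin_smult[OF k]
      by (metis U.m_comm U.smult_assoc2 U.smult_closed)
  qed (simp_all add: lin_closed[OF k] lin_add[OF k] U.l_distr U.r_distr)
  from tp.tensor_lift_additive[OF U.abelian_group_axioms this]
    tp.tensor_lift_pure[OF U.abelian_group_axioms this]
  show "additive (tensor K V U) U (contr K V U k)"
    "\<And>v u. v \<in> carrier V \<Longrightarrow> u \<in> carrier U \<Longrightarrow> contr K V U k (pure K V U v u) = k v \<otimes>\<^bsub>U\<^esub> u"
    by (simp_all add: contr_def)
qed

lemma contr_closed:
  assumes "module K V" "U \<in> comm_algebras K" "lin K V U k" "z \<in> carrier (tensor K V U)"
  shows "contr K V U k z \<in> carrier U"
  by (rule additive_closed[OF contr_additive[OF assms(1-3)] assms(4)])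

lemma contr_smult:
  assumes V: "module K V" and U: "U \<in> comm_algebras K" and k: "lin K V U k"
    and a: "a \<in> carrier U" and z: "z \<in> carrier (tensor K V U)"
  shows "contr K V U k (a \<odot>\<^bsub>tensor K V U\<^esub> z) = a \<otimes>\<^bsub>U\<^esub> contr K V U k z"
proof -
  note UA = comm_algebras_algebra[OF U]
  interpret U: algebra K U by (rule UA)
  interpret tp: tensor_pair K V U by (intro tensor_pair.intro V U.module)
  interpret T: module U "tensor K V U" by (rule tensor_module[OF V UA])
  note add = contr_additive[OF V U k]
  from z show ?thesis
    by (induction rule: tp.tensor_induct)
      (use a lin_closed[OF k] in \<open>simp_all add: tensor_smult_pure[OF V UA] contr_pure[OF V U k] U.m_lcomm
        T.smult_r_distr U.r_distr additive_add[OF add] additive_closed[OF add]\<close>)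
qed

text \<open>
  A homomorphism \<open>\<alpha>\<close> takes \<open>k(v) u\<close> to \<open>\<alpha>(k(v)) \<alpha>(u)\<close>. This makes the functionals on \<open>M\<close> that are
  obtained from contractions natural in the algebra \<open>U\<close>.
\<close>

lemma contr_natural:
  assumes V: "module K V" and U: "U \<in> comm_algebras K" and U': "U' \<in> comm_algebras K"
    and k: "lin K V U k" and \<alpha>: "\<alpha> \<in> alg_hom K U U'" and z: "z \<in> carrier (tensor K V U)"
  shows "contr K V U' (\<lambda>v. \<alpha> (k v)) (tensor_map K V U' \<alpha> z) = \<alpha> (contr K V U k z)"
proof -
  note m = comm_algebras_module[OF U] comm_algebras_module[OF U']
  interpret tp: tensor_pair K V U by (intro tensor_pair.intro V m)
  note l = alg_hom_lin[OF \<alpha>]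
  note k' = lin_comp[OF k l]
  show ?thesis
    by (rule tp.additive_tensor_eqI[OF additive_comp[OF tensor_map_additive[OF V m l] contr_additive[OF V U' k']]
          additive_comp[OF contr_additive[OF V U k] lin_additive[OF l]] _ z])
      (simp add: tensor_map_pure[OF V m l] contr_pure[OF V U' k'] contr_pure[OF V U k] lin_closed[OF l]
        lin_closed[OF k] alg_hom_mult[OF \<alpha>])
qed

lemma contr_left_map:
  assumes V: "module K V" and W: "module K W" and U: "U \<in> comm_algebras K"
    and u: "lin K V W u" and k: "lin K W U k" and z: "z \<in> carrier (tensor K V U)"
  shows "contr K W U k (left_map K V U W u z) = contr K V U (\<lambda>v. k (u v)) z"
proof -
  note m = comm_algebras_module[OF U]
  interpret tp: tensor_pair K V U by (intro tensor_pair.intro V m)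
  note k' = lin_comp[OF u k]
  show ?thesis
    by (rule tp.additive_tensor_eqI[OF additive_comp[OF left_map_additive[OF V m W u] contr_additive[OF W U k]]
          contr_additive[OF V U k'] _ z])
      (simp add: left_map_pure[OF V m W u] contr_pure[OF V U k'] contr_pure[OF W U k] lin_closed[OF u])
qed

lemma contr_cong:
  assumes V: "module K V" and U: "U \<in> comm_algebras K"
    and k: "lin K V U k" and eq: "\<And>v. v \<in> carrier V \<Longrightarrow> k' v = k v" and z: "z \<in> carrier (tensor K V U)"
  shows "contr K V U k' z = contr K V U k z"
proof -
  interpret tp: tensor_pair K V U by (intro tensor_pair.intro V comm_algebras_module[OF U])
  have k': "lin K V U k'" by (rule lin_cong[OF k eq V])
  show ?thesis
    by (rule tp.additive_tensor_eqI[OF contr_additive[OF V U k'] contr_additive[OF V U k] _ z])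
      (simp add: contr_pure[OF V U k'] contr_pure[OF V U k] eq)
qed

lemma contr_plus:
  assumes V: "module K V" and U: "U \<in> comm_algebras K"
    and k: "lin K V U k" and k': "lin K V U k'" and z: "z \<in> carrier (tensor K V U)"
  shows "contr K V U (\<lambda>v. k v \<oplus>\<^bsub>U\<^esub> k' v) z = contr K V U k z \<oplus>\<^bsub>U\<^esub> contr K V U k' z"
proof -
  note m = comm_algebras_module[OF U]
  interpret U: algebra K U by (rule comm_algebras_algebra[OF U])
  interpret tp: tensor_pair K V U by (intro tensor_pair.intro V m)
  note kk' = lin_plus[OF k k' V m]
  note add = contr_additive[OF V U]
  from z show ?thesis
    by (induction rule: tp.tensor_induct)
      (use lin_closed[OF k] lin_closed[OF k'] in \<open>simp_all add: contr_pure[OF V U] k k' kk'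
        additive_add[OF add] additive_closed[OF add] U.l_distr U.a_ac\<close>)
qed

section \<open>The tensor product of two algebras\<close>

text \<open>
  The product \<open>(a \<otimes> b) y\<close> is obtained by multiplying the two factors of \<open>y\<close> with \<open>a\<close> and with \<open>b\<close>;
  this is balanced in \<open>(a, b)\<close>. Each ring axiom then only has to be checked on pure tensors.
\<close>

definition tensor_mult ::
  "('u, 'r) ring_scheme \<Rightarrow> ('u, 'u) module \<Rightarrow> ('u, 'u) module \<Rightarrow>
   ('u \<times> 'u \<Rightarrow>\<^sub>0 int) set \<Rightarrow> ('u \<times> 'u \<Rightarrow>\<^sub>0 int) set \<Rightarrow> ('u \<times> 'u \<Rightarrow>\<^sub>0 int) set" where
  "tensor_mult K T U x y = tensor_lift K T U (tensor K T U)
     (\<lambda>a b. left_map K T U T (\<lambda>t. a \<otimes>\<^bsub>T\<^esub> t) (b \<odot>\<^bsub>tensor K T U\<^esub> y)) x"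

definition raw_tensor_alg ::
  "('u, 'r) ring_scheme \<Rightarrow> ('u, 'u) module \<Rightarrow> ('u, 'u) module \<Rightarrow>
   ('u, ('u \<times> 'u \<Rightarrow>\<^sub>0 int) set) module" where
  "raw_tensor_alg K T U =
     \<lparr>carrier = carrier (tensor K T U), mult = tensor_mult K T U,
      one = pure K T U \<one>\<^bsub>T\<^esub> \<one>\<^bsub>U\<^esub>, ring.zero = \<zero>\<^bsub>tensor K T U\<^esub>, add = ring.add (tensor K T U),
      smult = (\<lambda>t. tensor_mult K T U (pure K T U t \<one>\<^bsub>U\<^esub>))\<rparr>"

definition tensor_code ::
  "('u, 'r) ring_scheme \<Rightarrow> ('u, 'u) module \<Rightarrow> ('u, 'u) module \<Rightarrow> ('u \<times> 'u \<Rightarrow>\<^sub>0 int) set \<Rightarrow> 'u" where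
  "tensor_code K T U = (SOME e. inj_on e (carrier (tensor K T U)))"

definition tensor_decode ::
  "('u, 'r) ring_scheme \<Rightarrow> ('u, 'u) module \<Rightarrow> ('u, 'u) module \<Rightarrow> 'u \<Rightarrow> ('u \<times> 'u \<Rightarrow>\<^sub>0 int) set" where
  "tensor_decode K T U = inv_into (carrier (tensor K T U)) (tensor_code K T U)"

definition tensor_alg ::
  "('u, 'r) ring_scheme \<Rightarrow> ('u, 'u) module \<Rightarrow> ('u, 'u) module \<Rightarrow> ('u, 'u) module" where
  "tensor_alg K T U = encode T (raw_tensor_alg K T U) (tensor_code K T U)"

definition tensor_inr ::
  "('u, 'r) ring_scheme \<Rightarrow> ('u, 'u) module \<Rightarrow> ('u, 'u) module \<Rightarrow> 'u \<Rightarrow> 'u" where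
  "tensor_inr K T U = (\<lambda>u \<in> carrier U. tensor_code K T U (pure K T U \<one>\<^bsub>T\<^esub> u))"

locale tensor_algebra =
  fixes K :: "('u, 'r) ring_scheme" and T U :: "('u, 'u) module"
  assumes T: "T \<in> comm_algebras K" and U: "U \<in> comm_algebras K"
    and infinite_universe: "infinite (UNIV :: 'u set)"
begin

sublocale T: algebra K T by (rule comm_algebras_algebra[OF T])
sublocale U: algebra K U by (rule comm_algebras_algebra[OF U])
sublocale tp: tensor_pair K T U by (intro tensor_pair.intro T.module U.module)
sublocale X: module U "tensor K T U" by (rule tensor_module[OF T.module U.algebra_axioms])

abbreviation "X \<equiv> tensor K T U"
abbreviation "pr \<equiv> pure K T U"
abbreviation "mul \<equiv> tensor_mult K T U"

lemma left_mult_lin: "a \<in> carrier T \<Longrightarrow> lin K T T (\<lambda>t. a \<otimes>\<^bsub>T\<^esub> t)"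
  by (rule algebra_lin_mult[OF T.algebra_axioms])

lemma left_mult_additive: "a \<in> carrier T \<Longrightarrow> additive X X (left_map K T U T (\<lambda>t. a \<otimes>\<^bsub>T\<^esub> t))"
  by (rule left_map_additive[OF T.module U.module T.module left_mult_lin])

lemma left_mult_pure [simp]:
  "a \<in> carrier T \<Longrightarrow> t \<in> carrier T \<Longrightarrow> u \<in> carrier U \<Longrightarrow>
   left_map K T U T (\<lambda>t. a \<otimes>\<^bsub>T\<^esub> t) (pr t u) = pr (a \<otimes>\<^bsub>T\<^esub> t) u"
  by (rule left_map_pure[OF T.module U.module T.module left_mult_lin])

lemmas smult_pure [simp] = tensor_smult_pure[OF T.module U.algebra_axioms]
lemmas left_mult_closed [simp] = additive_closed[OF left_mult_additive]
lemmas left_mult_add [simp] = additive_add[OF left_mult_additive]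

lemma balanced_mult:
  assumes y: "y \<in> carrier X"
  shows "balanced K T U X (\<lambda>a b. left_map K T U T (\<lambda>t. a \<otimes>\<^bsub>T\<^esub> t) (b \<odot>\<^bsub>X\<^esub> y))"
proof (rule balancedI)
  fix a a' b assume *: "a \<in> carrier T" "a' \<in> carrier T" "b \<in> carrier U"
  from y show "left_map K T U T (\<lambda>t. (a \<oplus>\<^bsub>T\<^esub> a') \<otimes>\<^bsub>T\<^esub> t) (b \<odot>\<^bsub>X\<^esub> y)
      = left_map K T U T (\<lambda>t. a \<otimes>\<^bsub>T\<^esub> t) (b \<odot>\<^bsub>X\<^esub> y) \<oplus>\<^bsub>X\<^esub> left_map K T U T (\<lambda>t. a' \<otimes>\<^bsub>T\<^esub> t) (b \<odot>\<^bsub>X\<^esub> y)"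
    by (induction rule: tp.tensor_induct)
      (use * in \<open>simp_all add: T.l_distr tp.pure_add_left X.smult_r_distr X.M.a_ac\<close>)
next
  fix k a b assume *: "k \<in> carrier K" "a \<in> carrier T" "b \<in> carrier U"
  from y show "left_map K T U T (\<lambda>t. (k \<odot>\<^bsub>T\<^esub> a) \<otimes>\<^bsub>T\<^esub> t) (b \<odot>\<^bsub>X\<^esub> y)
      = left_map K T U T (\<lambda>t. a \<otimes>\<^bsub>T\<^esub> t) ((k \<odot>\<^bsub>U\<^esub> b) \<odot>\<^bsub>X\<^esub> y)"
    by (induction rule: tp.tensor_induct)
      (use * in \<open>simp_all add: T.smult_assoc2 U.smult_assoc2 tp.pure_balanced X.smult_r_distr\<close>)
qed (use y in \<open>simp_all add: X.smult_l_distr\<close>)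

lemma mul_pure_left:
  "y \<in> carrier X \<Longrightarrow> a \<in> carrier T \<Longrightarrow> b \<in> carrier U \<Longrightarrow>
   mul (pr a b) y = left_map K T U T (\<lambda>t. a \<otimes>\<^bsub>T\<^esub> t) (b \<odot>\<^bsub>X\<^esub> y)"
  unfolding tensor_mult_def by (rule tp.tensor_lift_pure[OF tp.abelian_tensor balanced_mult])

lemma mul_additive_left: "y \<in> carrier X \<Longrightarrow> additive X X (\<lambda>x. mul x y)"
  unfolding tensor_mult_def by (rule tp.tensor_lift_additive[OF tp.abelian_tensor balanced_mult])

lemmas mul_closed [simp] = additive_closed[OF mul_additive_left]
lemmas mul_add_left [simp] = additive_add[OF mul_additive_left]

lemma mul_pure [simp]:
  "a \<in> carrier T \<Longrightarrow> b \<in> carrier U \<Longrightarrow> a' \<in> carrier T \<Longrightarrow> b' \<in> carrier U \<Longrightarrow>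
   mul (pr a b) (pr a' b') = pr (a \<otimes>\<^bsub>T\<^esub> a') (b \<otimes>\<^bsub>U\<^esub> b')"
  by (simp add: mul_pure_left)

lemma mul_add_right [simp]:
  assumes "x \<in> carrier X" and y: "y \<in> carrier X" "z \<in> carrier X"
  shows "mul x (y \<oplus>\<^bsub>X\<^esub> z) = mul x y \<oplus>\<^bsub>X\<^esub> mul x z"
  using assms(1)
  by (induction rule: tp.tensor_induct)
    (use y in \<open>simp_all add: mul_pure_left X.smult_r_distr X.M.a_ac\<close>)

lemma mul_comm:
  assumes "x \<in> carrier X" "y \<in> carrier X"
  shows "mul x y = mul y x"
  using assms(1)
proof (induction rule: tp.tensor_induct)
  case (pure a b)
  from assms(2) show ?case
    by (induction rule: tp.tensor_induct) (use pure in \<open>simp_all add: T.m_comm U.m_comm\<close>)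
qed (use assms(2) in simp_all)

lemma mul_assoc:
  assumes "x \<in> carrier X" "y \<in> carrier X" "z \<in> carrier X"
  shows "mul (mul x y) z = mul x (mul y z)"
  using assms(1)
proof (induction rule: tp.tensor_induct)
  case p: (pure a b)
  from assms(2) show ?case
  proof (induction rule: tp.tensor_induct)
    case q: (pure c d)
    from assms(3) show ?case
      by (induction rule: tp.tensor_induct) (use p q in \<open>simp_all add: T.m_assoc U.m_assoc\<close>)
  qed (use assms(3) p in simp_all)
qed (use assms(2,3) in simp_all)

lemma mul_one: "x \<in> carrier X \<Longrightarrow> mul (pr \<one>\<^bsub>T\<^esub> \<one>\<^bsub>U\<^esub>) x = x"
  by (induction rule: tp.tensor_induct) simp_all

lemma mul_inr:
  assumes "u \<in> carrier U" "x \<in> carrier X"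
  shows "mul (pr \<one>\<^bsub>T\<^esub> u) x = u \<odot>\<^bsub>X\<^esub> x"
  using assms(2)
  by (induction rule: tp.tensor_induct) (use assms(1) in \<open>simp_all add: X.smult_r_distr\<close>)

lemma raw_algebra: "algebra T (raw_tensor_alg K T U)"
proof -
  let ?A = "raw_tensor_alg K T U"
  have simps: "carrier ?A = carrier X" "monoid.mult ?A = mul" "\<one>\<^bsub>?A\<^esub> = pr \<one>\<^bsub>T\<^esub> \<one>\<^bsub>U\<^esub>"
    "\<zero>\<^bsub>?A\<^esub> = \<zero>\<^bsub>X\<^esub>" "ring.add ?A = ring.add X"
    "smult ?A = (\<lambda>t. mul (pr t \<one>\<^bsub>U\<^esub>))"
    by (simp_all add: raw_tensor_alg_def)
  have "abelian_group ?A"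
    by (rule abelian_groupI; unfold simps)
      (rule X.M.add.m_closed X.M.zero_closed X.M.add.m_assoc X.M.add.m_comm X.M.l_zero
        X.M.add.l_inv_ex[simplified]; assumption)+
  moreover have "Group.comm_monoid ?A"
    by (rule comm_monoidI; unfold simps; (rule mul_comm; assumption)?; simp add: mul_assoc mul_one)
  ultimately have "cring ?A"
    by (rule cringI; unfold simps) simp
  then show ?thesis
    by (rule algebraI[OF T.M_cring]; unfold simps)
      (simp_all add: tp.pure_add_left mul_one flip: mul_assoc)
qed

abbreviation "code \<equiv> tensor_code K T U"
abbreviation "dec \<equiv> tensor_decode K T U"
abbreviation "P \<equiv> tensor_alg K T U"

lemma inj_code: "inj_on code (carrier X)"
  unfolding tensor_code_def
  by (rule someI_ex[OF tp.tensor_inj_into_universe[OF infinite_universe]])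

lemma carrier_raw: "carrier (raw_tensor_alg K T U) = carrier X"
  by (simp add: raw_tensor_alg_def)

lemma inj_code_raw: "inj_on code (carrier (raw_tensor_alg K T U))"
  by (simp add: carrier_raw inj_code)

lemma P_closed: "P \<in> comm_algebras T"
  unfolding tensor_alg_def by (rule encode_closed[OF raw_algebra inj_code_raw])

lemma carrier_P: "carrier P = code ` carrier X"
  unfolding tensor_alg_def encode_simps(1)[OF inj_code_raw] carrier_raw by simp

lemma code_closed [simp]: "x \<in> carrier X \<Longrightarrow> code x \<in> carrier P"
  by (simp add: carrier_P)

lemma dec_code [simp]: "x \<in> carrier X \<Longrightarrow> dec (code x) = x"
  unfolding tensor_decode_def by (rule inv_into_f_f[OF inj_code])

lemma code_dec [simp]: "p \<in> carrier P \<Longrightarrow> code (dec p) = p"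
  unfolding tensor_decode_def carrier_P by (rule f_inv_into_f)

lemma dec_closed [simp]: "p \<in> carrier P \<Longrightarrow> dec p \<in> carrier X"
  unfolding tensor_decode_def carrier_P by (rule inv_into_into)

lemma code_add: "x \<in> carrier X \<Longrightarrow> y \<in> carrier X \<Longrightarrow> code x \<oplus>\<^bsub>P\<^esub> code y = code (x \<oplus>\<^bsub>X\<^esub> y)"
  using encode_simps(5)[OF inj_code_raw, of x y T]
  by (simp add: carrier_raw tensor_alg_def) (simp add: raw_tensor_alg_def)

lemma code_mult: "x \<in> carrier X \<Longrightarrow> y \<in> carrier X \<Longrightarrow> code x \<otimes>\<^bsub>P\<^esub> code y = code (mul x y)"
  using encode_simps(4)[OF inj_code_raw, of x y T]
  by (simp add: carrier_raw tensor_alg_def) (simp add: raw_tensor_alg_def)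

lemma code_smult: "t \<in> carrier T \<Longrightarrow> x \<in> carrier X \<Longrightarrow> t \<odot>\<^bsub>P\<^esub> code x = code (mul (pr t \<one>\<^bsub>U\<^esub>) x)"
  using encode_simps(6)[OF inj_code_raw, of t T x]
  by (simp add: carrier_raw tensor_alg_def) (simp add: raw_tensor_alg_def)

lemma code_one: "\<one>\<^bsub>P\<^esub> = code (pr \<one>\<^bsub>T\<^esub> \<one>\<^bsub>U\<^esub>)"
  unfolding tensor_alg_def encode_simps(2)[OF inj_code_raw] by (simp add: raw_tensor_alg_def)

lemma dec_add: "p \<in> carrier P \<Longrightarrow> q \<in> carrier P \<Longrightarrow> dec (p \<oplus>\<^bsub>P\<^esub> q) = dec p \<oplus>\<^bsub>X\<^esub> dec q"
  using code_add[of "dec p" "dec q"] dec_code[of "dec p \<oplus>\<^bsub>X\<^esub> dec q"] by simp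

lemma dec_mult: "p \<in> carrier P \<Longrightarrow> q \<in> carrier P \<Longrightarrow> dec (p \<otimes>\<^bsub>P\<^esub> q) = mul (dec p) (dec q)"
  using code_mult[of "dec p" "dec q"] dec_code[of "mul (dec p) (dec q)"] by simp

lemma base_P: "base_alg K T P \<in> comm_algebras K"
  by (rule base_alg_closed[OF T P_closed])

lemma inr_apply [simp]: "u \<in> carrier U \<Longrightarrow> tensor_inr K T U u = code (pr \<one>\<^bsub>T\<^esub> u)"
  by (simp add: tensor_inr_def)

lemma inr_alg_hom: "tensor_inr K T U \<in> alg_hom K U (base_alg K T P)"
proof (rule alg_homI)
  fix a u assume "a \<in> carrier K" "u \<in> carrier U"
  then show "tensor_inr K T U (a \<odot>\<^bsub>U\<^esub> u) = a \<odot>\<^bsub>base_alg K T P\<^esub> tensor_inr K T U u"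
    by (simp add: code_smult tp.pure_balanced U.smult_assoc2)
qed (simp_all add: tensor_inr_def code_add code_mult code_one tp.pure_add_right)

end

lemma tensor_alg_functorial:
  assumes T: "T \<in> comm_algebras K" and U: "U \<in> comm_algebras K" and U': "U' \<in> comm_algebras K"
    and \<alpha>: "\<alpha> \<in> alg_hom K U U'" and inf: "infinite (UNIV :: 'u set)"
  defines "\<gamma> \<equiv> \<lambda>p \<in> carrier (tensor_alg K T U).
     tensor_code K T U' (tensor_map K T U' \<alpha> (tensor_decode K T U (p :: 'u)))"
  shows "\<gamma> \<in> alg_hom T (tensor_alg K T U) (tensor_alg K T U')"
proof -
  interpret A: tensor_algebra K T U by (intro tensor_algebra.intro T U inf)
  interpret B: tensor_algebra K T U' by (intro tensor_algebra.intro T U' inf)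
  note l = alg_hom_lin[OF \<alpha>]
  note add = tensor_map_additive[OF A.T.module A.U.module B.U.module l]
  note [simp] = tensor_map_pure[OF A.T.module A.U.module B.U.module l] lin_closed[OF l]
    additive_closed[OF add] additive_add[OF add] alg_hom_mult[OF \<alpha>] alg_hom_one[OF \<alpha>]
  have mult: "tensor_map K T U' \<alpha> (A.mul x y) = B.mul (tensor_map K T U' \<alpha> x) (tensor_map K T U' \<alpha> y)"
    if "x \<in> carrier A.X" "y \<in> carrier A.X" for x y
    using that(1)
  proof (induction rule: A.tp.tensor_induct)
    case p: (pure a b)
    from that(2) show ?case
      by (induction rule: A.tp.tensor_induct) (use p in simp_all)
  qed (use that(2) in simp_all)
  show ?thesis
  proof (rule alg_homI)
    fix a p assume a: "a \<in> carrier T" and p: "p \<in> carrier A.P"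
    have "a \<odot>\<^bsub>A.P\<^esub> p = A.code (A.mul (A.pr a \<one>\<^bsub>U\<^esub>) (A.dec p))"
      using A.code_smult[OF a A.dec_closed[OF p]] p by simp
    then show "\<gamma> (a \<odot>\<^bsub>A.P\<^esub> p) = a \<odot>\<^bsub>B.P\<^esub> \<gamma> p"
      using a p by (simp add: \<gamma>_def mult B.code_smult)
  next
    have "\<one>\<^bsub>A.P\<^esub> \<in> carrier A.P" by (simp add: A.code_one)
    then show "\<gamma> \<one>\<^bsub>A.P\<^esub> = \<one>\<^bsub>B.P\<^esub>"
      by (simp add: \<gamma>_def A.code_one B.code_one)
  next
    fix p q assume pq: "p \<in> carrier A.P" "q \<in> carrier A.P"
    have "p \<oplus>\<^bsub>A.P\<^esub> q \<in> carrier A.P" "p \<otimes>\<^bsub>A.P\<^esub> q \<in> carrier A.P"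
      using A.code_add[of "A.dec p" "A.dec q"] A.code_mult[of "A.dec p" "A.dec q"] pq by simp_all
    then show "\<gamma> (p \<oplus>\<^bsub>A.P\<^esub> q) = \<gamma> p \<oplus>\<^bsub>B.P\<^esub> \<gamma> q" "\<gamma> (p \<otimes>\<^bsub>A.P\<^esub> q) = \<gamma> p \<otimes>\<^bsub>B.P\<^esub> \<gamma> q"
      using pq by (simp_all add: \<gamma>_def A.dec_add A.dec_mult mult B.code_add B.code_mult)
  qed (simp_all add: \<gamma>_def)
qed

text \<open>
  The universal property of \<open>T \<otimes> B\<close> as a coproduct, for \<open>B\<close> a \<open>T\<close>-algebra \<open>U\<close> viewed over \<open>K\<close>: the
  structure map \<open>T \<rightarrow> U\<close> and the identity of \<open>U\<close> induce a homomorphism \<open>T \<otimes> U \<rightarrow> U\<close>.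
\<close>

lemma tensor_alg_contraction:
  assumes T: "T \<in> comm_algebras K" and U: "U \<in> comm_algebras T" and inf: "infinite (UNIV :: 'u set)"
  defines "B \<equiv> base_alg K T U"
  defines "c \<equiv> \<lambda>p \<in> carrier (tensor_alg K T B).
     contr K T B (\<lambda>t. structure_map T U t) (tensor_decode K T B (p :: 'u))"
  shows "c \<in> alg_hom T (tensor_alg K T B) U"
proof -
  have B: "B \<in> comm_algebras K" unfolding B_def by (rule base_alg_closed[OF T U])
  interpret A: tensor_algebra K T B by (intro tensor_algebra.intro T B inf)
  interpret U: algebra T U by (rule comm_algebras_algebra[OF U])
  have l: "lin K T B (\<lambda>t. structure_map T U t)"
    unfolding B_def by (rule alg_hom_lin[OF structure_map_base_alg[OF T U]])
  note add = contr_additive[OF A.T.module B l]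
  have [simp]: "carrier B = carrier U" "ring.add B = ring.add U" "monoid.mult B = monoid.mult U" "\<one>\<^bsub>B\<^esub> = \<one>\<^bsub>U\<^esub>"
    by (simp_all add: B_def)
  note [simp] = contr_pure[OF A.T.module B l, simplified]
    additive_closed[OF add, simplified] additive_add[OF add, simplified]
  have mult: "contr K T B (\<lambda>t. structure_map T U t) (A.mul x y)
      = contr K T B (\<lambda>t. structure_map T U t) x \<otimes>\<^bsub>U\<^esub> contr K T B (\<lambda>t. structure_map T U t) y"
    if "x \<in> carrier A.X" "y \<in> carrier A.X" for x y
    using that(1)
  proof (induction rule: A.tp.tensor_induct)
    case p: (pure a b)
    from that(2) show ?case
    proof (induction rule: A.tp.tensor_induct)
      case q: (pure c d)
      then show ?case
        using p by (simp add: U.smult_assoc1 U.smult_assoc2 U.m_ac)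
    qed (use p in \<open>simp_all add: U.r_distr\<close>)
  qed (use that(2) in \<open>simp_all add: U.l_distr\<close>)
  show ?thesis
  proof (rule alg_homI)
    fix a p assume a: "a \<in> carrier T" and p: "p \<in> carrier A.P"
    have "a \<odot>\<^bsub>A.P\<^esub> p = A.code (A.mul (A.pr a \<one>\<^bsub>B\<^esub>) (A.dec p))"
      using A.code_smult[OF a A.dec_closed[OF p]] p by simp
    then show "c (a \<odot>\<^bsub>A.P\<^esub> p) = a \<odot>\<^bsub>U\<^esub> c p"
      using a p by (simp add: c_def mult U.smult_assoc2)
  next
    have "\<one>\<^bsub>A.P\<^esub> \<in> carrier A.P" by (simp add: A.code_one)
    then show "c \<one>\<^bsub>A.P\<^esub> = \<one>\<^bsub>U\<^esub>"
      by (simp add: c_def A.code_one)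
  next
    fix p q assume pq: "p \<in> carrier A.P" "q \<in> carrier A.P"
    have "p \<oplus>\<^bsub>A.P\<^esub> q \<in> carrier A.P" "p \<otimes>\<^bsub>A.P\<^esub> q \<in> carrier A.P"
      using A.code_add[of "A.dec p" "A.dec q"] A.code_mult[of "A.dec p" "A.dec q"] pq by simp_all
    then show "c (p \<oplus>\<^bsub>A.P\<^esub> q) = c p \<oplus>\<^bsub>U\<^esub> c q" "c (p \<otimes>\<^bsub>A.P\<^esub> q) = c p \<otimes>\<^bsub>U\<^esub> c q"
      using pq by (simp_all add: c_def A.dec_add A.dec_mult mult)
  qed (simp_all add: c_def)
qed

section \<open>The dual of a functor\<close>

lemma restrict_functor_simps [simp]:
  "Ob (restrict_functor R M S) T = Ob M (base_alg R S T)"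
  "Ar (restrict_functor R M S) T T' h = Ar M (base_alg R S T) (base_alg R S T') h"
  by (simp_all add: restrict_functor_def)

lemma ring_functor_simps [simp]: "Ob ring_functor T = self_alg T" "Ar ring_functor S T h = h"
  by (simp_all add: ring_functor_def)

lemma dual_carrier: "carrier (Ob (dual R M) S) = mor S (restrict_functor R M S) ring_functor"
  by (simp add: dual_def)

lemma dual_add:
  "f \<oplus>\<^bsub>Ob (dual R M) S\<^esub> g =
     (\<lambda>T \<in> comm_algebras S. \<lambda>x \<in> carrier (Ob M (base_alg R S T)). f T x \<oplus>\<^bsub>T\<^esub> g T x)"
  by (simp add: dual_def)

lemma dual_smult:
  "s \<odot>\<^bsub>Ob (dual R M) S\<^esub> f =
     (\<lambda>T \<in> comm_algebras S. \<lambda>x \<in> carrier (Ob M (base_alg R S T)). s \<odot>\<^bsub>T\<^esub> f T x)"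
  by (simp add: dual_def)

lemma dual_Ar:
  "Ar (dual R M) S S' h f =
     (\<lambda>T \<in> comm_algebras S'. \<lambda>x \<in> carrier (Ob M (base_alg R S' T)). f (restrict_scalars S h T) x)"
  by (simp add: dual_def)

text \<open>
  The element of \<open>M\<^sup>*(T)\<close> that is given by a morphism \<open>f : M \<rightarrow> V\<close> and a linear map \<open>j : V \<rightarrow> T\<close>. On
  \<open>x \<in> M(U)\<close> it takes the image of \<open>f(x)\<close> under \<open>V \<otimes> U \<rightarrow> U, v \<otimes> u \<mapsto> j(v) u\<close>. Taking \<open>V = T\<close> and
  \<open>j = 1\<close> gives every element of \<open>M\<^sup>*(T)\<close> exactly once; allowing arbitrary \<open>V\<close> and \<open>j\<close> makes the
  dependence on \<open>T\<close> visible.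
\<close>

definition functional ::
  "('u, 'r) ring_scheme \<Rightarrow> ('u, 'm) mfunctor \<Rightarrow> ('u, 'u) module \<Rightarrow> ('u, 'u) module \<Rightarrow>
   (('u, 'u) module \<Rightarrow> 'm \<Rightarrow> ('u \<times> 'u \<Rightarrow>\<^sub>0 int) set) \<Rightarrow> ('u \<Rightarrow> 'u) \<Rightarrow> ('u, 'u) module \<Rightarrow> 'm \<Rightarrow> 'u" where
  "functional K M V T f j = (\<lambda>U \<in> comm_algebras T. \<lambda>x \<in> carrier (Ob M (base_alg K T U)).
     contr K V (base_alg K T U) (\<lambda>v. structure_map T U (j v)) (f (base_alg K T U) x))"

lemma functional_apply:
  "U \<in> comm_algebras T \<Longrightarrow> x \<in> carrier (Ob M (base_alg K T U)) \<Longrightarrow>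
   functional K M V T f j U x
     = contr K V (base_alg K T U) (\<lambda>v. structure_map T U (j v)) (f (base_alg K T U) x)"
  by (simp add: functional_def)

lemma structure_lin:
  assumes "T \<in> comm_algebras K" "U \<in> comm_algebras T" "lin K V T j"
  shows "lin K V (base_alg K T U) (\<lambda>v. structure_map T U (j v))"
  by (rule lin_comp[OF assms(3) alg_hom_lin[OF structure_map_base_alg[OF assms(1,2)]]])

locale functor_in_universe = module_functor K M
  for K :: "('u, 'r) ring_scheme" and M :: "('u, 'm) mfunctor" +
  assumes infinite_universe: "infinite (UNIV :: 'u set)"
begin

abbreviation "qc \<equiv> quasi_coherent K"
abbreviation "D T \<equiv> Ob (dual K M) T"

lemma qc_mor_closed:
  "f \<in> mor K M (qc V) \<Longrightarrow> S \<in> comm_algebras K \<Longrightarrow> x \<in> carrier (Ob M S) \<Longrightarrow> f S x \<in> carrier (tensor K V S)"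
  using mor_closed[of f K M "qc V" S x] by simp

lemma functional_closed:
  assumes V: "module K V" and T: "T \<in> comm_algebras K" and f: "f \<in> mor K M (qc V)" and j: "lin K V T j"
  shows "functional K M V T f j \<in> carrier (D T)"
  unfolding dual_carrier
proof (rule morI)
  fix U assume U: "U \<in> comm_algebras T"
  let ?B = "base_alg K T U"
  have B: "?B \<in> comm_algebras K" by (rule base_alg_closed[OF T U])
  note k = structure_lin[OF T U j]
  interpret MB: module ?B "Ob M ?B" by (rule Ob_module[OF B])
  note l = mor_lin[OF f B, simplified]
  note add = contr_additive[OF V B k]
  show "lin U (Ob (restrict_functor K M T) U) (Ob ring_functor U) (functional K M V T f j U)"
    using MB.smult_closed lin_closed[OF l] lin_add[OF l] lin_smult[OF l] additive_closed[OF add] additive_add[OF add]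
      contr_smult[OF V B k]
    by (intro linI) (simp_all add: functional_apply[OF U])
next
  fix U U' h x assume U: "U \<in> comm_algebras T" and U': "U' \<in> comm_algebras T" and h: "h \<in> alg_hom T U U'"
    and x: "x \<in> carrier (Ob (restrict_functor K M T) U)"
  let ?B = "base_alg K T U" let ?B' = "base_alg K T U'"
  have B: "?B \<in> comm_algebras K" and B': "?B' \<in> comm_algebras K"
    by (rule base_alg_closed[OF T U] base_alg_closed[OF T U'])+
  have h': "h \<in> alg_hom K ?B ?B'" by (rule base_alg_hom[OF T h U])
  note k = structure_lin[OF T U j] and k' = structure_lin[OF T U' j]
  interpret U: algebra T U by (rule comm_algebras_algebra[OF U])
  have x': "x \<in> carrier (Ob M ?B)" using x by simp
  have fx: "f ?B x \<in> carrier (tensor K V ?B)" by (rule qc_mor_closed[OF f B x'])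
  have "contr K V ?B' (\<lambda>v. structure_map T U' (j v)) (tensor_map K V ?B' h (f ?B x))
      = contr K V ?B' (\<lambda>v. h (structure_map T U (j v))) (tensor_map K V ?B' h (f ?B x))"
    using lin_smult[OF alg_hom_lin[OF h]] alg_hom_one[OF h]
    by (intro contr_cong[OF V B' lin_comp[OF k alg_hom_lin[OF h']]])
      (simp_all add: lin_closed[OF j] tensor_map_closed[OF V _ _ alg_hom_lin[OF h']] fx
        comm_algebras_module B B')
  also have "\<dots> = h (contr K V ?B (\<lambda>v. structure_map T U (j v)) (f ?B x))"
    by (rule contr_natural[OF V B B' k h' fx])
  finally show "functional K M V T f j U' (Ar (restrict_functor K M T) U U' h x)
      = Ar ring_functor U U' h (functional K M V T f j U x)"
    using mor_natural[OF f B B' h' x'] x' Ar_closed[OF B B' h' x']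
    by (simp add: functional_apply[OF U] functional_apply[OF U'])
qed (simp_all add: functional_def)

lemma functional_eqI:
  assumes "\<And>U x. U \<in> comm_algebras T \<Longrightarrow> x \<in> carrier (Ob M (base_alg K T U)) \<Longrightarrow>
    contr K V (base_alg K T U) (\<lambda>v. structure_map T U (j v)) (f (base_alg K T U) x) = g U x"
    and "g \<in> extensional (comm_algebras T)"
    and "\<And>U. U \<in> comm_algebras T \<Longrightarrow> g U \<in> extensional (carrier (Ob M (base_alg K T U)))"
  shows "functional K M V T f j = g"
proof (rule extensionalityI[OF _ assms(2)])
  show "functional K M V T f j \<in> extensional (comm_algebras T)" by (simp add: functional_def)
  fix U assume U: "U \<in> comm_algebras T"
  show "functional K M V T f j U = g U"
    by (rule extensionalityI[OF _ assms(3)[OF U]])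
      (use U in \<open>simp_all add: assms(1) functional_def\<close>)
qed

lemma functional_add:
  assumes V: "module K V" and T: "T \<in> comm_algebras K" and f: "f \<in> mor K M (qc V)"
    and j: "lin K V T j" and i: "lin K V T i"
  shows "functional K M V T f (\<lambda>v. j v \<oplus>\<^bsub>T\<^esub> i v)
    = functional K M V T f j \<oplus>\<^bsub>D T\<^esub> functional K M V T f i"
proof (rule functional_eqI, goal_cases)
  case (1 U x)
  note B = base_alg_closed[OF T 1(1)]
  note s = structure_lin[OF T 1(1)]
  interpret U: algebra T U by (rule comm_algebras_algebra[OF 1(1)])
  have "contr K V (base_alg K T U) (\<lambda>v. structure_map T U (j v \<oplus>\<^bsub>T\<^esub> i v)) (f (base_alg K T U) x)
    = contr K V (base_alg K T U) (\<lambda>v. structure_map T U (j v) \<oplus>\<^bsub>base_alg K T U\<^esub> structure_map T U (i v))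
        (f (base_alg K T U) x)"
    using lin_closed[OF j] lin_closed[OF i] comm_algebras_module[OF T] comm_algebras_module[OF B]
    by (intro contr_cong[OF V B lin_plus[OF s[OF j] s[OF i] V]] qc_mor_closed[OF f B 1(2)])
      (simp_all add: U.smult_l_distr)
  then show ?case
    using 1 contr_plus[OF V B s[OF j] s[OF i] qc_mor_closed[OF f B 1(2)]]
    by (simp add: dual_add functional_apply)
qed (simp_all add: dual_add)

lemma functional_smult:
  assumes V: "module K V" and T: "T \<in> comm_algebras K" and f: "f \<in> mor K M (qc V)"
    and j: "lin K V T j" and t: "t \<in> carrier T"
  shows "functional K M V T f (\<lambda>v. t \<otimes>\<^bsub>T\<^esub> j v) = t \<odot>\<^bsub>D T\<^esub> functional K M V T f j"
proof (rule functional_eqI, goal_cases)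
  case (1 U x)
  note B = base_alg_closed[OF T 1(1)]
  note s = structure_lin[OF T 1(1)]
  interpret U: algebra T U by (rule comm_algebras_algebra[OF 1(1)])
  interpret B: algebra K "base_alg K T U" by (rule comm_algebras_algebra[OF B])
  interpret T: algebra K T by (rule comm_algebras_algebra[OF T])
  interpret tp: tensor_pair K V "base_alg K T U" by (intro tensor_pair.intro V B.module)
  have tj: "lin K V T (\<lambda>v. t \<otimes>\<^bsub>T\<^esub> j v)"
    by (rule lin_comp[OF j algebra_lin_mult[OF T.algebra_axioms t]])
  have fx: "f (base_alg K T U) x \<in> carrier (tensor K V (base_alg K T U))"
    by (rule qc_mor_closed[OF f B 1(2)])
  have add: "additive U (base_alg K T U) (\<lambda>z. t \<odot>\<^bsub>U\<^esub> z)"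
    using t by (intro additiveI) (simp_all add: U.smult_r_distr)
  have "additive (tensor K V (base_alg K T U)) U (contr K V (base_alg K T U) (\<lambda>v. structure_map T U (j v)))"
    using contr_additive[OF V B s[OF j]] by (simp add: additive_def)
  from tp.additive_tensor_eqI[OF contr_additive[OF V B s[OF tj]] additive_comp[OF this add] _ fx]
  have "contr K V (base_alg K T U) (\<lambda>v. structure_map T U (t \<otimes>\<^bsub>T\<^esub> j v)) (f (base_alg K T U) x)
    = t \<odot>\<^bsub>U\<^esub> contr K V (base_alg K T U) (\<lambda>v. structure_map T U (j v)) (f (base_alg K T U) x)"
    using t lin_closed[OF j]
    by (simp add: contr_pure[OF V B s[OF tj]] contr_pure[OF V B s[OF j]] U.smult_assoc1 U.smult_assoc2)
  then show ?case
    using 1 by (simp add: dual_smult functional_apply)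
qed (simp_all add: dual_smult)

lemma functional_push:
  assumes V: "module K V" and W: "module K W" and T: "T \<in> comm_algebras K" and f: "f \<in> mor K M (qc V)"
    and u: "lin K V W u" and j: "lin K W T j"
  shows "functional K M W T (push K M V W u f) j = functional K M V T f (\<lambda>v. j (u v))"
proof (rule functional_eqI, goal_cases)
  case (1 U x)
  note B = base_alg_closed[OF T 1(1)]
  show ?case
    using 1 contr_left_map[OF V W B u structure_lin[OF T 1(1) j] qc_mor_closed[OF f B 1(2)]]
    by (simp add: push_apply[OF B] functional_apply)
qed (simp_all add: functional_def)

lemma functional_cong:
  assumes V: "module K V" and T: "T \<in> comm_algebras K" and f: "f \<in> mor K M (qc V)"
    and j: "lin K V T j" and eq: "\<And>v. v \<in> carrier V \<Longrightarrow> i v = j v"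
  shows "functional K M V T f i = functional K M V T f j"
proof (rule functional_eqI, goal_cases)
  case (1 U x)
  note B = base_alg_closed[OF T 1(1)]
  show ?case
    unfolding functional_apply[OF 1]
    by (rule contr_cong[OF V B structure_lin[OF T 1(1) j] _ qc_mor_closed[OF f B 1(2)]]) (simp add: eq)
qed (simp_all add: functional_def)

lemma functional_Ar:
  assumes V: "module K V" and T: "T \<in> comm_algebras K" and T': "T' \<in> comm_algebras K"
    and f: "f \<in> mor K M (qc V)" and j: "lin K V T j" and \<alpha>: "\<alpha> \<in> alg_hom K T T'"
  shows "functional K M V T' f (\<lambda>v. \<alpha> (j v)) = Ar (dual K M) T T' \<alpha> (functional K M V T f j)"
proof (rule functional_eqI, goal_cases)
  case (1 U x)
  note B = base_alg_closed[OF T' 1(1)]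
  note r = restrict_scalars_alg_hom[OF T T' \<alpha> 1(1)]
  interpret U: algebra T' U by (rule comm_algebras_algebra[OF 1(1)])
  have "contr K V (base_alg K T' U) (\<lambda>v. structure_map T (restrict_scalars T \<alpha> U) (j v)) (f (base_alg K T' U) x)
     = contr K V (base_alg K T' U) (\<lambda>v. structure_map T' U (\<alpha> (j v))) (f (base_alg K T' U) x)"
    by (rule contr_cong[OF V B structure_lin[OF T' 1(1) lin_comp[OF j alg_hom_lin[OF \<alpha>]]] _ qc_mor_closed[OF f B 1(2)]])
      (simp add: lin_closed[OF j] lin_closed[OF alg_hom_lin[OF \<alpha>]])
  then show ?case
    using 1 by (simp add: dual_Ar functional_apply r)
qed (simp_all add: dual_Ar)

text \<open>Evaluating at \<open>T \<otimes> U\<close> recovers \<open>(j \<otimes> 1) \<circ> f\<close> from the functional.\<close>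

lemma functional_at_tensor_alg:
  assumes V: "module K V" and T: "T \<in> comm_algebras K" and U: "U \<in> comm_algebras K"
    and f: "f \<in> mor K M (qc V)" and j: "lin K V T j" and x: "x \<in> carrier (Ob M U)"
  shows "functional K M V T f j (tensor_alg K T U)
      (Ar M U (base_alg K T (tensor_alg K T U)) (tensor_inr K T U) x)
    = tensor_code K T U (left_map K V U T j (f U x))"
proof -
  interpret A: tensor_algebra K T U by (intro tensor_algebra.intro T U infinite_universe)
  interpret P: algebra T A.P by (rule comm_algebras_algebra[OF A.P_closed])
  let ?B = "base_alg K T A.P"
  let ?y = "Ar M U ?B (tensor_inr K T U) x"
  interpret tp: tensor_pair K V U by (intro tensor_pair.intro V A.U.module)
  note y = Ar_closed[OF U A.base_P A.inr_alg_hom x]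
  note l = alg_hom_lin[OF A.inr_alg_hom]
  note s = structure_lin[OF T A.P_closed j]
  note BM = comm_algebras_module[OF A.base_P]
  have code_add: "additive A.X ?B A.code"
    by (rule additiveI) (simp_all add: A.code_add)
  have pure: "contr K V ?B (\<lambda>v. structure_map T A.P (j v)) (tensor_map K V ?B (tensor_inr K T U) (pure K V U v u))
      = A.code (left_map K V U T j (pure K V U v u))" if "v \<in> carrier V" "u \<in> carrier U" for v u
    using that lin_closed[OF j]
    by (simp add: tensor_map_pure[OF V A.U.module BM l] contr_pure[OF V A.base_P s]
        left_map_pure[OF V A.U.module A.T.module j] A.code_one A.code_smult A.code_mult)
  have "contr K V ?B (\<lambda>v. structure_map T A.P (j v)) (tensor_map K V ?B (tensor_inr K T U) (f U x))
      = A.code (left_map K V U T j (f U x))"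
    by (rule tp.additive_tensor_eqI[OF additive_comp[OF tensor_map_additive[OF V A.U.module BM l]
            contr_additive[OF V A.base_P s]]
          additive_comp[OF left_map_additive[OF V A.U.module A.T.module j] code_add] pure
          qc_mor_closed[OF f U x]])
  then show ?thesis
    using mor_natural[OF f U A.base_P A.inr_alg_hom x] y
    by (simp add: functional_apply[OF A.P_closed])
qed

text \<open>
  The two functionals agree at \<open>T \<otimes> U\<close> on the images of all \<open>x \<in> M(U)\<close>.
\<close>

lemma functional_determines:
  assumes V: "module K V" and W: "module K W" and T: "T \<in> comm_algebras K"
    and f: "f \<in> mor K M (qc V)" and j: "lin K V T j"
    and g: "g \<in> mor K M (qc W)" and i: "lin K W T i"
    and eq: "functional K M V T f j = functional K M W T g i"
  shows "push K M V T j f = push K M W T i g"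
proof -
  have TM: "module K T" by (rule comm_algebras_module[OF T])
  note mf = module_functor_axioms
  show ?thesis
  proof (rule mor_eqI[OF push_mor[OF mf V TM j f] push_mor[OF mf W TM i g]])
    fix U x assume U: "U \<in> comm_algebras K" and x: "x \<in> carrier (Ob M U)"
    interpret A: tensor_algebra K T U by (intro tensor_algebra.intro T U infinite_universe)
    have "A.code (left_map K V U T j (f U x)) = A.code (left_map K W U T i (g U x))"
      using functional_at_tensor_alg[OF V T U f j x] functional_at_tensor_alg[OF W T U g i x] eq by simp
    then have "left_map K V U T j (f U x) = left_map K W U T i (g U x)"
      using left_map_closed[OF V A.U.module TM j qc_mor_closed[OF f U x]]
        left_map_closed[OF W A.U.module TM i qc_mor_closed[OF g U x]]
      by (metis A.dec_code)
    then show "push K M V T j f U x = push K M W T i g U x"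
      using U x by simp
  qed
qed

text \<open>
  The morphism \<open>f\<close> is \<open>M(U) \<rightarrow> M(T \<otimes> U) \<rightarrow> T \<otimes> U\<close>, the second map being \<open>h\<close> at the \<open>T\<close>-algebra
  \<open>T \<otimes> U\<close>. It gives back \<open>h\<close> because, for a \<open>T\<close>-algebra \<open>U\<close>, the composite \<open>U \<rightarrow> T \<otimes> U \<rightarrow> U\<close> is the
  identity and \<open>h\<close> is natural along the second map.
\<close>

lemma dual_element_is_functional:
  assumes T: "T \<in> comm_algebras K" and h: "h \<in> carrier (D T)"
  obtains f where "f \<in> mor K M (qc T)" "h = functional K M T T f (\<lambda>t. t)"
proof
  have h': "h \<in> mor T (restrict_functor K M T) ring_functor" using h by (simp add: dual_carrier)
  define f where "f = (\<lambda>U \<in> comm_algebras K. \<lambda>x \<in> carrier (Ob M U).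
    tensor_decode K T U (h (tensor_alg K T U)
      (Ar M U (base_alg K T (tensor_alg K T U)) (tensor_inr K T U) x)))"
  show f: "f \<in> mor K M (qc T)"
  proof (rule morI)
    fix U assume U: "U \<in> comm_algebras K"
    interpret A: tensor_algebra K T U by (intro tensor_algebra.intro T U infinite_universe)
    interpret MU: module U "Ob M U" by (rule Ob_module[OF U])
    interpret MB: module "base_alg K T A.P" "Ob M (base_alg K T A.P)" by (rule Ob_module[OF A.base_P])
    note l = mor_lin[OF h' A.P_closed, simplified]
    note c = Ar_closed[OF U A.base_P A.inr_alg_hom]
    note hc = lin_closed[OF l, simplified]
    show "lin U (Ob M U) (Ob (qc T) U) (f U)"
    proof (rule linI)
      fix x assume x: "x \<in> carrier (Ob M U)"
      then show "f U x \<in> carrier (Ob (qc T) U)"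
        using U by (simp add: f_def c hc)
      fix a assume a: "a \<in> carrier U"
      have "f U (a \<odot>\<^bsub>Ob M U\<^esub> x) = A.dec (tensor_inr K T U a \<otimes>\<^bsub>A.P\<^esub> h A.P (Ar M U (base_alg K T A.P) (tensor_inr K T U) x))"
        using U a x Ar_smult[OF U A.base_P A.inr_alg_hom a x]
          lin_smult[OF l, of "tensor_inr K T U a"] c[OF x] hc[OF c[OF x]]
        by (simp add: f_def)
      also have "\<dots> = a \<odot>\<^bsub>A.X\<^esub> A.dec (h A.P (Ar M U (base_alg K T A.P) (tensor_inr K T U) x))"
        using a x by (simp add: A.dec_mult hc c A.mul_inr)
      finally show "f U (a \<odot>\<^bsub>Ob M U\<^esub> x) = a \<odot>\<^bsub>Ob (qc T) U\<^esub> f U x"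
        using U x by (simp add: f_def)
    next
      fix x y assume xy: "x \<in> carrier (Ob M U)" "y \<in> carrier (Ob M U)"
      then show "f U (x \<oplus>\<^bsub>Ob M U\<^esub> y) = f U x \<oplus>\<^bsub>Ob (qc T) U\<^esub> f U y"
        using U Ar_add[OF U A.base_P A.inr_alg_hom xy] lin_add[OF l c[OF xy(1)] c[OF xy(2)]]
        by (simp add: f_def A.dec_add hc c)
    qed
  next
    fix U U' \<alpha> x assume U: "U \<in> comm_algebras K" and U': "U' \<in> comm_algebras K"
      and \<alpha>: "\<alpha> \<in> alg_hom K U U'" and x: "x \<in> carrier (Ob M U)"
    interpret A: tensor_algebra K T U by (intro tensor_algebra.intro T U infinite_universe)
    interpret B: tensor_algebra K T U' by (intro tensor_algebra.intro T U' infinite_universe)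
    let ?y = "Ar M U (base_alg K T A.P) (tensor_inr K T U) x"
    note y = Ar_closed[OF U A.base_P A.inr_alg_hom x]
    define \<gamma> where "\<gamma> = (\<lambda>p \<in> carrier A.P. B.code (tensor_map K T U' \<alpha> (A.dec p)))"
    have \<gamma>: "\<gamma> \<in> alg_hom T A.P B.P"
      unfolding \<gamma>_def by (rule tensor_alg_functorial[OF T U U' \<alpha> infinite_universe])
    have \<gamma>': "\<gamma> \<in> alg_hom K (base_alg K T A.P) (base_alg K T B.P)"
      by (rule base_alg_hom[OF T \<gamma> A.P_closed])
    note la = alg_hom_lin[OF \<alpha>]
    have hy: "h A.P ?y \<in> carrier A.P"
      using lin_closed[OF mor_lin[OF h' A.P_closed]] y by simp
    have "compose (carrier U) (tensor_inr K T U') \<alpha> = compose (carrier U) \<gamma> (tensor_inr K T U)"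
      using la by (auto simp: compose_def fun_eq_iff \<gamma>_def lin_closed[OF la] alg_hom_one[OF \<alpha>]
          tensor_map_pure[OF A.T.module A.U.module B.U.module la])
    then have "Ar M U' (base_alg K T B.P) (tensor_inr K T U') (Ar M U U' \<alpha> x)
        = Ar M (base_alg K T A.P) (base_alg K T B.P) \<gamma> ?y"
      using Ar_comp[OF U U' B.base_P \<alpha> B.inr_alg_hom x] Ar_comp[OF U A.base_P B.base_P A.inr_alg_hom \<gamma>' x]
      by simp
    moreover have "h B.P (Ar M (base_alg K T A.P) (base_alg K T B.P) \<gamma> ?y) = \<gamma> (h A.P ?y)"
      using mor_natural[OF h' A.P_closed B.P_closed \<gamma>, of ?y] y by simp
    moreover have "B.dec (\<gamma> (h A.P ?y)) = tensor_map K T U' \<alpha> (A.dec (h A.P ?y))"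
      using hy by (simp add: \<gamma>_def tensor_map_closed[OF A.T.module A.U.module B.U.module la])
    ultimately show "f U' (Ar M U U' \<alpha> x) = Ar (qc T) U U' \<alpha> (f U x)"
      using U U' x Ar_closed[OF U U' \<alpha> x] by (simp add: f_def)
  qed (simp_all add: f_def)
  show "h = functional K M T T f (\<lambda>t. t)"
  proof (rule functional_eqI[symmetric])
    fix U x assume U: "U \<in> comm_algebras T" and x: "x \<in> carrier (Ob M (base_alg K T U))"
    let ?B = "base_alg K T U"
    have B: "?B \<in> comm_algebras K" by (rule base_alg_closed[OF T U])
    interpret U: algebra T U by (rule comm_algebras_algebra[OF U])
    interpret A: tensor_algebra K T ?B by (intro tensor_algebra.intro T B infinite_universe)
    let ?y = "Ar M ?B (base_alg K T A.P) (tensor_inr K T ?B) x"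
    note y = Ar_closed[OF B A.base_P A.inr_alg_hom x]
    define c where "c = (\<lambda>p \<in> carrier A.P. contr K T ?B (\<lambda>t. structure_map T U t) (A.dec p))"
    have c: "c \<in> alg_hom T A.P U"
      unfolding c_def by (rule tensor_alg_contraction[OF T U infinite_universe])
    have c': "c \<in> alg_hom K (base_alg K T A.P) ?B"
      by (rule base_alg_hom[OF T c A.P_closed])
    have hy: "h A.P ?y \<in> carrier A.P"
      using lin_closed[OF mor_lin[OF h' A.P_closed]] y by simp
    have "compose (carrier ?B) c (tensor_inr K T ?B) = (\<lambda>u \<in> carrier ?B. u)"
      using contr_pure[OF A.T.module B structure_lin[OF T U lin_id], simplified]
      by (auto simp: compose_def fun_eq_iff c_def)
    then have "Ar M (base_alg K T A.P) ?B c ?y = x"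
      using Ar_comp[OF B A.base_P B A.inr_alg_hom c' x] Ar_id[OF B x] by simp
    moreover have "h U (Ar M (base_alg K T A.P) ?B c ?y) = c (h A.P ?y)"
      using mor_natural[OF h' A.P_closed U c, of ?y] y by simp
    ultimately show "contr K T ?B (\<lambda>v. structure_map T U v) (f ?B x) = h U x"
      using hy B x by (simp add: f_def c_def)
  qed (use mor_extensional[OF h'] in simp_all)
qed

end

section \<open>The bidual\<close>

lemma self_alg_restrict_scalars: "self_alg (restrict_scalars R \<phi> T) = self_alg T"
  unfolding self_alg_def restrict_scalars_simps by (simp add: restrict_scalars_def)

lemma self_alg_over_base:
  assumes "S \<in> comm_algebras R" "T \<in> comm_algebras S"
  shows "self_alg T \<in> comm_algebras (base_alg R S T)"
    and "base_alg R (base_alg R S T) (self_alg T) = base_alg R S T"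
  using self_alg_closed[OF comm_algebras_cring[OF base_alg_closed[OF assms]]]
    base_alg_self_alg[OF base_alg_closed[OF assms]]
  by (simp_all add: self_alg_base_alg)

lemma left_map_zero:
  assumes V: "module K V" and S: "module K S" and W: "module K W" and z: "z \<in> carrier (tensor K V S)"
    and u: "lin K V W u" and eq: "\<And>v. v \<in> carrier V \<Longrightarrow> u v = \<zero>\<^bsub>W\<^esub>"
  shows "left_map K V S W u z = \<zero>\<^bsub>tensor K W S\<^esub>"
proof -
  interpret V: tensor_pair K V S by (intro tensor_pair.intro V S)
  interpret W: tensor_pair K W S by (intro tensor_pair.intro W S)
  interpret T: abelian_group "tensor K W S" by (rule W.abelian_tensor)
  have "left_map K V S W u (pure K V S v s) = \<zero>\<^bsub>tensor K W S\<^esub>" if "v \<in> carrier V" "s \<in> carrier S" for v s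
    using that by (simp add: left_map_pure[OF V S W u] eq W.pure_zero_left)
  moreover have "additive (tensor K V S) (tensor K W S) (\<lambda>_. \<zero>\<^bsub>tensor K W S\<^esub>)"
    by (rule additiveI) simp_all
  ultimately show ?thesis
    using V.additive_tensor_eqI[OF left_map_additive[OF V S W u]] z by blast
qed

definition mor_add ::
  "('u, 'r) ring_scheme \<Rightarrow> ('u, 'm) mfunctor \<Rightarrow> ('u, 'n) mfunctor \<Rightarrow> (('u, 'u) module \<Rightarrow> 'm \<Rightarrow> 'n) \<Rightarrow>
   (('u, 'u) module \<Rightarrow> 'm \<Rightarrow> 'n) \<Rightarrow> ('u, 'u) module \<Rightarrow> 'm \<Rightarrow> 'n" where
  "mor_add K M N f g = (\<lambda>S \<in> comm_algebras K. \<lambda>x \<in> carrier (Ob M S). f S x \<oplus>\<^bsub>Ob N S\<^esub> g S x)"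

lemma mor_add_mor:
  assumes M: "module_functor K M" and N: "module_functor K N" and f: "f \<in> mor K M N" and g: "g \<in> mor K M N"
  shows "mor_add K M N f g \<in> mor K M N"
proof -
  interpret M: module_functor K M by fact
  interpret N: module_functor K N by fact
  show ?thesis
  proof (rule morI)
    fix S assume S: "S \<in> comm_algebras K"
    interpret MS: module S "Ob M S" by (rule M.Ob_module[OF S])
    interpret NS: module S "Ob N S" by (rule N.Ob_module[OF S])
    note lf = mor_lin[OF f S] and lg = mor_lin[OF g S]
    show "lin S (Ob M S) (Ob N S) (mor_add K M N f g S)"
      by (rule lin_cong[OF lin_plus[OF lf lg MS.module_axioms NS.module_axioms] _ MS.module_axioms])
        (simp add: mor_add_def S)
  next
    fix S T h x assume *: "S \<in> comm_algebras K" "T \<in> comm_algebras K" "h \<in> alg_hom K S T"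
      "x \<in> carrier (Ob M S)"
    then show "mor_add K M N f g T (Ar M S T h x) = Ar N S T h (mor_add K M N f g S x)"
      using mor_natural[OF f *] mor_natural[OF g *] mor_closed[OF f *(1,4)] mor_closed[OF g *(1,4)]
      by (simp add: mor_add_def M.Ar_closed N.Ar_add)
  qed (simp_all add: mor_add_def)
qed

context functor_in_universe
begin

abbreviation "DD S \<equiv> Ob (dual K (dual K M)) S"

lemma qc_functor: "module K V \<Longrightarrow> module_functor K (qc V)"
  by (rule quasi_coherent_functor[OF is_cring])

text \<open>
  The element \<open>z \<in> V \<otimes> S\<close> determines the values of \<open>\<Phi> \<in> M\<^sup>*\<^sup>*(S)\<close> on all functionals that come from the
  morphism \<open>f : M \<rightarrow> V\<close>. For \<open>\<Phi>\<close> the image of \<open>m \<in> M(S)\<close>, it is \<open>f(m)\<close>.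
\<close>

definition represents ::
  "('u, 'u) module \<Rightarrow> (('u, 'u) module \<Rightarrow> (('u, 'u) module \<Rightarrow> 'm \<Rightarrow> 'u) \<Rightarrow> 'u) \<Rightarrow> ('u, 'u) module \<Rightarrow>
   (('u, 'u) module \<Rightarrow> 'm \<Rightarrow> ('u \<times> 'u \<Rightarrow>\<^sub>0 int) set) \<Rightarrow> ('u \<times> 'u \<Rightarrow>\<^sub>0 int) set \<Rightarrow> bool" where
  "represents S \<Phi> V f z \<longleftrightarrow> (\<forall>T \<in> comm_algebras S. \<forall>j. lin K V (base_alg K S T) j \<longrightarrow>
     \<Phi> T (functional K M V (base_alg K S T) f j)
       = contr K V (base_alg K S T) j (tensor_map K V (base_alg K S T) (structure_map S T) z))"

lemma representsD:
  "represents S \<Phi> V f z \<Longrightarrow> T \<in> comm_algebras S \<Longrightarrow> lin K V (base_alg K S T) j \<Longrightarrow>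
   \<Phi> T (functional K M V (base_alg K S T) f j)
       = contr K V (base_alg K S T) j (tensor_map K V (base_alg K S T) (structure_map S T) z)"
  by (simp add: represents_def)

lemma square_zero_tensor:
  assumes S: "S \<in> comm_algebras K" and V: "module K V"
  shows "square_zero_ext S (tensor K V S)"
proof -
  interpret tensor_pair K V S by (intro tensor_pair.intro V comm_algebras_module[OF S])
  show ?thesis
    by (intro square_zero_ext.intro square_zero_ext_axioms.intro
        tensor_module[OF V comm_algebras_algebra[OF S]] infinite_universe
        tensor_inj_into_universe[OF infinite_universe])
qed

text \<open>
  The square-zero extension \<open>S \<oplus> (V \<otimes> S)\<close> with the inclusion \<open>v \<mapsto> v \<otimes> 1\<close> of \<open>V\<close> is the universal
  test object: for the inclusion, the map \<open>V \<otimes> S \<rightarrow> S \<oplus> (V \<otimes> S)\<close> that occurs in \<open>represents\<close> is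
  injective.
\<close>

abbreviation univ_alg :: "('u, 'u) module \<Rightarrow> ('u, 'u) module \<Rightarrow> ('u, 'u) module" where
  "univ_alg S V \<equiv> square_zero S (tensor K V S)"

definition univ_incl :: "('u, 'u) module \<Rightarrow> ('u, 'u) module \<Rightarrow> 'u \<Rightarrow> 'u" where
  "univ_incl S V v = sq S (tensor K V S) \<zero>\<^bsub>S\<^esub> (pure K V S v \<one>\<^bsub>S\<^esub>)"

lemma
  assumes S: "S \<in> comm_algebras K" and V: "module K V"
  defines "B \<equiv> base_alg K S (univ_alg S V)"
  shows univ_incl_lin: "lin K V B (univ_incl S V)"
    and contr_univ_incl: "\<And>z. z \<in> carrier (tensor K V S) \<Longrightarrow>
      contr K V B (univ_incl S V) (tensor_map K V B (structure_map S (univ_alg S V)) z)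
        = sq S (tensor K V S) \<zero>\<^bsub>S\<^esub> z"
proof -
  interpret S: algebra K S by (rule comm_algebras_algebra[OF S])
  interpret E: square_zero_ext S "tensor K V S" by (rule square_zero_tensor[OF S V])
  interpret tp: tensor_pair K V S by (intro tensor_pair.intro V S.module)
  have EC: "univ_alg S V \<in> comm_algebras S" by (rule E.square_zero_closed)
  have B: "B \<in> comm_algebras K" unfolding B_def by (rule base_alg_closed[OF S EC])
  have BM: "module K B" by (rule comm_algebras_module[OF B])
  show l: "lin K V B (univ_incl S V)"
  proof (rule linI)
    fix a v assume *: "a \<in> carrier K" "v \<in> carrier V"
    have "pure K V S (a \<odot>\<^bsub>V\<^esub> v) \<one>\<^bsub>S\<^esub> = (a \<odot>\<^bsub>S\<^esub> \<one>\<^bsub>S\<^esub>) \<odot>\<^bsub>tensor K V S\<^esub> pure K V S v \<one>\<^bsub>S\<^esub>"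
      using * by (simp add: tp.pure_balanced tensor_smult_pure[OF V S.algebra_axioms])
    then show "univ_incl S V (a \<odot>\<^bsub>V\<^esub> v) = a \<odot>\<^bsub>B\<^esub> univ_incl S V v"
      using * by (simp add: B_def univ_incl_def E.sq_smult)
  qed (simp_all add: B_def univ_incl_def E.sq_add tp.pure_add_left)
  fix z assume z: "z \<in> carrier (tensor K V S)"
  have cB: "carrier B = carrier (univ_alg S V)" by (simp add: B_def)
  have str: "lin K S B (structure_map S (univ_alg S V))"
    unfolding B_def by (rule alg_hom_lin[OF structure_map_base_alg[OF S EC]])
  have add: "additive (tensor K V S) B (\<lambda>z. sq S (tensor K V S) \<zero>\<^bsub>S\<^esub> z)"
    by (rule additiveI) (simp_all add: B_def E.sq_add)
  show "contr K V B (univ_incl S V) (tensor_map K V B (structure_map S (univ_alg S V)) z)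
        = sq S (tensor K V S) \<zero>\<^bsub>S\<^esub> z"
  proof (rule tp.additive_tensor_eqI[OF additive_comp[OF tensor_map_additive[OF V S.module BM str]
          contr_additive[OF V B l]] add _ z])
    fix v s assume v: "v \<in> carrier V" and s: "s \<in> carrier S"
    have c: "s \<odot>\<^bsub>univ_alg S V\<^esub> \<one>\<^bsub>univ_alg S V\<^esub> = sq S (tensor K V S) s \<zero>\<^bsub>tensor K V S\<^esub>"
      using s by (simp add: E.sq_one E.sq_smult)
    have "contr K V B (univ_incl S V) (tensor_map K V B (structure_map S (univ_alg S V)) (pure K V S v s))
       = univ_incl S V v \<otimes>\<^bsub>B\<^esub> sq S (tensor K V S) s \<zero>\<^bsub>tensor K V S\<^esub>"
      using v s
      by (simp add: tensor_map_pure[OF V S.module BM str] contr_pure[OF V B l] c cB)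
    then show "contr K V B (univ_incl S V) (tensor_map K V B (structure_map S (univ_alg S V)) (pure K V S v s))
       = sq S (tensor K V S) \<zero>\<^bsub>S\<^esub> (pure K V S v s)"
      using v s by (simp add: B_def univ_incl_def E.sq_mult tensor_smult_pure[OF V S.algebra_axioms])
  qed
qed

lemma represents_unique:
  assumes S: "S \<in> comm_algebras K" and V: "module K V"
    and z: "z \<in> carrier (tensor K V S)" and z': "z' \<in> carrier (tensor K V S)"
    and r: "represents S \<Phi> V f z" "represents S \<Phi> V f z'"
  shows "z = z'"
proof -
  interpret E: square_zero_ext S "tensor K V S" by (rule square_zero_tensor[OF S V])
  have "sq S (tensor K V S) \<zero>\<^bsub>S\<^esub> z = sq S (tensor K V S) \<zero>\<^bsub>S\<^esub> z'"
    using representsD[OF r(1) E.square_zero_closed univ_incl_lin[OF S V]]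
      representsD[OF r(2) E.square_zero_closed univ_incl_lin[OF S V]]
      contr_univ_incl[OF S V z] contr_univ_incl[OF S V z'] by simp
  then show ?thesis using z z' by (simp add: E.sq_eq_iff)
qed

text \<open>
  Let \<open>s\<^sub>0 + z\<close> be the value of \<open>\<Phi>\<close> on the functional given by \<open>f\<close> and the inclusion
  \<open>V \<rightarrow> S \<oplus> (V \<otimes> S)\<close>. An arbitrary linear map \<open>j : V \<rightarrow> T\<close> into an \<open>S\<close>-algebra induces a homomorphism
  \<open>S \<oplus> (V \<otimes> S) \<rightarrow> T[\<epsilon>]\<close>, which takes this functional to \<open>\<epsilon>\<close> times the one given by \<open>f\<close> and \<open>j\<close>.
  Comparing the coefficients of \<open>\<epsilon>\<close> shows that \<open>z\<close> has the required property.
\<close>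

lemma represents_exists:
  assumes S: "S \<in> comm_algebras K" and V: "module K V" and f: "f \<in> mor K M (qc V)"
    and \<Phi>: "\<Phi> \<in> carrier (DD S)"
  obtains z where "z \<in> carrier (tensor K V S)" "represents S \<Phi> V f z"
proof -
  interpret S: algebra K S by (rule comm_algebras_algebra[OF S])
  interpret E: square_zero_ext S "tensor K V S" by (rule square_zero_tensor[OF S V])
  interpret tp: tensor_pair K V S by (intro tensor_pair.intro V S.module)
  let ?E = "univ_alg S V" let ?B = "base_alg K S ?E"
  let ?j0 = "univ_incl S V"
  have E: "?E \<in> comm_algebras S" by (rule E.square_zero_closed)
  have B: "?B \<in> comm_algebras K" by (rule base_alg_closed[OF S E])
  note j0 = univ_incl_lin[OF S V]
  have \<Phi>': "\<Phi> \<in> mor S (restrict_functor K (dual K M) S) ring_functor"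
    using \<Phi> by (simp add: dual_carrier)
  have \<Phi>_closed: "\<Phi> T h \<in> carrier T" if "T \<in> comm_algebras S" "h \<in> carrier (D (base_alg K S T))" for T h
    using mor_closed[OF \<Phi>' that(1)] that(2) by simp
  have h0: "functional K M V ?B f ?j0 \<in> carrier (D ?B)" by (rule functional_closed[OF V B f j0])
  obtain s0 z where sz: "\<Phi> ?E (functional K M V ?B f ?j0) = sq S (tensor K V S) s0 z"
    "s0 \<in> carrier S" "z \<in> carrier (tensor K V S)"
    using \<Phi>_closed[OF E h0] by (rule E.sq_cases)
  have "represents S \<Phi> V f z"
    unfolding represents_def
  proof (intro ballI allI impI)
    fix T j assume T: "T \<in> comm_algebras S" and j: "lin K V (base_alg K S T) j"
    let ?T = "base_alg K S T" let ?D = "dual_numbers T" let ?DS = "base_alg S T ?D"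
    let ?DK = "base_alg K S ?DS"
    have TK: "?T \<in> comm_algebras K" by (rule base_alg_closed[OF S T])
    interpret T: algebra S T by (rule comm_algebras_algebra[OF T])
    interpret TK: algebra K ?T by (rule comm_algebras_algebra[OF TK])
    interpret DN: square_zero_ext T "self_alg T"
      by (rule dual_numbers_square_zero[OF T.M_cring infinite_universe])
    have DS: "?DS \<in> comm_algebras S" by (rule base_alg_closed[OF T DN.square_zero_closed])
    have DK: "?DK \<in> comm_algebras K" by (rule base_alg_closed[OF S DS])
    have i: "structure_map T ?D \<in> alg_hom S T ?DS" by (rule structure_map_base_alg[OF T DN.square_zero_closed])
    have i': "structure_map T ?D \<in> alg_hom K ?T ?DK" by (rule base_alg_hom[OF S i T])
    have str: "structure_map S T \<in> alg_hom K S ?T" by (rule structure_map_base_alg[OF S T])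
    note strl = alg_hom_lin[OF str]
    define \<mu> where "\<mu> n = contr K V ?T j (tensor_map K V ?T (structure_map S T) n)" for n
    have \<mu>_add: "additive (tensor K V S) ?T \<mu>"
      unfolding \<mu>_def
      by (rule additive_comp[OF tensor_map_additive[OF V S.module TK.module strl] contr_additive[OF V TK j]])
    have \<mu>: "lin S (tensor K V S) T \<mu>"
    proof (rule linI)
      fix a n assume a: "a \<in> carrier S" and n: "n \<in> carrier (tensor K V S)"
      have "\<mu> (a \<odot>\<^bsub>tensor K V S\<^esub> n) = (a \<odot>\<^bsub>T\<^esub> \<one>\<^bsub>T\<^esub>) \<otimes>\<^bsub>T\<^esub> \<mu> n"
        using a n contr_smult[OF V TK j _ tensor_map_closed[OF V S.module TK.module strl n], of "structure_map S T a"]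
        by (simp add: \<mu>_def tensor_map_smult[OF V S TK str])
      then show "\<mu> (a \<odot>\<^bsub>tensor K V S\<^esub> n) = a \<odot>\<^bsub>T\<^esub> \<mu> n"
        using a additive_closed[OF \<mu>_add n] by (simp add: T.smult_assoc2)
    qed (use additive_closed[OF \<mu>_add] additive_add[OF \<mu>_add] in simp_all)
    have \<mu>_pure: "\<mu> (pure K V S v \<one>\<^bsub>S\<^esub>) = j v" if "v \<in> carrier V" for v
      using that lin_closed[OF j that]
      by (simp add: \<mu>_def tensor_map_pure[OF V S.module TK.module strl] contr_pure[OF V TK j])
    define \<beta> where "\<beta> = square_zero_hom S (tensor K V S) T \<mu>"
    have \<beta>: "\<beta> \<in> alg_hom S ?E ?DS" unfolding \<beta>_def by (rule E.square_zero_hom_alg_hom[OF T \<mu>])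
    have \<beta>': "\<beta> \<in> alg_hom K ?B ?DK" by (rule base_alg_hom[OF S \<beta> E])
    let ?\<epsilon> = "dn T \<zero>\<^bsub>T\<^esub> \<one>\<^bsub>T\<^esub>"
    have i_apply: "structure_map T ?D t = dn T t \<zero>\<^bsub>T\<^esub>" if "t \<in> carrier T" for t
      using that by (simp add: DN.sq_one DN.sq_smult)
    have \<epsilon>_mult: "?\<epsilon> \<otimes>\<^bsub>?D\<^esub> dn T t \<zero>\<^bsub>T\<^esub> = dn T \<zero>\<^bsub>T\<^esub> t" if "t \<in> carrier T" for t
      using that by (simp add: DN.sq_mult)
    have ij: "lin K V ?DK (\<lambda>v. structure_map T ?D (j v))" by (rule lin_comp[OF j alg_hom_lin[OF i']])
    have \<epsilon>ij: "lin K V ?DK (\<lambda>v. ?\<epsilon> \<otimes>\<^bsub>?DK\<^esub> structure_map T ?D (j v))"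
      by (rule lin_comp[OF ij algebra_lin_mult[OF comm_algebras_algebra[OF DK]]]) simp
    have jc: "j v \<in> carrier T" if "v \<in> carrier V" for v
      using lin_closed[OF j that] by simp
    (* both sides are the functional given by f and the map sending v to j(v) \<epsilon> *)
    have "functional K M V ?DK f (\<lambda>v. \<beta> (?j0 v)) = functional K M V ?DK f (\<lambda>v. ?\<epsilon> \<otimes>\<^bsub>?DK\<^esub> structure_map T ?D (j v))"
    proof (rule functional_cong[OF V DK f \<epsilon>ij])
      fix v assume v: "v \<in> carrier V"
      have "\<beta> (?j0 v) = dn T \<zero>\<^bsub>T\<^esub> (j v)"
        using v by (simp add: \<beta>_def univ_incl_def E.square_zero_hom_sq \<mu>_pure)
      then show "\<beta> (?j0 v) = ?\<epsilon> \<otimes>\<^bsub>?DK\<^esub> structure_map T ?D (j v)"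
        using v by (simp add: i_apply jc \<epsilon>_mult del: structure_map_apply)
    qed
    also have "\<dots> = ?\<epsilon> \<odot>\<^bsub>D ?DK\<^esub> functional K M V ?DK f (\<lambda>v. structure_map T ?D (j v))"
      by (rule functional_smult[OF V DK f ij]) simp
    also have "functional K M V ?DK f (\<lambda>v. structure_map T ?D (j v))
        = Ar (dual K M) ?T ?DK (structure_map T ?D) (functional K M V ?T f j)"
      by (rule functional_Ar[OF V TK DK f j i'])
    also have "functional K M V ?DK f (\<lambda>v. \<beta> (?j0 v))
        = Ar (dual K M) ?B ?DK \<beta> (functional K M V ?B f ?j0)"
      by (rule functional_Ar[OF V B DK f j0 \<beta>'])
    finally have eq: "Ar (dual K M) ?B ?DK \<beta> (functional K M V ?B f ?j0)
        = ?\<epsilon> \<odot>\<^bsub>D ?DK\<^esub> Ar (dual K M) ?T ?DK (structure_map T ?D) (functional K M V ?T f j)" .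
    have hj: "functional K M V ?T f j \<in> carrier (D ?T)" by (rule functional_closed[OF V TK f j])
    have hij: "Ar (dual K M) ?T ?DK (structure_map T ?D) (functional K M V ?T f j) \<in> carrier (D ?DK)"
      unfolding functional_Ar[OF V TK DK f j i', symmetric] by (rule functional_closed[OF V DK f ij])
    let ?y = "\<Phi> T (functional K M V ?T f j)"
    have y: "?y \<in> carrier T" by (rule \<Phi>_closed[OF T hj])
    have "\<beta> (\<Phi> ?E (functional K M V ?B f ?j0)) = \<Phi> ?DS (Ar (dual K M) ?B ?DK \<beta> (functional K M V ?B f ?j0))"
      using mor_natural[OF \<Phi>' E DS \<beta>] h0 by simp
    also have "\<dots> = ?\<epsilon> \<otimes>\<^bsub>?DS\<^esub> \<Phi> ?DS (Ar (dual K M) ?T ?DK (structure_map T ?D) (functional K M V ?T f j))"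
      unfolding eq using lin_smult[OF mor_lin[OF \<Phi>' DS], of ?\<epsilon>] hij \<Phi>_closed[OF DS hij] by simp
    also have "\<Phi> ?DS (Ar (dual K M) ?T ?DK (structure_map T ?D) (functional K M V ?T f j)) = structure_map T ?D ?y"
      using mor_natural[OF \<Phi>' T DS i] hj by simp
    finally have "\<beta> (\<Phi> ?E (functional K M V ?B f ?j0)) = dn T \<zero>\<^bsub>T\<^esub> ?y"
      using y by (simp add: i_apply \<epsilon>_mult del: structure_map_apply)
    moreover have "\<beta> (\<Phi> ?E (functional K M V ?B f ?j0)) = dn T (s0 \<odot>\<^bsub>T\<^esub> \<one>\<^bsub>T\<^esub>) (\<mu> z)"
      using sz by (simp add: \<beta>_def E.square_zero_hom_sq)
    ultimately have "?y = \<mu> z"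
      using DN.sq_eq_iff[of "\<zero>\<^bsub>T\<^esub>" ?y "s0 \<odot>\<^bsub>T\<^esub> \<one>\<^bsub>T\<^esub>" "\<mu> z"] y lin_closed[OF \<mu> sz(3)] sz(2) by simp
    then show "\<Phi> T (functional K M V ?T f j) = contr K V ?T j (tensor_map K V ?T (structure_map S T) z)"
      by (simp add: \<mu>_def)
  qed
  with sz(3) show ?thesis by (rule that)
qed

lemma represents_push:
  assumes S: "S \<in> comm_algebras K" and V: "module K V" and W: "module K W"
    and f: "f \<in> mor K M (qc V)" and u: "lin K V W u" and z: "z \<in> carrier (tensor K V S)"
    and r: "represents S \<Phi> V f z"
  shows "represents S \<Phi> W (push K M V W u f) (left_map K V S W u z)"
  unfolding represents_def
proof (intro ballI allI impI)
  fix T j assume T: "T \<in> comm_algebras S" and j: "lin K W (base_alg K S T) j"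
  let ?T = "base_alg K S T"
  have TK: "?T \<in> comm_algebras K" by (rule base_alg_closed[OF S T])
  note m = comm_algebras_module[OF S] comm_algebras_module[OF TK]
  note strl = alg_hom_lin[OF structure_map_base_alg[OF S T]]
  have "\<Phi> T (functional K M W ?T (push K M V W u f) j)
      = contr K V ?T (\<lambda>v. j (u v)) (tensor_map K V ?T (structure_map S T) z)"
    unfolding functional_push[OF V W TK f u j] by (rule representsD[OF r T lin_comp[OF u j]])
  also have "\<dots> = contr K W ?T j (left_map K V ?T W u (tensor_map K V ?T (structure_map S T) z))"
    by (rule contr_left_map[OF V W TK u j tensor_map_closed[OF V m strl z], symmetric])
  also have "left_map K V ?T W u (tensor_map K V ?T (structure_map S T) z)
      = tensor_map K W ?T (structure_map S T) (left_map K V S W u z)"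
    by (rule left_map_tensor_map[OF V m(1) W m(2) u strl z])
  finally show "\<Phi> T (functional K M W ?T (push K M V W u f) j)
      = contr K W ?T j (tensor_map K W ?T (structure_map S T) (left_map K V S W u z))" .
qed

lemma bidual_map_apply:
  assumes "S \<in> comm_algebras K" "m \<in> carrier (Ob M S)" "T \<in> comm_algebras S"
    "h \<in> carrier (D (base_alg K S T))"
  shows "bidual_map K M S m T h = h (self_alg T) (Ar M S (base_alg K S T) (structure_map S T) m)"
  using assms by (simp add: bidual_map_def)

lemma bidual_represents:
  assumes S: "S \<in> comm_algebras K" and V: "module K V" and f: "f \<in> mor K M (qc V)"
    and m: "m \<in> carrier (Ob M S)"
  shows "represents S (bidual_map K M S m) V f (f S m)"
  unfolding represents_def
proof (intro ballI allI impI)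
  fix T j assume T: "T \<in> comm_algebras S" and j: "lin K V (base_alg K S T) j"
  let ?T = "base_alg K S T"
  have TK: "?T \<in> comm_algebras K" by (rule base_alg_closed[OF S T])
  interpret T: algebra S T by (rule comm_algebras_algebra[OF T])
  note str = structure_map_base_alg[OF S T]
  note self = self_alg_over_base[OF S T]
  let ?y = "Ar M S ?T (structure_map S T) m"
  have y: "?y \<in> carrier (Ob M ?T)" by (rule Ar_closed[OF S TK str m])
  have fy: "f ?T ?y = tensor_map K V ?T (structure_map S T) (f S m)"
    using mor_natural[OF f S TK str m] by simp
  have "contr K V ?T (\<lambda>v. structure_map ?T (self_alg T) (j v)) (f ?T ?y) = contr K V ?T j (f ?T ?y)"
    using lin_closed[OF j] by (intro contr_cong[OF V TK j _ qc_mor_closed[OF f TK y]]) simp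
  then show "bidual_map K M S m T (functional K M V ?T f j)
      = contr K V ?T j (tensor_map K V ?T (structure_map S T) (f S m))"
    unfolding bidual_map_apply[OF S m T functional_closed[OF V TK f j]]
    using functional_apply[OF self(1), where x = ?y and K = K and M = M and V = V and f = f and j = j]
      y self(2) fy by simp
qed

lemma functional_mor_add:
  assumes V: "module K V" and T: "T \<in> comm_algebras K" and f: "f \<in> mor K M (qc V)"
    and g: "g \<in> mor K M (qc V)" and j: "lin K V T j"
  shows "functional K M V T (mor_add K M (qc V) f g) j
    = functional K M V T f j \<oplus>\<^bsub>D T\<^esub> functional K M V T g j"
proof (rule functional_eqI, goal_cases)
  case (1 U x)
  note B = base_alg_closed[OF T 1(1)]
  show ?case
    using 1 additive_add[OF contr_additive[OF V B structure_lin[OF T 1(1) j]]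
        qc_mor_closed[OF f B 1(2)] qc_mor_closed[OF g B 1(2)]]
    by (simp add: dual_add mor_add_def B functional_apply)
qed (simp_all add: dual_add)

lemma dual_smult_closed:
  assumes T: "T \<in> comm_algebras K" and h: "h \<in> carrier (D T)" and t: "t \<in> carrier T"
  shows "t \<odot>\<^bsub>D T\<^esub> h \<in> carrier (D T)"
proof -
  note TM = comm_algebras_module[OF T]
  obtain f where f: "f \<in> mor K M (qc T)" "h = functional K M T T f (\<lambda>t. t)"
    using dual_element_is_functional[OF T h] by blast
  show ?thesis
    unfolding f(2) functional_smult[OF TM T f(1) lin_id t, symmetric]
    by (rule functional_closed[OF TM T f(1) algebra_lin_mult[OF comm_algebras_algebra[OF T] t]])
qed

lemma dual_add_closed:
  assumes T: "T \<in> comm_algebras K" and h: "h \<in> carrier (D T)" and h': "h' \<in> carrier (D T)"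
  shows "h \<oplus>\<^bsub>D T\<^esub> h' \<in> carrier (D T)"
proof -
  note TM = comm_algebras_module[OF T]
  obtain f where f: "f \<in> mor K M (qc T)" "h = functional K M T T f (\<lambda>t. t)"
    using dual_element_is_functional[OF T h] by blast
  obtain g where g: "g \<in> mor K M (qc T)" "h' = functional K M T T g (\<lambda>t. t)"
    using dual_element_is_functional[OF T h'] by blast
  show ?thesis
    unfolding f(2) g(2) functional_mor_add[OF TM T f(1) g(1) lin_id, symmetric]
    by (rule functional_closed[OF TM T mor_add_mor[OF module_functor_axioms qc_functor[OF TM] f(1) g(1)] lin_id])
qed

lemma dual_Ar_closed:
  assumes T: "T \<in> comm_algebras K" and T': "T' \<in> comm_algebras K" and \<alpha>: "\<alpha> \<in> alg_hom K T T'"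
    and h: "h \<in> carrier (D T)"
  shows "Ar (dual K M) T T' \<alpha> h \<in> carrier (D T')"
proof -
  note TM = comm_algebras_module[OF T]
  obtain f where f: "f \<in> mor K M (qc T)" "h = functional K M T T f (\<lambda>t. t)"
    using dual_element_is_functional[OF T h] by blast
  show ?thesis
    unfolding f(2) functional_Ar[OF TM T T' f(1) lin_id \<alpha>, symmetric]
    by (rule functional_closed[OF TM T' f(1) alg_hom_lin[OF \<alpha>]])
qed

lemma bidual_map_closed:
  assumes S: "S \<in> comm_algebras K" and m: "m \<in> carrier (Ob M S)"
  shows "bidual_map K M S m \<in> carrier (DD S)"
  unfolding dual_carrier
proof (rule morI)
  fix T assume T: "T \<in> comm_algebras S"
  let ?T = "base_alg K S T"
  have TK: "?T \<in> comm_algebras K" by (rule base_alg_closed[OF S T])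
  note self = self_alg_over_base[OF S T]
  let ?y = "Ar M S ?T (structure_map S T) m"
  have y: "?y \<in> carrier (Ob M ?T)" by (rule Ar_closed[OF S TK structure_map_base_alg[OF S T] m])
  have c: "h (self_alg T) ?y \<in> carrier T" if "h \<in> carrier (D ?T)" for h
    using mor_closed[OF that[unfolded dual_carrier] self(1), of ?y] y self(2) by simp
  show "lin T (Ob (restrict_functor K (dual K M) S) T) (Ob ring_functor T) (bidual_map K M S m T)"
  proof (rule linI; unfold restrict_functor_simps ring_functor_simps self_alg_simps)
    fix h assume h: "h \<in> carrier (D ?T)"
    then show "bidual_map K M S m T h \<in> carrier T" by (simp add: bidual_map_apply[OF S m T] c)
    fix t assume t: "t \<in> carrier T"
    show "bidual_map K M S m T (t \<odot>\<^bsub>D ?T\<^esub> h) = t \<odot>\<^bsub>self_alg T\<^esub> bidual_map K M S m T h"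
      using h t dual_smult_closed[OF TK h] t y self by (simp add: bidual_map_apply[OF S m T] dual_smult)
  next
    fix h h' assume h: "h \<in> carrier (D ?T)" "h' \<in> carrier (D ?T)"
    interpret T: algebra S T by (rule comm_algebras_algebra[OF T])
    show "bidual_map K M S m T (h \<oplus>\<^bsub>D ?T\<^esub> h') = bidual_map K M S m T h \<oplus>\<^bsub>T\<^esub> bidual_map K M S m T h'"
      using h dual_add_closed[OF TK h] y self by (simp add: bidual_map_apply[OF S m T] dual_add)
  qed
next
  fix T T' \<alpha> h assume T: "T \<in> comm_algebras S" and T': "T' \<in> comm_algebras S" and \<alpha>: "\<alpha> \<in> alg_hom S T T'"
    and "h \<in> carrier (Ob (restrict_functor K (dual K M) S) T)"
  then have h: "h \<in> carrier (D (base_alg K S T))" by simp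
  let ?T = "base_alg K S T" let ?T' = "base_alg K S T'"
  have TK: "?T \<in> comm_algebras K" by (rule base_alg_closed[OF S T])
  have TK': "?T' \<in> comm_algebras K" by (rule base_alg_closed[OF S T'])
  have \<alpha>': "\<alpha> \<in> alg_hom K ?T ?T'" by (rule base_alg_hom[OF S \<alpha> T])
  note str = structure_map_base_alg[OF S T] and str' = structure_map_base_alg[OF S T']
  interpret T: algebra S T by (rule comm_algebras_algebra[OF T])
  note self = self_alg_over_base[OF S T]
  note self' = self_alg_over_base[OF S T']
  let ?R = "restrict_scalars ?T \<alpha> (self_alg T')"
  have R: "?R \<in> comm_algebras ?T" "base_alg K ?T ?R = ?T'"
    using restrict_scalars_alg_hom[OF TK TK' \<alpha>' self'(1)] self'(2) by simp_all
  let ?y = "Ar M S ?T (structure_map S T) m"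
  have y: "?y \<in> carrier (Ob M ?T)" by (rule Ar_closed[OF S TK str m])
  have "compose (carrier S) \<alpha> (structure_map S T) = structure_map S T'"
    using lin_smult[OF alg_hom_lin[OF \<alpha>]] alg_hom_one[OF \<alpha>]
    by (auto simp: compose_def structure_map_def fun_eq_iff)
  then have y': "Ar M S ?T' (structure_map S T') m = Ar M ?T ?T' \<alpha> ?y"
    using Ar_comp[OF S TK TK' str \<alpha>' m] by simp
  have \<alpha>'': "\<alpha> \<in> alg_hom ?T (self_alg T) ?R"
    using alg_hom_extensional[OF \<alpha>] lin_closed[OF alg_hom_lin[OF \<alpha>]] lin_add[OF alg_hom_lin[OF \<alpha>]]
      alg_hom_mult[OF \<alpha>] alg_hom_one[OF \<alpha>]
    by (intro alg_homI) simp_all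
  have "h ?R (Ar M ?T ?T' \<alpha> ?y) = \<alpha> (h (self_alg T) ?y)"
    using mor_natural[OF h[unfolded dual_carrier] self(1) R(1) \<alpha>'', of ?y] self(2) R(2) y by simp
  moreover have "Ar (dual K M) ?T ?T' \<alpha> h \<in> carrier (D ?T')"
    by (rule dual_Ar_closed[OF TK TK' \<alpha>' h])
  moreover have "Ar (dual K M) ?T ?T' \<alpha> h (self_alg T') (Ar M ?T ?T' \<alpha> ?y) = h ?R (Ar M ?T ?T' \<alpha> ?y)"
    using self' Ar_closed[OF TK TK' \<alpha>' y] by (simp add: dual_Ar)
  ultimately show "bidual_map K M S m T' (Ar (restrict_functor K (dual K M) S) T T' \<alpha> h)
      = Ar ring_functor T T' \<alpha> (bidual_map K M S m T h)"
    using y' h by (simp add: bidual_map_apply[OF S m T] bidual_map_apply[OF S m T'])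
qed (use S m in \<open>simp_all add: bidual_map_def extensional_def\<close>)

lemma bidual_map_mor: "bidual_map K M \<in> mor K M (dual K (dual K M))"
proof (rule morI)
  fix S assume S: "S \<in> comm_algebras K"
  interpret MS: module S "Ob M S" by (rule Ob_module[OF S])
  have eqI: "bidual_map K M S m = \<Psi>"
    if "m \<in> carrier (Ob M S)" "\<Psi> \<in> extensional (comm_algebras S)"
      "\<And>T. T \<in> comm_algebras S \<Longrightarrow> \<Psi> T \<in> extensional (carrier (D (base_alg K S T)))"
      "\<And>T h. T \<in> comm_algebras S \<Longrightarrow> h \<in> carrier (D (base_alg K S T)) \<Longrightarrow> bidual_map K M S m T h = \<Psi> T h"
    for m \<Psi>
  proof (rule extensionalityI[OF _ that(2)])
    show "bidual_map K M S m \<in> extensional (comm_algebras S)" using S that(1) by (simp add: bidual_map_def)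
    fix T assume T: "T \<in> comm_algebras S"
    show "bidual_map K M S m T = \<Psi> T"
      by (rule extensionalityI[OF _ that(3)[OF T] that(4)[OF T]])
        (use S that(1) T in \<open>simp add: bidual_map_def extensional_def\<close>)
  qed
  show "lin S (Ob M S) (DD S) (bidual_map K M S)"
  proof (rule linI)
    fix m assume m: "m \<in> carrier (Ob M S)"
    show "bidual_map K M S m \<in> carrier (DD S)" by (rule bidual_map_closed[OF S m])
    fix s assume s: "s \<in> carrier S"
    show "bidual_map K M S (s \<odot>\<^bsub>Ob M S\<^esub> m) = s \<odot>\<^bsub>DD S\<^esub> bidual_map K M S m"
    proof (rule eqI)
      fix T h assume T: "T \<in> comm_algebras S" and h: "h \<in> carrier (D (base_alg K S T))"
      let ?T = "base_alg K S T"
      have TK: "?T \<in> comm_algebras K" by (rule base_alg_closed[OF S T])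
      interpret T: algebra S T by (rule comm_algebras_algebra[OF T])
      note str = structure_map_base_alg[OF S T]
      note self = self_alg_over_base[OF S T]
      let ?y = "Ar M S ?T (structure_map S T) m"
      have y: "?y \<in> carrier (Ob M ?T)" by (rule Ar_closed[OF S TK str m])
      note l = mor_lin[OF h[unfolded dual_carrier] self(1), simplified self restrict_functor_simps ring_functor_simps]
      have c: "h (self_alg T) ?y \<in> carrier T" using lin_closed[OF l y] by simp
      have "h (self_alg T) (structure_map S T s \<odot>\<^bsub>Ob M ?T\<^esub> ?y) = structure_map S T s \<otimes>\<^bsub>T\<^esub> h (self_alg T) ?y"
        using lin_smult[OF l, of "structure_map S T s" ?y] s y c by simp
      then show "bidual_map K M S (s \<odot>\<^bsub>Ob M S\<^esub> m) T h = (s \<odot>\<^bsub>DD S\<^esub> bidual_map K M S m) T h"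
        using s m T h c Ar_smult[OF S TK str s m]
        by (simp add: bidual_map_apply[OF S] dual_smult T.smult_assoc2)
    qed (use s m in \<open>simp_all add: dual_smult\<close>)
  next
    fix m m' assume m: "m \<in> carrier (Ob M S)" "m' \<in> carrier (Ob M S)"
    show "bidual_map K M S (m \<oplus>\<^bsub>Ob M S\<^esub> m') = bidual_map K M S m \<oplus>\<^bsub>DD S\<^esub> bidual_map K M S m'"
    proof (rule eqI)
      fix T h assume T: "T \<in> comm_algebras S" and h: "h \<in> carrier (D (base_alg K S T))"
      let ?T = "base_alg K S T"
      have TK: "?T \<in> comm_algebras K" by (rule base_alg_closed[OF S T])
      note str = structure_map_base_alg[OF S T]
      note self = self_alg_over_base[OF S T]
      note l = mor_lin[OF h[unfolded dual_carrier] self(1), simplified self restrict_functor_simps ring_functor_simps]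
      show "bidual_map K M S (m \<oplus>\<^bsub>Ob M S\<^esub> m') T h = (bidual_map K M S m \<oplus>\<^bsub>DD S\<^esub> bidual_map K M S m') T h"
        using m T h Ar_add[OF S TK str m]
          lin_add[OF l Ar_closed[OF S TK str m(1)] Ar_closed[OF S TK str m(2)]]
        by (simp add: bidual_map_apply[OF S] dual_add)
    qed (use m in \<open>simp_all add: dual_add\<close>)
  qed
next
  fix S S' \<alpha> m assume S: "S \<in> comm_algebras K" and S': "S' \<in> comm_algebras K" and \<alpha>: "\<alpha> \<in> alg_hom K S S'"
    and m: "m \<in> carrier (Ob M S)"
  have m': "Ar M S S' \<alpha> m \<in> carrier (Ob M S')" by (rule Ar_closed[OF S S' \<alpha> m])
  show "bidual_map K M S' (Ar M S S' \<alpha> m) = Ar (dual K (dual K M)) S S' \<alpha> (bidual_map K M S m)"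
  proof (rule extensionalityI[of _ "comm_algebras S'"])
    show "bidual_map K M S' (Ar M S S' \<alpha> m) \<in> extensional (comm_algebras S')"
      using S' m' by (simp add: bidual_map_def)
    show "Ar (dual K (dual K M)) S S' \<alpha> (bidual_map K M S m) \<in> extensional (comm_algebras S')"
      by (simp add: dual_Ar)
    fix T assume T: "T \<in> comm_algebras S'"
    interpret T: algebra S' T by (rule comm_algebras_algebra[OF T])
    let ?R = "restrict_scalars S \<alpha> T"
    note R = restrict_scalars_alg_hom[OF S S' \<alpha> T]
    show "bidual_map K M S' (Ar M S S' \<alpha> m) T = Ar (dual K (dual K M)) S S' \<alpha> (bidual_map K M S m) T"
    proof (rule extensionalityI[of _ "carrier (D (base_alg K S' T))"])
      show "bidual_map K M S' (Ar M S S' \<alpha> m) T \<in> extensional (carrier (D (base_alg K S' T)))"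
        using S' m' T by (simp add: bidual_map_def)
      show "Ar (dual K (dual K M)) S S' \<alpha> (bidual_map K M S m) T \<in> extensional (carrier (D (base_alg K S' T)))"
        using T by (simp add: dual_Ar)
      fix h assume h: "h \<in> carrier (D (base_alg K S' T))"
      note T'K = base_alg_closed[OF S' T]
      have "compose (carrier S) (structure_map S' T) \<alpha> = structure_map S ?R"
        by (auto simp: compose_def structure_map_def fun_eq_iff lin_closed[OF alg_hom_lin[OF \<alpha>]])
      then have "Ar M S' (base_alg K S' T) (structure_map S' T) (Ar M S S' \<alpha> m)
          = Ar M S (base_alg K S' T) (structure_map S ?R) m"
        using Ar_comp[OF S S' T'K \<alpha> structure_map_base_alg[OF S' T] m] by simp
      then show "bidual_map K M S' (Ar M S S' \<alpha> m) T h = Ar (dual K (dual K M)) S S' \<alpha> (bidual_map K M S m) T h"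
        using T h R m m' S S'
        by (simp add: dual_Ar bidual_map_apply self_alg_restrict_scalars)
    qed
  qed
qed (simp_all add: bidual_map_def)

end

section \<open>Constructing elements of the bidual\<close>

lemma dual_numbers_snd_lin:
  assumes A: "A \<in> comm_algebras K" and inf: "infinite (UNIV :: 'u set)"
  shows "lin K (base_alg K A (dual_numbers A)) (A :: ('u, 'u) module) (dn_snd A)"
proof -
  interpret A: algebra K A by (rule comm_algebras_algebra[OF A])
  interpret D: square_zero_ext A "self_alg A" by (rule dual_numbers_square_zero[OF A.M_cring inf])
  show ?thesis
    by (rule linI) (auto elim!: D.sq_cases simp: D.sq_add D.sq_smult A.smult_assoc2)
qed

context functor_in_universe
begin

text \<open>
  The vector space underlying \<open>T[\<epsilon>]\<close> is \<open>T \<oplus> T\<close>, so \<open>f + g \<epsilon>\<close> is a morphism into its quasi-coherent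
  module. The coefficient of \<open>\<epsilon>\<close> gives \<open>g\<close>, and multiplication with \<open>\<epsilon>\<close> followed by the coefficient
  of \<open>\<epsilon>\<close> gives \<open>f\<close>.
\<close>

lemma common_source:
  assumes T: "T \<in> comm_algebras K" and f: "f \<in> mor K M (qc T)" and g: "g \<in> mor K M (qc T)"
  obtains W F p q where "module K W" "F \<in> mor K M (qc W)" "lin K W T p" "lin K W T q"
    "push K M W T p F = f" "push K M W T q F = g"
proof -
  interpret T: algebra K T by (rule comm_algebras_algebra[OF T])
  interpret D: square_zero_ext T "self_alg T"
    by (rule dual_numbers_square_zero[OF T.M_cring infinite_universe])
  let ?W = "base_alg K T (dual_numbers T)"
  let ?\<epsilon> = "dn T \<zero>\<^bsub>T\<^esub> \<one>\<^bsub>T\<^esub>"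
  have W: "?W \<in> comm_algebras K" by (rule base_alg_closed[OF T D.square_zero_closed])
  note WM = comm_algebras_module[OF W] and TM = comm_algebras_module[OF T]
  let ?i = "structure_map T (dual_numbers T)"
  have i_apply: "?i t = dn T t \<zero>\<^bsub>T\<^esub>" if "t \<in> carrier T" for t
    using that by (simp add: D.sq_one D.sq_smult)
  have i: "lin K T ?W ?i" by (rule alg_hom_lin[OF structure_map_base_alg[OF T D.square_zero_closed]])
  define m where "m x = ?\<epsilon> \<otimes>\<^bsub>?W\<^esub> x" for x
  have m_apply: "m (dn T a b) = dn T \<zero>\<^bsub>T\<^esub> a" if "a \<in> carrier T" "b \<in> carrier T" for a b
    using that by (simp add: m_def D.sq_mult)
  have e: "lin K ?W ?W m"
    unfolding m_def by (rule algebra_lin_mult[OF comm_algebras_algebra[OF W]]) simp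
  note q = dual_numbers_snd_lin[OF T infinite_universe]
  note p = lin_comp[OF e q] and ei = lin_comp[OF i e]
  let ?F = "mor_add K M (qc ?W) (push K M T ?W ?i f) (push K M T ?W (\<lambda>t. m (?i t)) g)"
  note mf = module_functor_axioms
  have F: "?F \<in> mor K M (qc ?W)"
    by (rule mor_add_mor[OF mf qc_functor[OF WM] push_mor[OF mf TM WM i f] push_mor[OF mf TM WM ei g]])
  have proj: "push K M ?W T r ?F U x =
      left_map K T U T (\<lambda>t. r (?i t)) (f U x) \<oplus>\<^bsub>tensor K T U\<^esub> left_map K T U T (\<lambda>t. r (m (?i t))) (g U x)"
    if r: "lin K ?W T r" and U: "U \<in> comm_algebras K" and x: "x \<in> carrier (Ob M U)" for r U x
  proof -
    note UM = comm_algebras_module[OF U]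
    note fx = qc_mor_closed[OF f U x] and gx = qc_mor_closed[OF g U x]
    show ?thesis
      using U x additive_add[OF left_map_additive[OF WM UM TM r] left_map_closed[OF TM UM WM i fx]
          left_map_closed[OF TM UM WM ei gx]]
      by (simp add: mor_add_def left_map_comp[OF TM UM WM TM i r fx] left_map_comp[OF TM UM WM TM ei r gx])
  qed
  have "push K M ?W T (\<lambda>x. dn_snd T (m x)) ?F = f"
  proof (rule mor_eqI[OF push_mor[OF mf WM TM p F] f])
    fix U x assume U: "U \<in> comm_algebras K" and x: "x \<in> carrier (Ob M U)"
    note UM = comm_algebras_module[OF U]
    note fx = qc_mor_closed[OF f U x] and gx = qc_mor_closed[OF g U x]
    interpret X: module U "tensor K T U" by (rule tensor_module[OF TM comm_algebras_algebra[OF U]])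
    have "left_map K T U T (\<lambda>t. dn_snd T (m (?i t))) (f U x) = f U x"
      using left_map_cong[OF TM UM TM lin_id, of "\<lambda>t. dn_snd T (m (?i t))", OF _ fx]
      by (simp add: i_apply m_apply left_map_id[OF TM UM fx] del: structure_map_apply)
    moreover have "left_map K T U T (\<lambda>t. dn_snd T (m (m (?i t)))) (g U x) = \<zero>\<^bsub>tensor K T U\<^esub>"
      by (rule left_map_zero[OF TM UM TM gx lin_comp[OF ei p]])
        (simp add: i_apply m_apply del: structure_map_apply)
    ultimately show "push K M ?W T (\<lambda>x. dn_snd T (m x)) ?F U x = f U x"
      using fx by (simp add: proj[OF p U x])
  qed
  moreover have "push K M ?W T (dn_snd T) ?F = g"
  proof (rule mor_eqI[OF push_mor[OF mf WM TM q F] g])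
    fix U x assume U: "U \<in> comm_algebras K" and x: "x \<in> carrier (Ob M U)"
    note UM = comm_algebras_module[OF U]
    note fx = qc_mor_closed[OF f U x] and gx = qc_mor_closed[OF g U x]
    interpret X: module U "tensor K T U" by (rule tensor_module[OF TM comm_algebras_algebra[OF U]])
    have "left_map K T U T (\<lambda>t. dn_snd T (m (?i t))) (g U x) = g U x"
      using left_map_cong[OF TM UM TM lin_id, of "\<lambda>t. dn_snd T (m (?i t))", OF _ gx]
      by (simp add: i_apply m_apply left_map_id[OF TM UM gx] del: structure_map_apply)
    moreover have "left_map K T U T (\<lambda>t. dn_snd T (?i t)) (f U x) = \<zero>\<^bsub>tensor K T U\<^esub>"
      by (rule left_map_zero[OF TM UM TM fx lin_comp[OF i q]])
        (simp add: i_apply del: structure_map_apply)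
    ultimately show "push K M ?W T (dn_snd T) ?F U x = g U x"
      using gx by (simp add: proj[OF q U x])
  qed
  ultimately show ?thesis
    using that[OF WM F p q] by blast
qed

lemma push_id:
  assumes V: "module K V" and f: "f \<in> mor K M (qc V)"
  shows "push K M V V (\<lambda>v. v) f = f"
proof (rule mor_eqI[OF push_mor[OF module_functor_axioms V V lin_id f] f])
  fix S x assume "S \<in> comm_algebras K" "x \<in> carrier (Ob M S)"
  then show "push K M V V (\<lambda>v. v) f S x = f S x"
    using left_map_id[OF V comm_algebras_module qc_mor_closed[OF f]] by simp
qed

lemma push_push:
  assumes V: "module K V" and W: "module K W" and X: "module K X"
    and f: "f \<in> mor K M (qc V)" and u: "lin K V W u" and w: "lin K W X w"
  shows "push K M W X w (push K M V W u f) = push K M V X (\<lambda>v. w (u v)) f"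
proof (rule mor_eqI[OF push_mor[OF module_functor_axioms W X w push_mor[OF module_functor_axioms V W u f]]
      push_mor[OF module_functor_axioms V X lin_comp[OF u w] f]])
  fix S x assume "S \<in> comm_algebras K" "x \<in> carrier (Ob M S)"
  then show "push K M W X w (push K M V W u f) S x = push K M V X (\<lambda>v. w (u v)) f S x"
    using left_map_comp[OF V comm_algebras_module W X u w qc_mor_closed[OF f]] by simp
qed

text \<open>
  The value of \<open>\<Phi>\<close> on the functional of a morphism \<open>f : M \<rightarrow> T\<close> has to be the image of \<open>y\<^sub>f \<in> T \<otimes> S\<close>
  in \<open>T\<close>. Naturality of the family in \<open>V\<close> turns this into a formula for all functionals; naturality
  of \<open>\<Phi>\<close> in \<open>T\<close>, its compatibility with scalars and even its additivity are instances of it.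
\<close>

theorem bidual_element_from_family:
  assumes S: "S \<in> comm_algebras K"
    and y_closed: "\<And>V f. module K V \<Longrightarrow> f \<in> mor K M (qc V) \<Longrightarrow> y V f \<in> carrier (tensor K V S)"
    and y_natural: "\<And>V W u f. module K V \<Longrightarrow> module K W \<Longrightarrow> lin K V W u \<Longrightarrow> f \<in> mor K M (qc V) \<Longrightarrow>
      y W (push K M V W u f) = left_map K V S W u (y V f)"
  obtains \<Phi> where "\<Phi> \<in> carrier (DD S)"
    and "\<And>V f. module K V \<Longrightarrow> f \<in> mor K M (qc V) \<Longrightarrow> represents S \<Phi> V f (y V f)"
proof -
  note SM = comm_algebras_module[OF S]
  define F where "F T h = (SOME f. f \<in> mor K M (qc T) \<and> h = functional K M T T f (\<lambda>t. t))" for T h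
  have F: "F T h \<in> mor K M (qc T)" "h = functional K M T T (F T h) (\<lambda>t. t)"
    if "T \<in> comm_algebras K" "h \<in> carrier (D T)" for T h
  proof -
    have "\<exists>f. f \<in> mor K M (qc T) \<and> h = functional K M T T f (\<lambda>t. t)"
      using dual_element_is_functional[OF that] by metis
    from someI_ex[OF this] show "F T h \<in> mor K M (qc T)" "h = functional K M T T (F T h) (\<lambda>t. t)"
      by (simp_all add: F_def)
  qed
  define \<Phi> where "\<Phi> = (\<lambda>T \<in> comm_algebras S. \<lambda>h \<in> carrier (D (base_alg K S T)).
    contr K (base_alg K S T) (base_alg K S T) (\<lambda>t. t) (tensor_map K (base_alg K S T) (base_alg K S T)
      (structure_map S T) (y (base_alg K S T) (F (base_alg K S T) h))))"
  have formula: "\<Phi> T (functional K M V (base_alg K S T) f j)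
      = contr K V (base_alg K S T) j (tensor_map K V (base_alg K S T) (structure_map S T) (y V f))"
    if V: "module K V" and f: "f \<in> mor K M (qc V)" and T: "T \<in> comm_algebras S"
      and j: "lin K V (base_alg K S T) j" for V f T j
  proof -
    let ?T = "base_alg K S T"
    have TK: "?T \<in> comm_algebras K" by (rule base_alg_closed[OF S T])
    note TM = comm_algebras_module[OF TK]
    note str = alg_hom_lin[OF structure_map_base_alg[OF S T]]
    let ?h = "functional K M V ?T f j"
    have h: "?h \<in> carrier (D ?T)" by (rule functional_closed[OF V TK f j])
    note Fh = F[OF TK h]
    have "push K M ?T ?T (\<lambda>t. t) (F ?T ?h) = push K M V ?T j f"
      by (rule functional_determines[OF TM V TK Fh(1) lin_id f j Fh(2)[symmetric]])
    then have "F ?T ?h = push K M V ?T j f" by (simp add: push_id[OF TM Fh(1)])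
    then have "y ?T (F ?T ?h) = left_map K V S ?T j (y V f)"
      by (simp add: y_natural[OF V TM j f])
    then have "\<Phi> T ?h = contr K ?T ?T (\<lambda>t. t) (tensor_map K ?T ?T (structure_map S T) (left_map K V S ?T j (y V f)))"
      using T h by (simp add: \<Phi>_def)
    then show ?thesis
      using contr_left_map[OF V TM TK j lin_id tensor_map_closed[OF V SM TM str y_closed[OF V f]]]
      by (simp add: left_map_tensor_map[OF V SM TM TM j str y_closed[OF V f]])
  qed
  have "\<Phi> \<in> mor S (restrict_functor K (dual K M) S) ring_functor"
  proof (rule morI)
    fix T assume T: "T \<in> comm_algebras S"
    let ?T = "base_alg K S T"
    have TK: "?T \<in> comm_algebras K" by (rule base_alg_closed[OF S T])
    note TM = comm_algebras_module[OF TK] and TA = comm_algebras_algebra[OF TK]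
    note str = alg_hom_lin[OF structure_map_base_alg[OF S T]]
    interpret T: algebra S T by (rule comm_algebras_algebra[OF T])
    interpret TK: algebra K ?T by (rule TA)
    have yc: "tensor_map K V ?T (structure_map S T) (y V f) \<in> carrier (tensor K V ?T)"
      if "module K V" "f \<in> mor K M (qc V)" for V f
      by (rule tensor_map_closed[OF that(1) SM TM str y_closed[OF that]])
    show "lin T (Ob (restrict_functor K (dual K M) S) T) (Ob ring_functor T) (\<Phi> T)"
    proof (rule linI; unfold restrict_functor_simps ring_functor_simps self_alg_simps)
      fix h assume h: "h \<in> carrier (D ?T)"
      note f = F[OF TK h]
      have c: "contr K ?T ?T (\<lambda>t. t) (tensor_map K ?T ?T (structure_map S T) (y ?T (F ?T h))) \<in> carrier T"
        using contr_closed[OF TM TK lin_id yc[OF TM f(1)]] by simp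
      have \<Phi>h: "\<Phi> T h = contr K ?T ?T (\<lambda>t. t) (tensor_map K ?T ?T (structure_map S T) (y ?T (F ?T h)))"
        using formula[OF TM f(1) T lin_id] f(2) by simp
      then show \<Phi>c: "\<Phi> T h \<in> carrier T" using c by simp
      fix t assume t: "t \<in> carrier T"
      then have t': "t \<in> carrier ?T" by simp
      note lt = algebra_lin_mult[OF TA t']
      interpret tp: tensor_pair K ?T ?T by (intro tensor_pair.intro TM)
      have add: "additive ?T ?T (\<lambda>x. t \<otimes>\<^bsub>?T\<^esub> x)" by (rule lin_additive[OF lt])
      have "contr K ?T ?T (\<lambda>v. t \<otimes>\<^bsub>?T\<^esub> v) z = t \<otimes>\<^bsub>?T\<^esub> contr K ?T ?T (\<lambda>v. v) z"
        if "z \<in> carrier (tensor K ?T ?T)" for z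
        by (rule tp.additive_tensor_eqI[OF contr_additive[OF TM TK lt]
              additive_comp[OF contr_additive[OF TM TK lin_id] add] _ that])
          (use t' in \<open>simp add: contr_pure[OF TM TK lt] contr_pure[OF TM TK lin_id] TK.m_assoc
            del: base_alg_simps\<close>)
      then have "\<Phi> T (t \<odot>\<^bsub>D ?T\<^esub> h) = t \<otimes>\<^bsub>T\<^esub> \<Phi> T h"
        using formula[OF TM f(1) T lt] functional_smult[OF TM TK f(1) lin_id t'] f(2) yc[OF TM f(1)] \<Phi>h
        by simp
      then show "\<Phi> T (t \<odot>\<^bsub>D ?T\<^esub> h) = t \<odot>\<^bsub>self_alg T\<^esub> \<Phi> T h"
        using t \<Phi>c by simp
    next
      fix h h' assume h: "h \<in> carrier (D ?T)" "h' \<in> carrier (D ?T)"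
      note f = F[OF TK h(1)] and g = F[OF TK h(2)]
      \<comment> \<open>additivity is naturality along the two projections of a common source and their sum\<close>
      obtain W G p q where W: "module K W" and G: "G \<in> mor K M (qc W)" and p: "lin K W ?T p"
        and q: "lin K W ?T q" and pG: "push K M W ?T p G = F ?T h" and qG: "push K M W ?T q G = F ?T h'"
        using common_source[OF TK f(1) g(1)] by metis
      have hG: "h = functional K M W ?T G p" "h' = functional K M W ?T G q"
        using functional_push[OF W TM TK G p lin_id] functional_push[OF W TM TK G q lin_id] f(2) g(2)
        by (simp_all add: pG qG)
      note pq = lin_plus[OF p q W TM]
      have "h \<oplus>\<^bsub>D ?T\<^esub> h' = functional K M W ?T G (\<lambda>v. p v \<oplus>\<^bsub>?T\<^esub> q v)"
        unfolding hG by (rule functional_add[OF W TK G p q, symmetric])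
      then show "\<Phi> T (h \<oplus>\<^bsub>D ?T\<^esub> h') = \<Phi> T h \<oplus>\<^bsub>T\<^esub> \<Phi> T h'"
        using formula[OF W G T pq] formula[OF W G T p] formula[OF W G T q] hG
          contr_plus[OF W TK p q yc[OF W G]] by simp
    qed
  next
    fix T T' \<alpha> h assume T: "T \<in> comm_algebras S" and T': "T' \<in> comm_algebras S" and \<alpha>: "\<alpha> \<in> alg_hom S T T'"
      and "h \<in> carrier (Ob (restrict_functor K (dual K M) S) T)"
    then have h: "h \<in> carrier (D (base_alg K S T))" by simp
    let ?T = "base_alg K S T" let ?T' = "base_alg K S T'"
    have TK: "?T \<in> comm_algebras K" by (rule base_alg_closed[OF S T])
    have TK': "?T' \<in> comm_algebras K" by (rule base_alg_closed[OF S T'])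
    note TM = comm_algebras_module[OF TK] and TM' = comm_algebras_module[OF TK']
    have \<alpha>': "\<alpha> \<in> alg_hom K ?T ?T'" by (rule base_alg_hom[OF S \<alpha> T])
    note str = alg_hom_lin[OF structure_map_base_alg[OF S T]]
    note str' = alg_hom_lin[OF structure_map_base_alg[OF S T']]
    interpret T: algebra S T by (rule comm_algebras_algebra[OF T])
    note f = F[OF TK h]
    note fy = y_closed[OF TM f(1)]
    have "tensor_map K ?T ?T' (structure_map S T') (y ?T (F ?T h))
        = tensor_map K ?T ?T' (\<lambda>s. \<alpha> (structure_map S T s)) (y ?T (F ?T h))"
      using lin_smult[OF alg_hom_lin[OF \<alpha>]] alg_hom_one[OF \<alpha>]
      by (intro tensor_map_cong[OF TM SM TM' lin_comp[OF str alg_hom_lin[OF \<alpha>']] _ fy]) simp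
    also have "\<dots> = tensor_map K ?T ?T' \<alpha> (tensor_map K ?T ?T (structure_map S T) (y ?T (F ?T h)))"
      by (rule tensor_map_comp[OF TM SM TM TM' str alg_hom_lin[OF \<alpha>'] fy, symmetric])
    finally have "contr K ?T ?T' \<alpha> (tensor_map K ?T ?T' (structure_map S T') (y ?T (F ?T h)))
        = \<alpha> (contr K ?T ?T (\<lambda>t. t) (tensor_map K ?T ?T (structure_map S T) (y ?T (F ?T h))))"
      using contr_natural[OF TM TK TK' lin_id \<alpha>' tensor_map_closed[OF TM SM TM str fy]] by simp
    then have "\<Phi> T' (Ar (dual K M) ?T ?T' \<alpha> h) = \<alpha> (\<Phi> T h)"
      using formula[OF TM f(1) T' alg_hom_lin[OF \<alpha>']] formula[OF TM f(1) T lin_id]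
        functional_Ar[OF TM TK TK' f(1) lin_id \<alpha>'] f(2) by simp
    then show "\<Phi> T' (Ar (restrict_functor K (dual K M) S) T T' \<alpha> h) = Ar ring_functor T T' \<alpha> (\<Phi> T h)"
      by simp
  qed (simp_all add: \<Phi>_def extensional_def)
  then have "\<Phi> \<in> carrier (DD S)" by (simp add: dual_carrier)
  moreover have "represents S \<Phi> V f (y V f)" if "module K V" "f \<in> mor K M (qc V)" for V f
    unfolding represents_def using formula[OF that] by blast
  ultimately show ?thesis by (rule that)
qed

end

section \<open>Linear algebra over a field\<close>

definition adjoin :: "('a, 'r) ring_scheme \<Rightarrow> ('a, 'b) module \<Rightarrow> 'b set \<Rightarrow> 'b \<Rightarrow> 'b set" where
  "adjoin K V C s = {c \<oplus>\<^bsub>V\<^esub> k \<odot>\<^bsub>V\<^esub> s | c k. c \<in> C \<and> k \<in> carrier K}"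

locale vector_space_over = K: field K + V: module K V
  for K :: "('u, 'r) ring_scheme" and V :: "('u, 'v) module"
begin

lemma submodule_facts:
  assumes "submodule C K V"
  shows "C \<subseteq> carrier V" "\<zero>\<^bsub>V\<^esub> \<in> C" "\<And>x y. x \<in> C \<Longrightarrow> y \<in> C \<Longrightarrow> x \<oplus>\<^bsub>V\<^esub> y \<in> C"
    "\<And>x. x \<in> C \<Longrightarrow> \<ominus>\<^bsub>V\<^esub> x \<in> C" "\<And>a x. a \<in> carrier K \<Longrightarrow> x \<in> C \<Longrightarrow> a \<odot>\<^bsub>V\<^esub> x \<in> C"
proof -
  note E = V.submoduleE[OF assms]
  show "C \<subseteq> carrier V" "\<And>x y. x \<in> C \<Longrightarrow> y \<in> C \<Longrightarrow> x \<oplus>\<^bsub>V\<^esub> y \<in> C"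
    "\<And>x. x \<in> C \<Longrightarrow> \<ominus>\<^bsub>V\<^esub> x \<in> C" "\<And>a x. a \<in> carrier K \<Longrightarrow> x \<in> C \<Longrightarrow> a \<odot>\<^bsub>V\<^esub> x \<in> C"
    using E by auto
  obtain c where "c \<in> C" using E(2) by blast
  then show "\<zero>\<^bsub>V\<^esub> \<in> C" using E(4)[OF K.zero_closed, of c] E(1) by auto
qed

lemma adjoin_submodule:
  assumes C: "submodule C K V" and s: "s \<in> carrier V"
  shows "submodule (adjoin K V C s) K V" "C \<subseteq> adjoin K V C s" "s \<in> adjoin K V C s"
proof -
  note F = submodule_facts[OF C]
  have cV: "c \<in> carrier V" if "c \<in> C" for c using F(1) that by blast
  show sub: "C \<subseteq> adjoin K V C s"
  proof
    fix c assume c: "c \<in> C"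
    then have "c = c \<oplus>\<^bsub>V\<^esub> \<zero>\<^bsub>K\<^esub> \<odot>\<^bsub>V\<^esub> s" using s cV by simp
    then show "c \<in> adjoin K V C s" using c unfolding adjoin_def by blast
  qed
  have "s = \<zero>\<^bsub>V\<^esub> \<oplus>\<^bsub>V\<^esub> \<one>\<^bsub>K\<^esub> \<odot>\<^bsub>V\<^esub> s" using s by simp
  then show "s \<in> adjoin K V C s" unfolding adjoin_def using F(2) by blast
  show "submodule (adjoin K V C s) K V"
  proof (rule V.submoduleI)
    show "adjoin K V C s \<subseteq> carrier V" using s cV by (auto simp: adjoin_def)
    show "\<zero>\<^bsub>V\<^esub> \<in> adjoin K V C s" using sub F(2) by blast
  next
    fix x assume "x \<in> adjoin K V C s"
    then obtain c k where x: "x = c \<oplus>\<^bsub>V\<^esub> k \<odot>\<^bsub>V\<^esub> s" "c \<in> C" "k \<in> carrier K" by (auto simp: adjoin_def)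
    have "\<ominus>\<^bsub>V\<^esub> x = (\<ominus>\<^bsub>V\<^esub> c) \<oplus>\<^bsub>V\<^esub> (\<ominus>\<^bsub>K\<^esub> k) \<odot>\<^bsub>V\<^esub> s"
      using x s cV by (simp add: V.M.minus_add V.smult_l_minus)
    then show "\<ominus>\<^bsub>V\<^esub> x \<in> adjoin K V C s" unfolding adjoin_def using F(4)[OF x(2)] x(3) by blast
    fix a assume a: "a \<in> carrier K"
    have "a \<odot>\<^bsub>V\<^esub> x = a \<odot>\<^bsub>V\<^esub> c \<oplus>\<^bsub>V\<^esub> (a \<otimes>\<^bsub>K\<^esub> k) \<odot>\<^bsub>V\<^esub> s"
      using x s cV a by (simp add: V.smult_r_distr V.smult_assoc1)
    then show "a \<odot>\<^bsub>V\<^esub> x \<in> adjoin K V C s" unfolding adjoin_def using F(5)[OF a x(2)] x(3) a by blast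
  next
    fix x y assume "x \<in> adjoin K V C s" "y \<in> adjoin K V C s"
    then obtain c k d l where x: "x = c \<oplus>\<^bsub>V\<^esub> k \<odot>\<^bsub>V\<^esub> s" "c \<in> C" "k \<in> carrier K"
      and y: "y = d \<oplus>\<^bsub>V\<^esub> l \<odot>\<^bsub>V\<^esub> s" "d \<in> C" "l \<in> carrier K" by (auto simp: adjoin_def)
    have "x \<oplus>\<^bsub>V\<^esub> y = (c \<oplus>\<^bsub>V\<^esub> d) \<oplus>\<^bsub>V\<^esub> (k \<oplus>\<^bsub>K\<^esub> l) \<odot>\<^bsub>V\<^esub> s"
      using x y s cV by (simp add: V.smult_l_distr V.M.a_ac)
    then show "x \<oplus>\<^bsub>V\<^esub> y \<in> adjoin K V C s" unfolding adjoin_def using F(3)[OF x(2) y(2)] x(3) y(3) by blast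
  qed
qed

text \<open>
  A maximal subspace that contains \<open>W\<close> and meets \<open>A\<close> trivially is a complement of \<open>A\<close>.
\<close>

lemma complement_exists:
  assumes A: "submodule A K V" and W: "submodule W K V" and AW: "A \<inter> W = {\<zero>\<^bsub>V\<^esub>}"
  obtains C where "submodule C K V" "W \<subseteq> C" "A \<inter> C = {\<zero>\<^bsub>V\<^esub>}"
    "\<And>v. v \<in> carrier V \<Longrightarrow> \<exists>a \<in> A. \<exists>c \<in> C. v = a \<oplus>\<^bsub>V\<^esub> c"
proof -
  let ?X = "{C. submodule C K V \<and> W \<subseteq> C \<and> A \<inter> C = {\<zero>\<^bsub>V\<^esub>}}"
  note FA = submodule_facts[OF A]
  have "\<exists>C\<in>?X. \<forall>X\<in>?X. C \<subseteq> X \<longrightarrow> X = C"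
  proof (rule subset_Zorn_nonempty)
    show "?X \<noteq> {}" using W AW by blast
    fix \<C> assume ne: "\<C> \<noteq> {}" and ch: "subset.chain ?X \<C>"
    have sub: "submodule C K V" "W \<subseteq> C" "A \<inter> C = {\<zero>\<^bsub>V\<^esub>}" if "C \<in> \<C>" for C
      using ch that by (auto simp: subset.chain_def)
    have tot: "C \<subseteq> E \<or> E \<subseteq> C" if "C \<in> \<C>" "E \<in> \<C>" for C E
      using ch that by (auto simp: subset_chain_def)
    obtain C0 where C0: "C0 \<in> \<C>" using ne by blast
    have "submodule (\<Union>\<C>) K V"
    proof (rule V.submoduleI)
      show "\<Union>\<C> \<subseteq> carrier V" using submodule_facts(1)[OF sub(1)] by blast
      show "\<zero>\<^bsub>V\<^esub> \<in> \<Union>\<C>" using submodule_facts(2)[OF sub(1)[OF C0]] C0 by blast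
    next
      fix x assume "x \<in> \<Union>\<C>"
      then obtain C where C: "C \<in> \<C>" "x \<in> C" by blast
      then show "\<ominus>\<^bsub>V\<^esub> x \<in> \<Union>\<C>" using submodule_facts(4)[OF sub(1)[OF C(1)] C(2)] by blast
      fix a assume "a \<in> carrier K"
      then show "a \<odot>\<^bsub>V\<^esub> x \<in> \<Union>\<C>" using submodule_facts(5)[OF sub(1)[OF C(1)] _ C(2)] C(1) by blast
    next
      fix x y assume "x \<in> \<Union>\<C>" "y \<in> \<Union>\<C>"
      then obtain C E where C: "C \<in> \<C>" "x \<in> C" "E \<in> \<C>" "y \<in> E" by blast
      then obtain G where "G \<in> \<C>" "x \<in> G" "y \<in> G" using tot[OF C(1,3)] by blast
      then show "x \<oplus>\<^bsub>V\<^esub> y \<in> \<Union>\<C>" using submodule_facts(3)[OF sub(1)] by blast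
    qed
    moreover have "W \<subseteq> \<Union>\<C>" using sub(2)[OF C0] C0 by blast
    moreover have "A \<inter> \<Union>\<C> = {\<zero>\<^bsub>V\<^esub>}" using sub(3) C0 by blast
    ultimately show "\<Union>\<C> \<in> ?X" by blast
  qed
  then obtain C where CX: "C \<in> ?X" and maxC: "\<forall>X\<in>?X. C \<subseteq> X \<longrightarrow> X = C" ..
  from CX have C: "submodule C K V" "W \<subseteq> C" "A \<inter> C = {\<zero>\<^bsub>V\<^esub>}" by simp_all
  have max: "X = C" if "submodule X K V" "W \<subseteq> X" "A \<inter> X = {\<zero>\<^bsub>V\<^esub>}" "C \<subseteq> X" for X
    using maxC that by simp
  note FC = submodule_facts[OF C(1)]
  have "\<exists>a \<in> A. \<exists>c \<in> C. v = a \<oplus>\<^bsub>V\<^esub> c" if v: "v \<in> carrier V" for v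
  proof (cases "v \<in> C")
    case True
    then show ?thesis using FA(2) v by (intro bexI[of _ "\<zero>\<^bsub>V\<^esub>"] bexI[of _ v]) simp_all
  next
    case False
    note ad = adjoin_submodule[OF C(1) v]
    have "A \<inter> adjoin K V C v \<noteq> {\<zero>\<^bsub>V\<^esub>}"
      using max[OF ad(1)] ad(2,3) C(2) False by blast
    then obtain x where x: "x \<in> A" "x \<in> adjoin K V C v" "x \<noteq> \<zero>\<^bsub>V\<^esub>"
      using FA(2) submodule_facts(2)[OF ad(1)] by blast
    then obtain c k where ck: "x = c \<oplus>\<^bsub>V\<^esub> k \<odot>\<^bsub>V\<^esub> v" "c \<in> C" "k \<in> carrier K" by (auto simp: adjoin_def)
    have cV: "c \<in> carrier V" using ck FC(1) by blast
    have "k \<noteq> \<zero>\<^bsub>K\<^esub>"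
    proof
      assume "k = \<zero>\<^bsub>K\<^esub>"
      then have "x = c" using ck v cV by simp
      then show False using x ck C(3) by blast
    qed
    then have inv: "inv\<^bsub>K\<^esub> k \<in> carrier K" "inv\<^bsub>K\<^esub> k \<otimes>\<^bsub>K\<^esub> k = \<one>\<^bsub>K\<^esub>"
      using ck(3) K.field_Units by simp_all
    have xV: "x \<in> carrier V" using x FA(1) by blast
    have "k \<odot>\<^bsub>V\<^esub> v = x \<oplus>\<^bsub>V\<^esub> \<ominus>\<^bsub>V\<^esub> c"
      using ck v cV by (simp add: V.M.a_ac V.M.r_neg1 V.M.r_neg2 V.M.r_neg)
    then have "inv\<^bsub>K\<^esub> k \<odot>\<^bsub>V\<^esub> (k \<odot>\<^bsub>V\<^esub> v) = inv\<^bsub>K\<^esub> k \<odot>\<^bsub>V\<^esub> x \<oplus>\<^bsub>V\<^esub> inv\<^bsub>K\<^esub> k \<odot>\<^bsub>V\<^esub> (\<ominus>\<^bsub>V\<^esub> c)"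
      using inv xV cV by (simp add: V.smult_r_distr)
    then have "v = inv\<^bsub>K\<^esub> k \<odot>\<^bsub>V\<^esub> x \<oplus>\<^bsub>V\<^esub> inv\<^bsub>K\<^esub> k \<odot>\<^bsub>V\<^esub> (\<ominus>\<^bsub>V\<^esub> c)"
      using inv v ck(3) by (simp flip: V.smult_assoc1)
    then show ?thesis
      using FA(5)[OF inv(1) x(1)] FC(5)[OF inv(1) FC(4)[OF ck(2)]] by blast
  qed
  with C show ?thesis by (rule that)
qed

lemma projection_exists:
  assumes A: "submodule A K V" and W: "submodule W K V" and AW: "A \<inter> W = {\<zero>\<^bsub>V\<^esub>}"
  obtains p where "lin K V V p" "\<And>v. v \<in> carrier V \<Longrightarrow> p v \<in> A" "\<And>a. a \<in> A \<Longrightarrow> p a = a"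
    "\<And>w. w \<in> W \<Longrightarrow> p w = \<zero>\<^bsub>V\<^esub>"
proof -
  obtain C where C: "submodule C K V" "W \<subseteq> C" "A \<inter> C = {\<zero>\<^bsub>V\<^esub>}"
    and dec: "\<And>v. v \<in> carrier V \<Longrightarrow> \<exists>a \<in> A. \<exists>c \<in> C. v = a \<oplus>\<^bsub>V\<^esub> c"
    using complement_exists[OF assms] by blast
  note FA = submodule_facts[OF A] and FC = submodule_facts[OF C(1)]
  have AV: "a \<in> carrier V" if "a \<in> A" for a using FA(1) that by blast
  have CV: "c \<in> carrier V" if "c \<in> C" for c using FC(1) that by blast
  define p where "p v = (THE a. a \<in> A \<and> (\<exists>c \<in> C. v = a \<oplus>\<^bsub>V\<^esub> c))" for v
  have p: "p (a \<oplus>\<^bsub>V\<^esub> c) = a" if a: "a \<in> A" and c: "c \<in> C" for a c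
    unfolding p_def
  proof (rule the_equality)
    show "a \<in> A \<and> (\<exists>c' \<in> C. a \<oplus>\<^bsub>V\<^esub> c = a \<oplus>\<^bsub>V\<^esub> c')" using that by blast
    fix a' assume "a' \<in> A \<and> (\<exists>c' \<in> C. a \<oplus>\<^bsub>V\<^esub> c = a' \<oplus>\<^bsub>V\<^esub> c')"
    then obtain c' where a': "a' \<in> A" and c': "c' \<in> C" and eq: "a \<oplus>\<^bsub>V\<^esub> c = a' \<oplus>\<^bsub>V\<^esub> c'" by blast
    note car = AV[OF a] AV[OF a'] CV[OF c] CV[OF c']
    have "a' \<oplus>\<^bsub>V\<^esub> \<ominus>\<^bsub>V\<^esub> a = (a' \<oplus>\<^bsub>V\<^esub> c') \<oplus>\<^bsub>V\<^esub> (\<ominus>\<^bsub>V\<^esub> c' \<oplus>\<^bsub>V\<^esub> \<ominus>\<^bsub>V\<^esub> a)"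
      using car by (simp add: V.M.a_assoc V.M.r_neg2)
    also have "\<dots> = c \<oplus>\<^bsub>V\<^esub> \<ominus>\<^bsub>V\<^esub> c'"
    proof -
      have "(a \<oplus>\<^bsub>V\<^esub> c) \<oplus>\<^bsub>V\<^esub> (\<ominus>\<^bsub>V\<^esub> c' \<oplus>\<^bsub>V\<^esub> \<ominus>\<^bsub>V\<^esub> a) = (a \<oplus>\<^bsub>V\<^esub> \<ominus>\<^bsub>V\<^esub> a) \<oplus>\<^bsub>V\<^esub> (c \<oplus>\<^bsub>V\<^esub> \<ominus>\<^bsub>V\<^esub> c')"
        using car by (simp add: V.M.a_ac)
      then show ?thesis using car by (simp add: V.M.r_neg flip: eq)
    qed
    finally have "a' \<oplus>\<^bsub>V\<^esub> \<ominus>\<^bsub>V\<^esub> a \<in> A \<inter> C"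
      using FA(3)[OF a' FA(4)[OF a]] FC(3)[OF c FC(4)[OF c']] by simp
    then have "a' \<oplus>\<^bsub>V\<^esub> \<ominus>\<^bsub>V\<^esub> a = \<zero>\<^bsub>V\<^esub>" using C(3) by blast
    then show "a' = a" using car V.M.minus_equality[of a' "\<ominus>\<^bsub>V\<^esub> a"] by simp
  qed
  have "lin K V V p"
  proof (rule linI)
    fix x assume x: "x \<in> carrier V"
    then obtain a c where ac: "a \<in> A" "c \<in> C" "x = a \<oplus>\<^bsub>V\<^esub> c" using dec by blast
    then show "p x \<in> carrier V" using p AV by simp
    fix k assume k: "k \<in> carrier K"
    have "k \<odot>\<^bsub>V\<^esub> x = k \<odot>\<^bsub>V\<^esub> a \<oplus>\<^bsub>V\<^esub> k \<odot>\<^bsub>V\<^esub> c" using ac k AV CV by (simp add: V.smult_r_distr)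
    then show "p (k \<odot>\<^bsub>V\<^esub> x) = k \<odot>\<^bsub>V\<^esub> p x" using ac p FA(5)[OF k] FC(5)[OF k] by simp
  next
    fix x y assume "x \<in> carrier V" "y \<in> carrier V"
    then obtain a c b d where ac: "a \<in> A" "c \<in> C" "x = a \<oplus>\<^bsub>V\<^esub> c" and bd: "b \<in> A" "d \<in> C" "y = b \<oplus>\<^bsub>V\<^esub> d"
      using dec by metis
    have "x \<oplus>\<^bsub>V\<^esub> y = (a \<oplus>\<^bsub>V\<^esub> b) \<oplus>\<^bsub>V\<^esub> (c \<oplus>\<^bsub>V\<^esub> d)" using ac bd AV CV by (simp add: V.M.a_ac)
    then show "p (x \<oplus>\<^bsub>V\<^esub> y) = p x \<oplus>\<^bsub>V\<^esub> p y"
      using ac bd p FA(3)[OF ac(1) bd(1)] FC(3)[OF ac(2) bd(2)] by simp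
  qed
  moreover have "p v \<in> A" if "v \<in> carrier V" for v using dec[OF that] p by auto
  moreover have "p a = a" if "a \<in> A" for a using p[OF that FC(2)] AV[OF that] by simp
  moreover have "p w = \<zero>\<^bsub>V\<^esub>" if "w \<in> W" for w
    using p[OF FA(2), of w] that C(2) CV by auto
  ultimately show ?thesis by (rule that)
qed

text \<open>
  The projection onto the line through \<open>s\<close> along a complement containing \<open>W\<close>, read as a multiple of
  \<open>s\<close>.
\<close>

lemma functional_exists:
  assumes W: "submodule W K V" and s: "s \<in> carrier V" "s \<notin> W"
  obtains \<xi> where "lin K V (scalar_alg K) \<xi>" "\<And>w. w \<in> W \<Longrightarrow> \<xi> w = \<zero>\<^bsub>K\<^esub>" "\<xi> s = \<one>\<^bsub>K\<^esub>"
proof -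
  note FW = submodule_facts[OF W]
  have s0: "s \<noteq> \<zero>\<^bsub>V\<^esub>" using s FW(2) by blast
  have zero_sub: "submodule {\<zero>\<^bsub>V\<^esub>} K V" by (rule V.submoduleI) simp_all
  let ?A = "adjoin K V {\<zero>\<^bsub>V\<^esub>} s"
  have A_eq: "?A = {k \<odot>\<^bsub>V\<^esub> s | k. k \<in> carrier K}" 
    using s by (auto simp: adjoin_def) (metis V.M.l_zero V.smult_closed)
  note A = adjoin_submodule[OF zero_sub s(1)]
  have scal0: "k = \<zero>\<^bsub>K\<^esub>" if "k \<in> carrier K" "k \<odot>\<^bsub>V\<^esub> s \<in> W" for k
  proof (rule ccontr)
    assume "k \<noteq> \<zero>\<^bsub>K\<^esub>"
    then have inv: "inv\<^bsub>K\<^esub> k \<in> carrier K" "inv\<^bsub>K\<^esub> k \<otimes>\<^bsub>K\<^esub> k = \<one>\<^bsub>K\<^esub>"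
      using that(1) K.field_Units by simp_all
    have "inv\<^bsub>K\<^esub> k \<odot>\<^bsub>V\<^esub> (k \<odot>\<^bsub>V\<^esub> s) = s" using inv that(1) s by (simp flip: V.smult_assoc1)
    then show False using FW(5)[OF inv(1) that(2)] s(2) by simp
  qed
  have "?A \<inter> W = {\<zero>\<^bsub>V\<^esub>}"
  proof (intro equalityI subsetI)
    fix x assume "x \<in> ?A \<inter> W"
    then obtain k where "k \<in> carrier K" "x = k \<odot>\<^bsub>V\<^esub> s" "x \<in> W" unfolding A_eq by blast
    then show "x \<in> {\<zero>\<^bsub>V\<^esub>}" using scal0[of k] s(1) by simp
  qed (use FW(2) submodule_facts(2)[OF A(1)] in simp)
  then obtain p where p: "lin K V V p" "\<And>v. v \<in> carrier V \<Longrightarrow> p v \<in> ?A" "\<And>a. a \<in> ?A \<Longrightarrow> p a = a"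
    "\<And>w. w \<in> W \<Longrightarrow> p w = \<zero>\<^bsub>V\<^esub>"
    using projection_exists[OF A(1) W] by blast
  define \<xi> where "\<xi> v = (THE k. k \<in> carrier K \<and> k \<odot>\<^bsub>V\<^esub> s = p v)" for v
  have \<xi>I: "\<xi> v = k" if k: "k \<in> carrier K" "k \<odot>\<^bsub>V\<^esub> s = p v" for v k
    unfolding \<xi>_def
  proof (rule the_equality)
    show "k \<in> carrier K \<and> k \<odot>\<^bsub>V\<^esub> s = p v" using that by blast
    fix l assume l: "l \<in> carrier K \<and> l \<odot>\<^bsub>V\<^esub> s = p v"
    have "(l \<oplus>\<^bsub>K\<^esub> \<ominus>\<^bsub>K\<^esub> k) \<odot>\<^bsub>V\<^esub> s = \<zero>\<^bsub>V\<^esub>"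
      using l k s V.smult_closed[OF k(1) s(1)]
      by (simp add: V.smult_l_distr V.smult_l_minus V.M.r_neg)
    then have "l \<oplus>\<^bsub>K\<^esub> \<ominus>\<^bsub>K\<^esub> k = \<zero>\<^bsub>K\<^esub>" using scal0[of "l \<oplus>\<^bsub>K\<^esub> \<ominus>\<^bsub>K\<^esub> k"] FW(2) l k by simp
    then show "l = k" using l k K.minus_equality[of l "\<ominus>\<^bsub>K\<^esub> k"] by simp
  qed
  have \<xi>: "\<xi> v \<in> carrier K" "\<xi> v \<odot>\<^bsub>V\<^esub> s = p v" if v: "v \<in> carrier V" for v
  proof -
    obtain k where "k \<in> carrier K" "k \<odot>\<^bsub>V\<^esub> s = p v" using p(2)[OF v] unfolding A_eq by auto
    then show "\<xi> v \<in> carrier K" "\<xi> v \<odot>\<^bsub>V\<^esub> s = p v" using \<xi>I by auto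
  qed
  have "lin K V (scalar_alg K) \<xi>"
    by (rule linI) (use s \<xi> in \<open>auto intro!: \<xi>I simp: lin_add[OF p(1)] lin_smult[OF p(1)]
        V.smult_l_distr V.smult_assoc1\<close>)
  moreover have "\<xi> w = \<zero>\<^bsub>K\<^esub>" if "w \<in> W" for w using s p(4)[OF that] by (intro \<xi>I) simp_all
  moreover have "\<xi> s = \<one>\<^bsub>K\<^esub>" using s p(3)[OF A(3)] by (intro \<xi>I) simp_all
  ultimately show ?thesis by (rule that)
qed

end

text \<open>
  The image of \<open>V \<otimes> D\<close> in \<open>V \<otimes> S\<close>, for a subspace \<open>D\<close> of \<open>S\<close>.
\<close>

inductive_set tensor_span ::
  "('u, 'r) ring_scheme \<Rightarrow> ('u, 'u) module \<Rightarrow> ('u, 'u) module \<Rightarrow> 'u set \<Rightarrow> ('u \<times> 'u \<Rightarrow>\<^sub>0 int) set set"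
  for K V S D where
    pure: "v \<in> carrier V \<Longrightarrow> d \<in> D \<Longrightarrow> pure K V S v d \<in> tensor_span K V S D"
  | add: "x \<in> tensor_span K V S D \<Longrightarrow> y \<in> tensor_span K V S D \<Longrightarrow>
      x \<oplus>\<^bsub>tensor K V S\<^esub> y \<in> tensor_span K V S D"

lemma tensor_span_mono: "z \<in> tensor_span K V S D \<Longrightarrow> D \<subseteq> E \<Longrightarrow> z \<in> tensor_span K V S E"
  by (induction rule: tensor_span.induct) (auto intro: tensor_span.intros)

text \<open>
  By induction on the dimension of a subspace \<open>D\<close> of \<open>S\<close> with \<open>z \<in> V \<otimes> D\<close>. An element of
  \<open>V \<otimes> (D + K s)\<close> with \<open>s \<notin> D\<close> has the form \<open>w + v \<otimes> s\<close> with \<open>w \<in> V \<otimes> D\<close>, and a linear form with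
  \<open>\<xi>(D) = 0\<close> and \<open>\<xi>(s) = 1\<close> sends it to \<open>v\<close>; so \<open>v = 0\<close>. Instead of dimensions, the proof uses that the
  subspaces for which the claim holds, the good ones, include \<open>0\<close> and are closed under adjoining an
  element, and that every tensor lies in \<open>V \<otimes> D\<close> for some \<open>D\<close> obtained in this way.
\<close>

lemma tensor_zero_if_functionals_vanish:
  assumes K: "field K" and V: "module K V" and S: "module K S"
    and z: "z \<in> carrier (tensor K V S)"
    and vanish: "\<And>\<xi>. lin K S (scalar_alg K) \<xi> \<Longrightarrow>
      tensor_map K V (scalar_alg K) \<xi> z = \<zero>\<^bsub>tensor K V (scalar_alg K)\<^esub>"
  shows "z = \<zero>\<^bsub>tensor K V S\<^esub>"
proof -
  interpret K: field K by fact
  interpret V: module K V by fact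
  interpret S: vector_space_over K S by (intro vector_space_over.intro K S)
  interpret tp: tensor_pair K V S by (intro tensor_pair.intro V S)
  interpret X: abelian_group "tensor K V S" by (rule tp.abelian_tensor)
  let ?K1 = "scalar_alg K"
  note K1 = comm_algebras_module[OF scalar_alg_closed[OF K.is_cring]]
  interpret t1: tensor_pair K V ?K1 by (intro tensor_pair.intro V K1)
  interpret X1: abelian_group "tensor K V ?K1" by (rule t1.abelian_tensor)
  define killed where "killed w \<longleftrightarrow> (\<forall>\<xi>. lin K S ?K1 \<xi> \<longrightarrow> tensor_map K V ?K1 \<xi> w = \<zero>\<^bsub>tensor K V ?K1\<^esub>)" for w
  define good where "good D \<longleftrightarrow> submodule D K S \<and> (\<forall>w \<in> tensor_span K V S D. killed w \<longrightarrow> w = \<zero>\<^bsub>tensor K V S\<^esub>)" for D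
  have span_closed: "w \<in> carrier (tensor K V S)" if "w \<in> tensor_span K V S D" "D \<subseteq> carrier S" for w D
    using that by (induction rule: tensor_span.induct) auto
  have good0: "good {\<zero>\<^bsub>S\<^esub>}"
  proof -
    have "w = \<zero>\<^bsub>tensor K V S\<^esub>" if "w \<in> tensor_span K V S {\<zero>\<^bsub>S\<^esub>}" for w
      using that by (induction rule: tensor_span.induct) (simp_all add: tp.pure_zero_right)
    then show ?thesis unfolding good_def using S.V.submoduleI[of "{\<zero>\<^bsub>S\<^esub>}"] by simp
  qed
  have step: "good (adjoin K S D s)" if D: "good D" and s: "s \<in> carrier S" for D s
  proof -
    have sub: "submodule D K S" using D by (simp add: good_def)
    note F = S.submodule_facts[OF sub] and ad = S.adjoin_submodule[OF sub s]
    have "w = \<zero>\<^bsub>tensor K V S\<^esub>" if w: "w \<in> tensor_span K V S (adjoin K S D s)" and kw: "killed w" for w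
    proof (cases "s \<in> D")
      case True
      then have "adjoin K S D s \<subseteq> D" using F(3,5) by (auto simp: adjoin_def)
      then show ?thesis using tensor_span_mono[OF w] D kw by (auto simp: good_def)
    next
      case False
      have "\<exists>w' \<in> tensor_span K V S D. \<exists>v \<in> carrier V. w = w' \<oplus>\<^bsub>tensor K V S\<^esub> pure K V S v s"
        using w
      proof (induction rule: tensor_span.induct)
        case (pure v e)
        then obtain d k where e: "e = d \<oplus>\<^bsub>S\<^esub> k \<odot>\<^bsub>S\<^esub> s" "d \<in> D" "k \<in> carrier K" by (auto simp: adjoin_def)
        have "pure K V S v e = pure K V S v d \<oplus>\<^bsub>tensor K V S\<^esub> pure K V S (k \<odot>\<^bsub>V\<^esub> v) s"
          using e pure(1) s F(1) by (auto simp: tp.pure_add_right tp.pure_balanced)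
        then show ?case
          using tensor_span.pure[OF pure(1) e(2)] V.smult_closed[OF e(3) pure(1)] by blast
      next
        case (add x y)
        then obtain x' v y' u where xy: "x' \<in> tensor_span K V S D" "v \<in> carrier V"
          "x = x' \<oplus>\<^bsub>tensor K V S\<^esub> pure K V S v s" "y' \<in> tensor_span K V S D" "u \<in> carrier V"
          "y = y' \<oplus>\<^bsub>tensor K V S\<^esub> pure K V S u s" by blast
        have "x \<oplus>\<^bsub>tensor K V S\<^esub> y = (x' \<oplus>\<^bsub>tensor K V S\<^esub> y') \<oplus>\<^bsub>tensor K V S\<^esub> pure K V S (v \<oplus>\<^bsub>V\<^esub> u) s"
          using xy s span_closed[OF xy(1) F(1)] span_closed[OF xy(4) F(1)]
          by (simp add: tp.pure_add_left X.a_ac)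
        then show ?case
          using tensor_span.add[OF xy(1,4)] V.M.a_closed[OF xy(2,5)] by blast
      qed
      then obtain w' v where w': "w' \<in> tensor_span K V S D" "v \<in> carrier V"
        "w = w' \<oplus>\<^bsub>tensor K V S\<^esub> pure K V S v s" by blast
      obtain \<xi> where \<xi>: "lin K S ?K1 \<xi>" "\<And>d. d \<in> D \<Longrightarrow> \<xi> d = \<zero>\<^bsub>K\<^esub>" "\<xi> s = \<one>\<^bsub>K\<^esub>"
        using S.functional_exists[OF sub s False] by blast
      note add = tensor_map_additive[OF V S K1 \<xi>(1)]
      note w'c = span_closed[OF w'(1) F(1)]
      have "tensor_map K V ?K1 \<xi> w' = \<zero>\<^bsub>tensor K V ?K1\<^esub>"
        using w'(1)
      proof (induction rule: tensor_span.induct)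
        case (pure u d)
        then show ?case using F(1) t1.pure_zero_right[simplified] \<xi>(2) by (auto simp: tensor_map_pure[OF V S K1 \<xi>(1)])
      next
        case (add x y)
        then show ?case
          using additive_add[OF tensor_map_additive[OF V S K1 \<xi>(1)] span_closed[OF add(1) F(1)] span_closed[OF add(2) F(1)]]
          by simp
      qed
      then have "pure K V ?K1 v \<one>\<^bsub>K\<^esub> = \<zero>\<^bsub>tensor K V ?K1\<^esub>"
        using kw w' s \<xi> w'c additive_add[OF add w'c, of "pure K V S v s"]
        by (simp add: killed_def tensor_map_pure[OF V S K1 \<xi>(1)])
      then have "v = \<zero>\<^bsub>V\<^esub>"
        using scalar_part_pure[OF V w'(2) K.one_closed] w'(2)
          additive_zero[OF scalar_part_additive[OF V] t1.abelian_tensor V.abelian_group_axioms] by simp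
      then have "w = w'" using w' s w'c by (simp add: tp.pure_zero_left)
      then show ?thesis using w'(1) D kw by (auto simp: good_def)
    qed
    then show ?thesis unfolding good_def using ad(1) by blast
  qed
  have "\<exists>E. good E \<and> w \<oplus>\<^bsub>tensor K V S\<^esub> z \<in> tensor_span K V S E" if "good D" "w \<in> tensor_span K V S D" for D w
    using z that
  proof (induction z arbitrary: D w rule: tp.tensor_induct)
    case (pure v s)
    have sub: "submodule D K S" using pure by (simp add: good_def)
    note ad = S.adjoin_submodule[OF sub pure(2)]
    have "w \<oplus>\<^bsub>tensor K V S\<^esub> pure K V S v s \<in> tensor_span K V S (adjoin K S D s)"
      by (rule tensor_span.add[OF tensor_span_mono[OF pure(4) ad(2)] tensor_span.pure[OF pure(1) ad(3)]])
    then show ?case using step[OF pure(3,2)] by blast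
  next
    case (add x y)
    obtain E where E: "good E" "w \<oplus>\<^bsub>tensor K V S\<^esub> x \<in> tensor_span K V S E" using add by blast
    obtain E' where E': "good E'" "(w \<oplus>\<^bsub>tensor K V S\<^esub> x) \<oplus>\<^bsub>tensor K V S\<^esub> y \<in> tensor_span K V S E'"
      using add.IH(2)[OF E] by blast
    have "w \<in> carrier (tensor K V S)"
      using span_closed[OF add.prems(2)] S.submodule_facts(1) add.prems(1) by (auto simp: good_def)
    then show ?case using E' add.hyps by (auto simp: X.a_assoc)
  qed
  from this[OF good0, of "pure K V S \<zero>\<^bsub>V\<^esub> \<zero>\<^bsub>S\<^esub>"]
  obtain E where "good E" "z \<in> tensor_span K V S E"
    using tensor_span.pure[of "\<zero>\<^bsub>V\<^esub>" V "\<zero>\<^bsub>S\<^esub>" "{\<zero>\<^bsub>S\<^esub>}" K S] z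
    by (auto simp: tp.pure_zero_left[OF S.V.M.zero_closed])
  moreover have "killed z" using vanish by (simp add: killed_def)
  ultimately show ?thesis by (auto simp: good_def)
qed

section \<open>Morphisms of functors\<close>

lemma id_mor_mor:
  assumes "module_functor K M"
  shows "id_mor K M \<in> mor K M M"
proof -
  interpret M: module_functor K M by fact
  show ?thesis
  proof (rule morI)
    fix S assume S: "S \<in> comm_algebras K"
    show "lin S (Ob M S) (Ob M S) (id_mor K M S)"
      by (rule lin_cong[OF lin_id _ M.Ob_module[OF S]]) (simp add: id_mor_def S)
  qed (simp_all add: id_mor_def M.Ar_closed)
qed

lemma comp_mor_mor:
  assumes L: "module_functor K L" and f: "f \<in> mor K L M" and g: "g \<in> mor K M N"
  shows "comp_mor K L g f \<in> mor K L N"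
proof -
  interpret L: module_functor K L by fact
  show ?thesis
  proof (rule morI)
    fix S assume S: "S \<in> comm_algebras K"
    show "lin S (Ob L S) (Ob N S) (comp_mor K L g f S)"
      by (rule lin_cong[OF lin_comp[OF mor_lin[OF f S] mor_lin[OF g S]] _ L.Ob_module[OF S]])
        (simp add: comp_mor_def S compose_eq)
  next
    fix S T h x assume *: "S \<in> comm_algebras K" "T \<in> comm_algebras K" "h \<in> alg_hom K S T"
      "x \<in> carrier (Ob L S)"
    then show "comp_mor K L g f T (Ar L S T h x) = Ar N S T h (comp_mor K L g f S x)"
      using mor_natural[OF f *] mor_natural[OF g *(1-3) mor_closed[OF f *(1,4)]] L.Ar_closed[OF *]
      by (simp add: comp_mor_def compose_eq)
  qed (simp_all add: comp_mor_def compose_def)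
qed

lemma comp_mor_apply:
  "S \<in> comm_algebras K \<Longrightarrow> x \<in> carrier (Ob L S) \<Longrightarrow> comp_mor K L g f S x = g S (f S x)"
  by (simp add: comp_mor_def compose_eq)

lemma comp_mor_assoc:
  assumes f: "f \<in> mor K L M"
  shows "comp_mor K L (comp_mor K M h g) f = comp_mor K L h (comp_mor K L g f)"
proof -
  have "compose (carrier (Ob L S)) (compose (carrier (Ob M S)) (h S) (g S)) (f S)
      = compose (carrier (Ob L S)) (h S) (compose (carrier (Ob L S)) (g S) (f S))"
    if "S \<in> comm_algebras K" for S
    using mor_closed[OF f that] by (auto simp: compose_def fun_eq_iff)
  then show ?thesis
    by (simp add: comp_mor_def fun_eq_iff restrict_def)
qed

lemma functor_iso_iff_bij:
  assumes M: "module_functor K M"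
  shows "functor_iso K M N f \<longleftrightarrow> f \<in> mor K M N \<and>
    (\<forall>S \<in> comm_algebras K. bij_betw (f S) (carrier (Ob M S)) (carrier (Ob N S)))"
proof (intro iffI conjI ballI; (elim conjE)?)
  interpret M: module_functor K M by fact
  {
    assume iso: "functor_iso K M N f"
    then show "f \<in> mor K M N" by (simp add: functor_iso_def)
    fix S assume S: "S \<in> comm_algebras K"
    obtain g where f: "f \<in> mor K M N" and g: "g \<in> mor K N M" and gf: "comp_mor K M g f = id_mor K M"
      and fg: "comp_mor K N f g = id_mor K N"
      using iso by (auto simp: functor_iso_def)
    have "g S (f S x) = x" if "x \<in> carrier (Ob M S)" for x
      using fun_cong[OF fun_cong[OF gf], of S x] S that by (simp add: comp_mor_apply id_mor_def)
    moreover have "f S (g S y) = y" if "y \<in> carrier (Ob N S)" for y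
      using fun_cong[OF fun_cong[OF fg], of S y] S that by (simp add: comp_mor_apply id_mor_def)
    ultimately show "bij_betw (f S) (carrier (Ob M S)) (carrier (Ob N S))"
      using mor_closed[OF f S] mor_closed[OF g S] by (intro bij_betw_byWitness[where f' = "g S"]) auto
  }
  assume f: "f \<in> mor K M N"
    and bij: "\<forall>S \<in> comm_algebras K. bij_betw (f S) (carrier (Ob M S)) (carrier (Ob N S))"
  define g where "g = (\<lambda>S \<in> comm_algebras K. \<lambda>y \<in> carrier (Ob N S). inv_into (carrier (Ob M S)) (f S) y)"
  have g_closed: "g S y \<in> carrier (Ob M S)" and fg: "f S (g S y) = y"
    if "S \<in> comm_algebras K" "y \<in> carrier (Ob N S)" for S y
    using bij that inv_into_into[of y "f S" "carrier (Ob M S)"] f_inv_into_f[of y "f S" "carrier (Ob M S)"]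
    by (auto simp: g_def bij_betw_def)
  have gf: "g S (f S x) = x" if "S \<in> comm_algebras K" "x \<in> carrier (Ob M S)" for S x
    using bij that inv_into_f_f[of "f S" "carrier (Ob M S)" x] mor_closed[OF f that]
    by (auto simp: g_def bij_betw_def)
  have gI: "g S y = x" if "S \<in> comm_algebras K" "x \<in> carrier (Ob M S)" "y = f S x" for S x y
    using gf that by simp
  have "g \<in> mor K N M"
  proof (rule morI)
    fix S assume S: "S \<in> comm_algebras K"
    interpret MS: module S "Ob M S" by (rule M.Ob_module[OF S])
    note l = mor_lin[OF f S]
    show "lin S (Ob N S) (Ob M S) (g S)"
      by (rule linI)
        (use S g_closed in \<open>auto intro!: gI simp: lin_add[OF l] lin_smult[OF l] fg\<close>)
  next
    fix S T h y assume *: "S \<in> comm_algebras K" "T \<in> comm_algebras K" "h \<in> alg_hom K S T"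
      "y \<in> carrier (Ob N S)"
    show "g T (Ar N S T h y) = Ar M S T h (g S y)"
      using mor_natural[OF f *(1-3) g_closed[OF *(1,4)]] fg[OF *(1,4)]
      by (intro gI *(2) M.Ar_closed[OF *(1-3) g_closed[OF *(1,4)]]) simp
  qed (simp_all add: g_def)
  moreover have "comp_mor K M g f = id_mor K M"
    by (auto simp: comp_mor_def id_mor_def fun_eq_iff restrict_def compose_def gf)
  moreover have "comp_mor K N f g = id_mor K N"
    by (auto simp: comp_mor_def id_mor_def fun_eq_iff restrict_def compose_def fg)
  ultimately show "functor_iso K M N f"
    using f by (auto simp: functor_iso_def)
qed

section \<open>Quasi-coherent quotients\<close>

locale functor_over_field = functor_in_universe K M + K: field K
  for K :: "('u, 'r) ring_scheme" and M :: "('u, 'm) mfunctor"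
begin

abbreviation "K1 \<equiv> scalar_alg K"
abbreviation "Q \<equiv> qc_quotients K M"

lemma K1_closed: "K1 \<in> comm_algebras K"
  by (rule scalar_alg_closed[OF is_cring])

lemma quotientD:
  assumes "i \<in> Q"
  shows "module K (fst i)" "snd i \<in> mor K M (qc (fst i))"
    "\<And>S. S \<in> comm_algebras K \<Longrightarrow> snd i S ` carrier (Ob M S) = carrier (tensor K (fst i) S)"
  using assms by (simp_all add: qc_quotients_def functor_epi_def case_prod_beta)

lemma quotient_closed:
  assumes "i \<in> Q" "S \<in> comm_algebras K" "x \<in> carrier (Ob M S)"
  shows "snd i S x \<in> carrier (tensor K (fst i) S)"
  by (rule qc_mor_closed[OF quotientD(2)[OF assms(1)] assms(2,3)])

text \<open>
  An epimorphism of functors is in particular surjective over \<open>K\<close>, where \<open>V \<otimes> K = V\<close>.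
\<close>

lemma quotient_cancel:
  assumes i: "i \<in> Q" and W: "module K W" and a: "lin K (fst i) W a" and b: "lin K (fst i) W b"
    and eq: "push K M (fst i) W a (snd i) = push K M (fst i) W b (snd i)" and v: "v \<in> carrier (fst i)"
  shows "a v = b v"
proof -
  note V = quotientD(1)[OF i]
  note K1M = comm_algebras_module[OF K1_closed]
  interpret tp: tensor_pair K "fst i" K1 by (intro tensor_pair.intro V K1M)
  interpret W: module K W by fact
  have "pure K (fst i) K1 v \<one>\<^bsub>K\<^esub> \<in> snd i K1 ` carrier (Ob M K1)"
    unfolding quotientD(3)[OF i K1_closed] using v by simp
  then obtain x where x: "x \<in> carrier (Ob M K1)" "snd i K1 x = pure K (fst i) K1 v \<one>\<^bsub>K\<^esub>" by auto
  have "left_map K (fst i) K1 W a (snd i K1 x) = left_map K (fst i) K1 W b (snd i K1 x)"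
    using fun_cong[OF fun_cong[OF eq], of K1 x] K1_closed x(1) by simp
  then have "pure K W K1 (a v) \<one>\<^bsub>K\<^esub> = pure K W K1 (b v) \<one>\<^bsub>K\<^esub>"
    using x(2) v by (simp add: left_map_pure[OF V K1M W a] left_map_pure[OF V K1M W b])
  then have "scalar_part K W (pure K W K1 (a v) \<one>\<^bsub>K\<^esub>) = scalar_part K W (pure K W K1 (b v) \<one>\<^bsub>K\<^esub>)" by simp
  then show ?thesis
    using lin_closed[OF a v] lin_closed[OF b v] by (simp add: scalar_part_pure[OF W])
qed

lemma factors_unique:
  assumes i: "i \<in> Q" and g: "qc_factors K M i j g" and g': "qc_factors K M i j g'"
  shows "g = g'"
proof (rule mor_eqI)
  show "g \<in> mor K (qc (fst i)) (qc (fst j))" "g' \<in> mor K (qc (fst i)) (qc (fst j))"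
    using g g' by (simp_all add: qc_factors_def)
  fix S z assume S: "S \<in> comm_algebras K" and z: "z \<in> carrier (Ob (qc (fst i)) S)"
  obtain x where x: "x \<in> carrier (Ob M S)" "z = snd i S x"
    using z quotientD(3)[OF i S] by auto
  have "comp_mor K M g (snd i) = comp_mor K M g' (snd i)" using g g' by (simp add: qc_factors_def)
  from fun_cong[OF fun_cong[OF this], of S x] show "g S z = g' S z"
    using S x by (simp add: comp_mor_apply)
qed

lemma transition_factors:
  assumes "i \<in> Q" "qc_ge K M i j"
  shows "qc_factors K M i j (qc_transition K M i j)"
proof -
  obtain g where g: "qc_factors K M i j g" using assms(2) by (auto simp: qc_ge_def)
  show ?thesis
    unfolding qc_transition_def
  proof (rule theI[where P = "qc_factors K M i j"])
    show "qc_factors K M i j g" by (rule g)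
    fix g' assume "qc_factors K M i j g'"
    then show "g' = g" by (rule factors_unique[OF assms(1) _ g])
  qed
qed

lemma transition_eqI:
  assumes "i \<in> Q" "qc_factors K M i j g"
  shows "qc_ge K M i j" "qc_transition K M i j = g"
proof -
  show ge: "qc_ge K M i j" using assms(2) by (auto simp: qc_ge_def)
  show "qc_transition K M i j = g"
    by (rule factors_unique[OF assms(1) transition_factors[OF assms(1) ge] assms(2)])
qed

text \<open>
  With the lemma that follows, this identifies the transition morphisms between two quotients
  with the linear maps \<open>u\<close> for which \<open>u \<otimes> 1\<close> is compatible with the projections from \<open>M\<close>.
\<close>

lemma linear_factor:
  assumes i: "i \<in> Q" and j: "j \<in> Q" and u: "lin K (fst i) (fst j) u"
    and eq: "push K M (fst i) (fst j) u (snd i) = snd j"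
  shows "qc_ge K M i j"
    and "S \<in> comm_algebras K \<Longrightarrow> z \<in> carrier (tensor K (fst i) S) \<Longrightarrow>
      qc_transition K M i j S z = left_map K (fst i) S (fst j) u z"
proof -
  note V = quotientD(1)[OF i] and W = quotientD(1)[OF j]
  note qV = qc_functor[OF V]
  let ?g = "push K (qc (fst i)) (fst i) (fst j) u (id_mor K (qc (fst i)))"
  have g: "?g \<in> mor K (qc (fst i)) (qc (fst j))"
    by (rule push_mor[OF qV V W u id_mor_mor[OF qV]])
  have g_apply: "?g S z = left_map K (fst i) S (fst j) u z"
    if "S \<in> comm_algebras K" "z \<in> carrier (tensor K (fst i) S)" for S z
    using that by (simp add: id_mor_def)
  have "comp_mor K M ?g (snd i) = push K M (fst i) (fst j) u (snd i)"
    by (rule mor_eqI[OF comp_mor_mor[OF module_functor_axioms quotientD(2)[OF i] g]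
          push_mor[OF module_functor_axioms V W u quotientD(2)[OF i]]])
      (simp add: comp_mor_apply g_apply quotient_closed[OF i] del: push_apply, simp)
  then have "qc_factors K M i j ?g" using g eq by (simp add: qc_factors_def)
  note t = transition_eqI[OF i this]
  show "qc_ge K M i j" by (rule t(1))
  show "qc_transition K M i j S z = left_map K (fst i) S (fst j) u z"
    if "S \<in> comm_algebras K" "z \<in> carrier (tensor K (fst i) S)"
    unfolding t(2) by (rule g_apply[OF that])
qed

lemma transition_linear:
  assumes i: "i \<in> Q" and j: "j \<in> Q" and ge: "qc_ge K M i j"
  obtains u where "lin K (fst i) (fst j) u" "push K M (fst i) (fst j) u (snd i) = snd j"
    "\<And>S z. S \<in> comm_algebras K \<Longrightarrow> z \<in> carrier (tensor K (fst i) S) \<Longrightarrow>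
      qc_transition K M i j S z = left_map K (fst i) S (fst j) u z"
proof -
  note V = quotientD(1)[OF i] and W = quotientD(1)[OF j]
  note fac = transition_factors[OF i ge, unfolded qc_factors_def]
  obtain u where u: "lin K (fst i) (fst j) u" and t: "\<And>S z. S \<in> comm_algebras K \<Longrightarrow>
      z \<in> carrier (tensor K (fst i) S) \<Longrightarrow> qc_transition K M i j S z = left_map K (fst i) S (fst j) u z"
    by (rule quasi_coherent_mor_linear[OF V W conjunct1[OF fac]]) blast
  have "push K M (fst i) (fst j) u (snd i) = snd j"
  proof (rule mor_eqI[OF push_mor[OF module_functor_axioms V W u quotientD(2)[OF i]] quotientD(2)[OF j]])
    fix S x assume S: "S \<in> comm_algebras K" and x: "x \<in> carrier (Ob M S)"
    then show "push K M (fst i) (fst j) u (snd i) S x = snd j S x"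
      using fun_cong[OF fun_cong[OF conjunct2[OF fac]], of S x] t[OF S quotient_closed[OF i S x]]
      by (simp add: comp_mor_apply)
  qed
  with u t show ?thesis using that by blast
qed

lemma limit_carrier:
  "carrier (Ob (qc_limit K M) S) = {x \<in> \<Pi>\<^sub>E i \<in> Q. carrier (tensor K (fst i) S).
     \<forall>i \<in> Q. \<forall>j \<in> Q. qc_ge K M i j \<longrightarrow> qc_transition K M i j S (x i) = x j}"
  by (simp add: qc_limit_def inverse_limit_def)

lemma limit_memI:
  assumes S: "S \<in> comm_algebras K" and x: "x \<in> (\<Pi>\<^sub>E i \<in> Q. carrier (tensor K (fst i) S))"
    and compat: "\<And>i j u. i \<in> Q \<Longrightarrow> j \<in> Q \<Longrightarrow> lin K (fst i) (fst j) u \<Longrightarrow>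
      push K M (fst i) (fst j) u (snd i) = snd j \<Longrightarrow> left_map K (fst i) S (fst j) u (x i) = x j"
  shows "x \<in> carrier (Ob (qc_limit K M) S)"
proof -
  have "qc_transition K M i j S (x i) = x j" if ij: "i \<in> Q" "j \<in> Q" "qc_ge K M i j" for i j
  proof -
    obtain u where u: "lin K (fst i) (fst j) u" "push K M (fst i) (fst j) u (snd i) = snd j"
      and t: "\<And>S z. S \<in> comm_algebras K \<Longrightarrow> z \<in> carrier (tensor K (fst i) S) \<Longrightarrow>
        qc_transition K M i j S z = left_map K (fst i) S (fst j) u z"
      using transition_linear[OF ij] by blast
    show ?thesis using compat[OF ij(1,2) u] t[OF S PiE_mem[OF x ij(1)]] by simp
  qed
  then show ?thesis using x by (simp add: limit_carrier)
qed

lemma limit_memD: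
  assumes S: "S \<in> comm_algebras K" and x: "x \<in> carrier (Ob (qc_limit K M) S)"
  shows "i \<in> Q \<Longrightarrow> x i \<in> carrier (tensor K (fst i) S)"
    and "i \<in> Q \<Longrightarrow> j \<in> Q \<Longrightarrow> lin K (fst i) (fst j) u \<Longrightarrow>
      push K M (fst i) (fst j) u (snd i) = snd j \<Longrightarrow> left_map K (fst i) S (fst j) u (x i) = x j"
    and "x \<in> extensional Q"
proof -
  show c: "i \<in> Q \<Longrightarrow> x i \<in> carrier (tensor K (fst i) S)" for i
    using x by (auto simp: limit_carrier)
  show "x \<in> extensional Q" using x by (simp add: limit_carrier PiE_def)
  assume *: "i \<in> Q" "j \<in> Q" "lin K (fst i) (fst j) u" "push K M (fst i) (fst j) u (snd i) = snd j"
  then have "qc_transition K M i j S (x i) = x j"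
    using linear_factor(1)[OF *] x by (auto simp: limit_carrier)
  then show "left_map K (fst i) S (fst j) u (x i) = x j"
    using linear_factor(2)[OF * S c[OF *(1)]] by simp
qed

lemma to_limit_apply:
  "S \<in> comm_algebras K \<Longrightarrow> m \<in> carrier (Ob M S) \<Longrightarrow> i \<in> Q \<Longrightarrow> to_qc_limit K M S m i = snd i S m"
  by (simp add: to_qc_limit_def)

lemma to_limit_closed:
  assumes S: "S \<in> comm_algebras K" and m: "m \<in> carrier (Ob M S)"
  shows "to_qc_limit K M S m \<in> carrier (Ob (qc_limit K M) S)"
proof (rule limit_memI[OF S])
  show "to_qc_limit K M S m \<in> (\<Pi>\<^sub>E i \<in> Q. carrier (tensor K (fst i) S))"
    using S m quotient_closed by (auto simp: to_qc_limit_def)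
  fix i j u assume *: "i \<in> Q" "j \<in> Q" "push K M (fst i) (fst j) u (snd i) = snd j"
  show "left_map K (fst i) S (fst j) u (to_qc_limit K M S m i) = to_qc_limit K M S m j"
    using fun_cong[OF fun_cong[OF *(3)], of S m] S m *(1,2) by (simp add: to_limit_apply)
qed

lemma to_limit_mor: "to_qc_limit K M \<in> mor K M (qc_limit K M)"
proof (rule morI)
  fix S assume S: "S \<in> comm_algebras K"
  interpret MS: module S "Ob M S" by (rule Ob_module[OF S])
  show "lin S (Ob M S) (Ob (qc_limit K M) S) (to_qc_limit K M S)"
  proof (rule linI)
    fix m assume m: "m \<in> carrier (Ob M S)"
    show "to_qc_limit K M S m \<in> carrier (Ob (qc_limit K M) S)" by (rule to_limit_closed[OF S m])
    fix a assume "a \<in> carrier S"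
    then show "to_qc_limit K M S (a \<odot>\<^bsub>Ob M S\<^esub> m) = a \<odot>\<^bsub>Ob (qc_limit K M) S\<^esub> to_qc_limit K M S m"
      using S m lin_smult[OF mor_lin[OF quotientD(2) S]]
      by (auto simp: to_qc_limit_def qc_limit_def inverse_limit_def fun_eq_iff restrict_def)
  next
    fix m m' assume "m \<in> carrier (Ob M S)" "m' \<in> carrier (Ob M S)"
    then show "to_qc_limit K M S (m \<oplus>\<^bsub>Ob M S\<^esub> m')
        = to_qc_limit K M S m \<oplus>\<^bsub>Ob (qc_limit K M) S\<^esub> to_qc_limit K M S m'"
      using S lin_add[OF mor_lin[OF quotientD(2) S]]
      by (auto simp: to_qc_limit_def qc_limit_def inverse_limit_def fun_eq_iff restrict_def)
  qed
next
  fix S T h m assume *: "S \<in> comm_algebras K" "T \<in> comm_algebras K" "h \<in> alg_hom K S T"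
    "m \<in> carrier (Ob M S)"
  show "to_qc_limit K M T (Ar M S T h m) = Ar (qc_limit K M) S T h (to_qc_limit K M S m)"
    using * mor_natural[OF quotientD(2) *] Ar_closed[OF *]
    by (auto simp: to_qc_limit_def qc_limit_def inverse_limit_def fun_eq_iff restrict_def)
qed (auto simp: to_qc_limit_def)

section \<open>Factorization through quotients\<close>

text \<open>
  The functors \<open>M\<close> for which \<open>M(S) \<rightarrow> M(K)\<close> exists, at least elementwise, for linear forms \<open>S \<rightarrow> K\<close> in
  place of homomorphisms, compatibly with all morphisms into quasi-coherent modules.
\<close>

definition scalar_liftable :: bool where
  "scalar_liftable \<longleftrightarrow> (\<forall>S \<in> comm_algebras K. \<forall>\<xi>. lin K S K1 \<xi> \<longrightarrow>
     (\<forall>x \<in> carrier (Ob M S). \<exists>y \<in> carrier (Ob M K1). \<forall>W f. module K W \<longrightarrow> f \<in> mor K M (qc W) \<longrightarrow>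
       f K1 y = tensor_map K W K1 \<xi> (f S x)))"

lemma scalar_liftableD:
  assumes lift: scalar_liftable and S: "S \<in> comm_algebras K" and \<xi>: "lin K S K1 \<xi>"
    and x: "x \<in> carrier (Ob M S)"
  shows "\<exists>y \<in> carrier (Ob M K1). \<forall>W f. module K W \<longrightarrow> f \<in> mor K M (qc W) \<longrightarrow>
       f K1 y = tensor_map K W K1 \<xi> (f S x)"
  by (rule lift[unfolded scalar_liftable_def, THEN bspec, OF S, THEN spec, THEN mp, OF \<xi>,
        THEN bspec, OF x])

text \<open>
  The space \<open>V\<close> is the image of \<open>M(K)\<close> in \<open>W\<close>, and \<open>p\<close> is a projection of \<open>W\<close> onto it. For \<open>x \<in> M(S)\<close>,
  every \<open>1 \<otimes> \<xi>\<close> sends \<open>(p \<otimes> 1)(f(x)) - f(x)\<close> to \<open>p(f(y)) - f(y) = 0\<close>, where \<open>y \<in> M(K)\<close> lifts \<open>x\<close>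
  along \<open>\<xi>\<close>; so \<open>f\<close> takes its values in \<open>V\<close>. The factor \<open>M \<rightarrow> V\<close> is surjective over \<open>K\<close>, hence over
  every \<open>S\<close>, because \<open>V \<otimes> S\<close> is generated by the elements \<open>v \<otimes> 1\<close>.
\<close>

lemma factor_through_quotient:
  assumes lift: scalar_liftable and W: "module K W" and f: "f \<in> mor K M (qc W)"
  obtains V g p where "(V, g) \<in> Q" "lin K V W (\<lambda>v. v)" "lin K W V p"
    "\<And>v. v \<in> carrier V \<Longrightarrow> p v = v" "push K M V W (\<lambda>v. v) g = f"
proof -
  interpret W: vector_space_over K W by (intro vector_space_over.intro K.field_axioms W)
  note mf = module_functor_axioms
  note K1M = comm_algebras_module[OF K1_closed]
  interpret MK: module K1 "Ob M K1" by (rule Ob_module[OF K1_closed])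
  note lf = mor_lin[OF f K1_closed, simplified]
  define s where "s y = scalar_part K W (f K1 y)" for y
  have fc: "f K1 y \<in> carrier (tensor K W K1)" if "y \<in> carrier (Ob M K1)" for y
    by (rule qc_mor_closed[OF f K1_closed that])
  have sp: "f K1 y = pure K W K1 (s y) \<one>\<^bsub>K\<^esub>" if "y \<in> carrier (Ob M K1)" for y
    using pure_scalar_part[OF W fc[OF that]] by (simp add: s_def)
  have s_add: "additive (Ob M K1) W s"
    unfolding s_def by (rule additive_comp[OF lin_additive[OF lf] scalar_part_additive[OF W]])
  have s_smult: "s (a \<odot>\<^bsub>Ob M K1\<^esub> y) = a \<odot>\<^bsub>W\<^esub> s y" if "a \<in> carrier K" "y \<in> carrier (Ob M K1)" for a y
    using that lin_smult[OF lf, of a y] by (simp add: s_def scalar_part_smult[OF W] fc)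
  let ?A = "s ` carrier (Ob M K1)"
  have A: "submodule ?A K W"
  proof (rule W.V.submoduleI)
    show "?A \<subseteq> carrier W" using additive_closed[OF s_add] by blast
    show "\<zero>\<^bsub>W\<^esub> \<in> ?A"
      using additive_zero[OF s_add MK.abelian_group_axioms W.V.abelian_group_axioms] by (metis MK.M.zero_closed imageI)
  next
    fix x assume "x \<in> ?A"
    then obtain y where y: "y \<in> carrier (Ob M K1)" "x = s y" by blast
    show "\<ominus>\<^bsub>W\<^esub> x \<in> ?A"
      using y additive_minus[OF s_add MK.abelian_group_axioms W.V.abelian_group_axioms y(1)]
      by (metis MK.M.a_inv_closed imageI)
    fix a assume "a \<in> carrier K"
    then show "a \<odot>\<^bsub>W\<^esub> x \<in> ?A" using y s_smult MK.smult_closed[of a y] by (metis imageI scalar_alg_simps(1))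
  next
    fix x x' assume "x \<in> ?A" "x' \<in> ?A"
    then obtain y y' where y: "y \<in> carrier (Ob M K1)" "x = s y" "y' \<in> carrier (Ob M K1)" "x' = s y'" by blast
    then have "x \<oplus>\<^bsub>W\<^esub> x' = s (y \<oplus>\<^bsub>Ob M K1\<^esub> y')" by (simp add: additive_add[OF s_add])
    then show "x \<oplus>\<^bsub>W\<^esub> x' \<in> ?A" using MK.M.a_closed[OF y(1,3)] by simp
  qed
  have zero_sub: "submodule {\<zero>\<^bsub>W\<^esub>} K W" by (rule W.V.submoduleI) simp_all
  note FA = W.submodule_facts[OF A]
  obtain p where p: "lin K W W p" "\<And>v. v \<in> carrier W \<Longrightarrow> p v \<in> ?A" "\<And>a. a \<in> ?A \<Longrightarrow> p a = a"
  proof (rule W.projection_exists[OF A zero_sub])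
    show "?A \<inter> {\<zero>\<^bsub>W\<^esub>} = {\<zero>\<^bsub>W\<^esub>}" using FA(2) by simp
  qed (rule that)
  define V where "V = W\<lparr>carrier := ?A\<rparr>"
  have V: "module K V" unfolding V_def by (rule submodule.submodule_is_module[OF A W])
  have Vs: "carrier V = ?A" "ring.add V = ring.add W" "smult V = smult W" by (simp_all add: V_def)
  have inc: "lin K V W (\<lambda>v. v)" by (rule linI) (use FA(1) in \<open>auto simp: Vs\<close>)
  have pV: "lin K W V p"
    by (rule linI) (simp_all add: Vs p lin_add[OF p(1)] lin_smult[OF p(1)])
  have pid: "p v = v" if "v \<in> carrier V" for v using p(3) that by (simp add: Vs)
  define g where "g = push K M W V p f"
  have g: "g \<in> mor K M (qc V)" unfolding g_def by (rule push_mor[OF mf W V pV f])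
  have "push K M V W (\<lambda>v. v) g = push K M W W p f"
    unfolding g_def by (rule push_push[OF W V W f pV inc])
  also have "\<dots> = f"
  proof (rule mor_eqI[OF push_mor[OF mf W W p(1) f] f])
    fix S x assume S: "S \<in> comm_algebras K" and x: "x \<in> carrier (Ob M S)"
    note SM = comm_algebras_module[OF S]
    note fx = qc_mor_closed[OF f S x]
    note pfx = left_map_closed[OF W SM W p(1) fx]
    interpret X: module S "tensor K W S" by (rule tensor_module[OF W comm_algebras_algebra[OF S]])
    interpret X1: module K1 "tensor K W K1" by (rule tensor_module[OF W comm_algebras_algebra[OF K1_closed]])
    let ?z = "left_map K W S W p (f S x) \<ominus>\<^bsub>tensor K W S\<^esub> f S x"
    have "?z = \<zero>\<^bsub>tensor K W S\<^esub>"
    proof (rule tensor_zero_if_functionals_vanish[OF K.field_axioms W SM])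
      show "?z \<in> carrier (tensor K W S)" using pfx fx by simp
      fix \<xi> assume \<xi>: "lin K S K1 \<xi>"
      obtain y where y: "y \<in> carrier (Ob M K1)" "f K1 y = tensor_map K W K1 \<xi> (f S x)"
        using scalar_liftableD[OF lift S \<xi> x] W f by (elim bexE) simp
      have "tensor_map K W K1 \<xi> ?z
          = tensor_map K W K1 \<xi> (left_map K W S W p (f S x)) \<ominus>\<^bsub>tensor K W K1\<^esub> f K1 y"
        unfolding y(2)
        by (rule additive_diff[OF tensor_map_additive[OF W SM K1M \<xi>] X.abelian_group_axioms X1.abelian_group_axioms pfx fx])
      also have "tensor_map K W K1 \<xi> (left_map K W S W p (f S x)) = left_map K W K1 W p (f K1 y)"
        unfolding y(2) by (rule left_map_tensor_map[OF W SM W K1M p(1) \<xi> fx, symmetric])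
      also have "\<dots> = f K1 y"
        using additive_closed[OF s_add y(1)] p(3) y(1)
        by (simp add: sp left_map_pure[OF W K1M W p(1)])
      finally show "tensor_map K W K1 \<xi> ?z = \<zero>\<^bsub>tensor K W K1\<^esub>"
        using fc[OF y(1)] by (simp add: X1.M.minus_eq X1.M.r_neg)
    qed
    then have "left_map K W S W p (f S x) = f S x"
      using pfx fx X.M.minus_equality[of "left_map K W S W p (f S x)" "\<ominus>\<^bsub>tensor K W S\<^esub> f S x"]
      by (simp add: X.M.minus_eq)
    then show "push K M W W p f S x = f S x" using S x by simp
  qed
  finally have eq: "push K M V W (\<lambda>v. v) g = f" .
  have epi: "g S ` carrier (Ob M S) = carrier (tensor K V S)" if S: "S \<in> comm_algebras K" for S
  proof
    show "g S ` carrier (Ob M S) \<subseteq> carrier (tensor K V S)" using qc_mor_closed[OF g S] by blast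
    interpret tp: tensor_pair K V S by (intro tensor_pair.intro V comm_algebras_module[OF S])
    interpret MS: module S "Ob M S" by (rule Ob_module[OF S])
    note l = mor_lin[OF g S, simplified]
    note str = structure_map_scalar_alg[OF S]
    have "z \<in> g S ` carrier (Ob M S)" if "z \<in> carrier (tensor K V S)" for z
      using that
    proof (induction rule: tp.tensor_induct)
      case (pure v a)
      then obtain y where y: "y \<in> carrier (Ob M K1)" "v = s y" by (auto simp: Vs)
      have vW: "v \<in> carrier W" using y additive_closed[OF s_add] by simp
      have "g K1 y = pure K V K1 v \<one>\<^bsub>K\<^esub>"
        using y vW pid[OF pure(1)] K1_closed by (simp add: g_def sp left_map_pure[OF W K1M V pV])
      moreover have "g S (Ar M K1 S (structure_map K S) y) = tensor_map K V S (structure_map K S) (g K1 y)"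
        using mor_natural[OF g K1_closed S str y(1)] by simp
      moreover note c = Ar_closed[OF K1_closed S str y(1)]
      ultimately have "g S (a \<odot>\<^bsub>Ob M S\<^esub> Ar M K1 S (structure_map K S) y) = pure K V S v a"
        using lin_smult[OF l pure(2) c] pure_as_scalar_extension[OF V S pure] by simp
      then show ?case using MS.smult_closed[OF pure(2) c] by (metis imageI)
    next
      case (add x y)
      then obtain a b where ab: "a \<in> carrier (Ob M S)" "x = g S a" "b \<in> carrier (Ob M S)" "y = g S b" by blast
      then have "x \<oplus>\<^bsub>tensor K V S\<^esub> y = g S (a \<oplus>\<^bsub>Ob M S\<^esub> b)" by (simp add: lin_add[OF l])
      then show ?case using MS.M.a_closed[OF ab(1,3)] by simp
    qed
    then show "carrier (tensor K V S) \<subseteq> g S ` carrier (Ob M S)" by blast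
  qed
  have "(V, g) \<in> Q" using V g epi by (simp add: qc_quotients_def functor_epi_def)
  then show ?thesis using inc pV pid eq by (rule that)
qed

text \<open>
  Every functional comes from a morphism into a quasi-coherent module, hence from a quotient.
\<close>

lemma bidual_eqI:
  assumes lift: scalar_liftable and S: "S \<in> comm_algebras K"
    and \<Phi>: "\<Phi> \<in> carrier (DD S)" and \<Psi>: "\<Psi> \<in> carrier (DD S)"
    and r: "\<And>i. i \<in> Q \<Longrightarrow> represents S \<Phi> (fst i) (snd i) (z i)"
      "\<And>i. i \<in> Q \<Longrightarrow> represents S \<Psi> (fst i) (snd i) (z i)"
  shows "\<Phi> = \<Psi>"
proof (rule mor_eqI)
  show "\<Phi> \<in> mor S (restrict_functor K (dual K M) S) ring_functor"
    "\<Psi> \<in> mor S (restrict_functor K (dual K M) S) ring_functor"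
    using \<Phi> \<Psi> by (simp_all add: dual_carrier)
  fix T h assume T: "T \<in> comm_algebras S" and "h \<in> carrier (Ob (restrict_functor K (dual K M) S) T)"
  then have h: "h \<in> carrier (D (base_alg K S T))" by simp
  let ?T = "base_alg K S T"
  have TK: "?T \<in> comm_algebras K" by (rule base_alg_closed[OF S T])
  note TM = comm_algebras_module[OF TK]
  obtain f where f: "f \<in> mor K M (qc ?T)" "h = functional K M ?T ?T f (\<lambda>t. t)"
    using dual_element_is_functional[OF TK h] by blast
  obtain V g p where g: "(V, g) \<in> Q" "lin K V ?T (\<lambda>v. v)" "push K M V ?T (\<lambda>v. v) g = f"
    using factor_through_quotient[OF lift TM f(1)] by metis
  note V = quotientD(1)[OF g(1), simplified] and gm = quotientD(2)[OF g(1), simplified]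
  have "h = functional K M V ?T g (\<lambda>v. v)"
    using functional_push[OF V TM TK gm g(2) lin_id] f(2) g(3) by simp
  then show "\<Phi> T h = \<Psi> T h"
    using representsD[OF r(1)[OF g(1)] T] representsD[OF r(2)[OF g(1)] T] g(2) by simp
qed

section \<open>Reflexive functors are limits of their quotients\<close>

lemma reflexive_bij:
  "reflexive K M \<longleftrightarrow> (\<forall>S \<in> comm_algebras K. bij_betw (bidual_map K M S) (carrier (Ob M S)) (carrier (DD S)))"
  unfolding reflexive_def functor_iso_iff_bij[OF module_functor_axioms] using bidual_map_mor by blast

lemma limit_bij:
  "functor_iso K M (qc_limit K M) (to_qc_limit K M) \<longleftrightarrow>
   (\<forall>S \<in> comm_algebras K. bij_betw (to_qc_limit K M S) (carrier (Ob M S)) (carrier (Ob (qc_limit K M) S)))"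
  unfolding functor_iso_iff_bij[OF module_functor_axioms] using to_limit_mor by blast

lemma bidual_surj_realizes_family:
  assumes surj: "bidual_map K M S ` carrier (Ob M S) = carrier (DD S)" and S: "S \<in> comm_algebras K"
    and y_closed: "\<And>V f. module K V \<Longrightarrow> f \<in> mor K M (qc V) \<Longrightarrow> y V f \<in> carrier (tensor K V S)"
    and y_natural: "\<And>V W u f. module K V \<Longrightarrow> module K W \<Longrightarrow> lin K V W u \<Longrightarrow> f \<in> mor K M (qc V) \<Longrightarrow>
      y W (push K M V W u f) = left_map K V S W u (y V f)"
  obtains m where "m \<in> carrier (Ob M S)" "\<And>V f. module K V \<Longrightarrow> f \<in> mor K M (qc V) \<Longrightarrow> f S m = y V f"
proof -
  obtain \<Phi> where \<Phi>: "\<Phi> \<in> carrier (DD S)"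
    "\<And>V f. module K V \<Longrightarrow> f \<in> mor K M (qc V) \<Longrightarrow> represents S \<Phi> V f (y V f)"
    by (rule bidual_element_from_family[OF S, of y, OF y_closed y_natural]) blast+
  obtain m where m: "m \<in> carrier (Ob M S)" "\<Phi> = bidual_map K M S m"
    using \<Phi>(1) surj by blast
  have "f S m = y V f" if "module K V" "f \<in> mor K M (qc V)" for V f
    using represents_unique[OF S that(1) qc_mor_closed[OF that(2) S m(1)] y_closed[OF that]]
      bidual_represents[OF S that m(1)] \<Phi>(2)[OF that] m(2) by blast
  with m(1) show ?thesis by (rule that)
qed

text \<open>
  The lift of \<open>x\<close> along \<open>\<xi>\<close> is the element that realizes the family \<open>(1 \<otimes> \<xi>)(f(x))\<close>.
\<close>

lemma reflexive_scalar_liftable: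
  assumes "reflexive K M"
  shows scalar_liftable
  unfolding scalar_liftable_def
proof (intro ballI allI impI)
  fix S \<xi> x assume S: "S \<in> comm_algebras K" and \<xi>: "lin K S K1 \<xi>" and x: "x \<in> carrier (Ob M S)"
  note SM = comm_algebras_module[OF S] and K1M = comm_algebras_module[OF K1_closed]
  have surj: "bidual_map K M K1 ` carrier (Ob M K1) = carrier (DD K1)"
    using assms K1_closed by (simp add: reflexive_bij bij_betw_def)
  obtain m where "m \<in> carrier (Ob M K1)"
    "\<And>V f. module K V \<Longrightarrow> f \<in> mor K M (qc V) \<Longrightarrow> f K1 m = tensor_map K V K1 \<xi> (f S x)"
  proof (rule bidual_surj_realizes_family[OF surj K1_closed, of "\<lambda>V f. tensor_map K V K1 \<xi> (f S x)"])
    fix V f assume "module K V" "f \<in> mor K M (qc V)"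
    then show "tensor_map K V K1 \<xi> (f S x) \<in> carrier (tensor K V K1)"
      using tensor_map_closed[OF _ SM K1M \<xi>] qc_mor_closed[OF _ S x] by blast
  next
    fix V W :: "('u, 'u) module" and u f
    assume *: "module K V" "module K W" "lin K V W u" "f \<in> mor K M (qc V)"
    show "tensor_map K W K1 \<xi> (push K M V W u f S x) = left_map K V K1 W u (tensor_map K V K1 \<xi> (f S x))"
      using left_map_tensor_map[OF *(1) SM *(2) K1M *(3) \<xi> qc_mor_closed[OF *(4) S x]] S x by simp
  qed blast
  then show "\<exists>y\<in>carrier (Ob M K1). \<forall>W f. module K W \<longrightarrow> f \<in> mor K M (qc W) \<longrightarrow>
      f K1 y = tensor_map K W K1 \<xi> (f S x)" by blast
qed

text \<open>
  For surjectivity, a compatible family \<open>x\<close> on the quotients is extended to a natural family on all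
  morphisms \<open>f : M \<rightarrow> W\<close>: factor \<open>f\<close> as \<open>M \<rightarrow> V \<subseteq> W\<close> with \<open>M \<rightarrow> V\<close> a quotient and take the image of the
  entry of \<open>x\<close> at \<open>V\<close>. For \<open>u : W \<rightarrow> X\<close>, the map \<open>u\<close> restricts to a map between the subspaces chosen for
  \<open>f\<close> and for \<open>(u \<otimes> 1) \<circ> f\<close>, which is a transition morphism of quotients; this gives naturality.
\<close>

theorem reflexive_imp_limit:
  assumes refl: "reflexive K M"
  shows "functor_iso K M (qc_limit K M) (to_qc_limit K M)"
  unfolding limit_bij
proof (intro ballI)
  fix S assume S: "S \<in> comm_algebras K"
  note SM = comm_algebras_module[OF S]
  note lift = reflexive_scalar_liftable[OF refl]
  have bij: "bij_betw (bidual_map K M S) (carrier (Ob M S)) (carrier (DD S))"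
    using refl S by (simp add: reflexive_bij)
  have "inj_on (to_qc_limit K M S) (carrier (Ob M S))"
  proof (rule inj_onI)
    fix m m' assume m: "m \<in> carrier (Ob M S)" "m' \<in> carrier (Ob M S)"
      and eq: "to_qc_limit K M S m = to_qc_limit K M S m'"
    have "snd i S m = snd i S m'" if "i \<in> Q" for i
      using fun_cong[OF eq, of i] S m that by (simp add: to_limit_apply)
    then have r': "represents S (bidual_map K M S m') (fst i) (snd i) (snd i S m)" if "i \<in> Q" for i
      using bidual_represents[OF S quotientD(1)[OF that] quotientD(2)[OF that] m(2)] that by simp
    have "bidual_map K M S m = bidual_map K M S m'"
      by (rule bidual_eqI[OF lift S bidual_map_closed[OF S m(1)] bidual_map_closed[OF S m(2)]
            bidual_represents[OF S quotientD(1) quotientD(2) m(1)] r'])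
    then show "m = m'" using bij m by (auto simp: bij_betw_def dest: inj_onD)
  qed
  moreover have "\<exists>m \<in> carrier (Ob M S). to_qc_limit K M S m = x"
    if x: "x \<in> carrier (Ob (qc_limit K M) S)" for x
  proof -
    note xc = limit_memD(1)[OF S x] and xcompat = limit_memD(2)[OF S x]
    (* R W f holds of the triples (V, g, p) where g is a quotient onto a subspace V of W through
       which f factors, with projection p of W onto V *)
    define R where "R W f t \<longleftrightarrow> (case t of (V, g, p) \<Rightarrow> (V, g) \<in> Q \<and> lin K V W (\<lambda>v. v) \<and> lin K W V p \<and>
      (\<forall>v \<in> carrier V. p v = v) \<and> push K M V W (\<lambda>v. v) g = f)" for W f t
    define c where "c W f = (SOME t. R W f t)" for W f
    have c: "R W f (c W f)" if W: "module K W" and f: "f \<in> mor K M (qc W)" for W f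
    proof -
      obtain V g p where "(V, g) \<in> Q" "lin K V W (\<lambda>v. v)" "lin K W V p"
        "\<And>v. v \<in> carrier V \<Longrightarrow> p v = v" "push K M V W (\<lambda>v. v) g = f"
        using factor_through_quotient[OF lift W f] by metis
      then have "R W f (V, g, p)" by (simp add: R_def)
      then show ?thesis unfolding c_def by (rule someI)
    qed
    define y where "y W f = (case c W f of (V, g, p) \<Rightarrow> left_map K V S W (\<lambda>v. v) (x (V, g)))" for W f
    obtain m where m: "m \<in> carrier (Ob M S)"
      "\<And>V f. module K V \<Longrightarrow> f \<in> mor K M (qc V) \<Longrightarrow> f S m = y V f"
    proof (rule bidual_surj_realizes_family[OF _ S, of y])
      show "bidual_map K M S ` carrier (Ob M S) = carrier (DD S)" using bij by (simp add: bij_betw_def)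
    next
      fix W f assume W: "module K W" and f: "f \<in> mor K M (qc W)"
      obtain V g p where t: "c W f = (V, g, p)" by (cases "c W f")
      have g: "(V, g) \<in> Q" "lin K V W (\<lambda>v. v)" using c[OF W f] by (simp_all add: R_def t)
      show "y W f \<in> carrier (tensor K W S)"
        using left_map_closed[OF _ SM W g(2)] quotientD(1)[OF g(1)] xc[OF g(1)] by (simp add: y_def t)
    next
      fix W X :: "('u, 'u) module" and u f
      assume W: "module K W" and X: "module K X" and u: "lin K W X u" and f: "f \<in> mor K M (qc W)"
      let ?f' = "push K M W X u f"
      have f': "?f' \<in> mor K M (qc X)" by (rule push_mor[OF module_functor_axioms W X u f])
      obtain V g p where t: "c W f = (V, g, p)" by (cases "c W f")
      obtain V' g' p' where t': "c X ?f' = (V', g', p')" by (cases "c X ?f'")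
      have g: "(V, g) \<in> Q" "lin K V W (\<lambda>v. v)" "push K M V W (\<lambda>v. v) g = f"
        using c[OF W f] by (simp_all add: R_def t)
      have g': "(V', g') \<in> Q" "lin K V' X (\<lambda>v. v)" "lin K X V' p'" "\<And>v. v \<in> carrier V' \<Longrightarrow> p' v = v"
        "push K M V' X (\<lambda>v. v) g' = ?f'"
        using c[OF X f'] by (simp_all add: R_def t')
      note V = quotientD(1)[OF g(1), simplified] and V' = quotientD(1)[OF g'(1), simplified]
      note gm = quotientD(2)[OF g(1), simplified] and gm' = quotientD(2)[OF g'(1), simplified]
      have uV: "lin K V X u" using lin_comp[OF g(2) u] by simp
      note w = lin_comp[OF uV g'(3)]
      have push_u: "push K M V X u g = ?f'"
        using push_push[OF V W X gm g(2) u] g(3) by simp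
      have pid: "push K M V' V' p' g' = g'"
      proof -
        have "push K M V' V' p' g' = push K M V' V' (\<lambda>v. v) g'"
        proof (rule mor_eqI)
          show "push K M V' V' p' g' \<in> mor K M (qc V')"
            using push_mor[OF module_functor_axioms V' V' _ gm'] lin_comp[OF g'(2,3)] by simp
          show "push K M V' V' (\<lambda>v. v) g' \<in> mor K M (qc V')"
            by (rule push_mor[OF module_functor_axioms V' V' lin_id gm'])
          fix U z assume U: "U \<in> comm_algebras K" and z: "z \<in> carrier (Ob M U)"
          then show "push K M V' V' p' g' U z = push K M V' V' (\<lambda>v. v) g' U z"
            using left_map_cong[OF V' comm_algebras_module[OF U] V' lin_id _ qc_mor_closed[OF gm' U z], of p'] g'(4)
            by simp
        qed
        then show ?thesis by (simp add: push_id[OF V' gm'])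
      qed
      have "push K M V V' (\<lambda>v. p' (u v)) g = push K M X V' p' ?f'"
        unfolding push_u[symmetric] by (rule push_push[OF V X V' gm uV g'(3), symmetric])
      also have "\<dots> = push K M V' V' p' g'"
        unfolding g'(5)[symmetric] using push_push[OF V' X V' gm' g'(2,3)] by simp
      finally have push_w: "push K M V V' (\<lambda>v. p' (u v)) g = g'" by (simp add: pid)
      (* the composite of u and p' on V is a transition morphism from (V, g) to (V', g') *)
      have xw: "left_map K V S V' (\<lambda>v. p' (u v)) (x (V, g)) = x (V', g')"
        using xcompat[OF g(1) g'(1)] w push_w by simp
      have "push K M V X (\<lambda>v. p' (u v)) g = push K M V X u g"
        using push_push[OF V V' X gm w g'(2)] by (simp add: push_w g'(5) push_u)
      then have ueq: "p' (u v) = u v" if "v \<in> carrier V" for v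
        using quotient_cancel[OF g(1) X, of "\<lambda>v. p' (u v)" u v] lin_comp[OF w g'(2)] uV that by simp
      note xg = xc[OF g(1), simplified]
      have "y X ?f' = left_map K V' S X (\<lambda>v. v) (left_map K V S V' (\<lambda>v. p' (u v)) (x (V, g)))"
        by (simp add: y_def t' xw)
      also have "\<dots> = left_map K V S X (\<lambda>v. p' (u v)) (x (V, g))"
        by (rule left_map_comp[OF V SM V' X w g'(2) xg])
      also have "\<dots> = left_map K V S X u (x (V, g))"
        by (rule left_map_cong[OF V SM X uV ueq xg])
      also have "\<dots> = left_map K W S X u (y W f)"
        using left_map_comp[OF V SM W X g(2) u xg] by (simp add: y_def t)
      finally show "y X ?f' = left_map K W S X u (y W f)" .
    qed blast
    have "to_qc_limit K M S m = x"
    proof (rule extensionalityI[of _ Q])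
      show "to_qc_limit K M S m \<in> extensional Q" using S m(1) by (simp add: to_qc_limit_def)
      show "x \<in> extensional Q" by (rule limit_memD(3)[OF S x])
      fix i assume i: "i \<in> Q"
      obtain W f where i_eq: "i = (W, f)" by (cases i)
      note W = quotientD(1)[OF i, unfolded i_eq fst_conv] and f = quotientD(2)[OF i, unfolded i_eq fst_conv snd_conv]
      obtain V g p where t: "c W f = (V, g, p)" by (cases "c W f")
      have g: "(V, g) \<in> Q" "lin K V W (\<lambda>v. v)" "push K M V W (\<lambda>v. v) g = f"
        using c[OF W f] by (simp_all add: R_def t)
      have "y W f = x i"
        using xcompat[OF g(1) i] g(2,3) by (simp add: y_def t i_eq)
      then show "to_qc_limit K M S m i = x i"
        using m(2)[OF W f] i S m(1) by (simp add: to_limit_apply i_eq)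
    qed
    with m(1) show ?thesis by blast
  qed
  ultimately show "bij_betw (to_qc_limit K M S) (carrier (Ob M S)) (carrier (Ob (qc_limit K M) S))"
    using to_limit_closed[OF S] by (auto simp: bij_betw_def)
qed

section \<open>Limits of quotients are reflexive\<close>

text \<open>
  The transition morphisms have the form \<open>u \<otimes> 1\<close>, so they commute with \<open>1 \<otimes> \<mu>\<close> for every linear map
  \<open>\<mu>\<close>, multiplicative or not.
\<close>

lemma limit_linear_transport:
  assumes iso: "functor_iso K M (qc_limit K M) (to_qc_limit K M)"
    and S: "S \<in> comm_algebras K" and S': "S' \<in> comm_algebras K" and \<mu>: "lin K S S' \<mu>"
    and x: "x \<in> carrier (Ob M S)"
  obtains y where "y \<in> carrier (Ob M S')"
    "\<And>i. i \<in> Q \<Longrightarrow> snd i S' y = tensor_map K (fst i) S' \<mu> (snd i S x)"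
proof -
  note SM = comm_algebras_module[OF S] and SM' = comm_algebras_module[OF S']
  let ?x = "\<lambda>i \<in> Q. tensor_map K (fst i) S' \<mu> (snd i S x)"
  have "?x \<in> carrier (Ob (qc_limit K M) S')"
  proof (rule limit_memI[OF S'])
    show "?x \<in> (\<Pi>\<^sub>E i \<in> Q. carrier (tensor K (fst i) S'))"
      using tensor_map_closed[OF quotientD(1) SM SM' \<mu>] quotient_closed[OF _ S x] by auto
    fix i j u assume *: "i \<in> Q" "j \<in> Q" "lin K (fst i) (fst j) u" "push K M (fst i) (fst j) u (snd i) = snd j"
    have "snd j S x = left_map K (fst i) S (fst j) u (snd i S x)"
      using fun_cong[OF fun_cong[OF *(4)], of S x] S x by simp
    then show "left_map K (fst i) S' (fst j) u (?x i) = ?x j"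
      using left_map_tensor_map[OF quotientD(1)[OF *(1)] SM quotientD(1)[OF *(2)] SM' *(3) \<mu> quotient_closed[OF *(1) S x]] *
      by simp
  qed
  then obtain y where y: "y \<in> carrier (Ob M S')" "?x = to_qc_limit K M S' y"
    using iso S' unfolding limit_bij bij_betw_def by blast
  have "snd i S' y = tensor_map K (fst i) S' \<mu> (snd i S x)" if "i \<in> Q" for i
    using fun_cong[OF y(2), of i] that S' y(1) by (simp add: to_limit_apply)
  with y(1) show ?thesis by (rule that)
qed

lemma limit_separated:
  assumes iso: "functor_iso K M (qc_limit K M) (to_qc_limit K M)"
    and S: "S \<in> comm_algebras K" and x: "x \<in> carrier (Ob M S)" and y: "y \<in> carrier (Ob M S)"
    and eq: "\<And>i. i \<in> Q \<Longrightarrow> snd i S x = snd i S y"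
  shows "x = y"
proof -
  have "to_qc_limit K M S x = to_qc_limit K M S y"
    by (rule extensionalityI[of _ Q]) (use S x y eq in \<open>simp_all add: to_qc_limit_def\<close>)
  then show ?thesis
    using iso S x y unfolding limit_bij bij_betw_def by (auto dest: inj_onD)
qed

text \<open>
  The lift of \<open>x\<close> along \<open>\<xi>\<close> has the components \<open>(1 \<otimes> \<xi>)(x\<^sub>i)\<close>; the point is that an arbitrary morphism
  \<open>f : M \<rightarrow> W\<close> respects it. Let \<open>x\<epsilon> \<in> M(K \<oplus> S)\<close> have the components of \<open>x\<close>, placed in the summand \<open>S\<close>.
  For a linear map \<open>\<nu> : S \<rightarrow> A\<close> and \<open>a \<in> M(A)\<close> with components \<open>(1 \<otimes> \<nu>)(x\<^sub>i)\<close>, the homomorphism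
  \<open>K \<oplus> S \<rightarrow> A[\<epsilon>]\<close> induced by \<open>\<nu>\<close> sends \<open>x\<epsilon>\<close> to \<open>\<epsilon> a\<close>, as both have the same components. Applying \<open>f\<close>,
  which is natural and linear, expresses \<open>f(a)\<close> through \<open>f(x\<epsilon>)\<close> and \<open>\<nu>\<close>. Comparing the cases
  \<open>A = S, \<nu> = 1\<close> and \<open>A = K, \<nu> = \<xi>\<close> gives the claim.
\<close>

lemma limit_scalar_liftable:
  assumes iso: "functor_iso K M (qc_limit K M) (to_qc_limit K M)"
  shows scalar_liftable
  unfolding scalar_liftable_def
proof (intro ballI allI impI)
  fix S \<xi> x assume S: "S \<in> comm_algebras K" and \<xi>: "lin K S K1 \<xi>" and x: "x \<in> carrier (Ob M S)"
  note SM = comm_algebras_module[OF S] and K1M = comm_algebras_module[OF K1_closed]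
  have "\<exists>e :: 'u \<Rightarrow> 'u. inj_on e (carrier S)" by (rule exI[of _ id]) simp
  then interpret E: square_zero_ext K S
    by (intro square_zero_ext.intro SM square_zero_ext_axioms.intro infinite_universe)
  let ?E = "square_zero K S"
  have E: "?E \<in> comm_algebras K" by (rule E.square_zero_closed)
  note EM = comm_algebras_module[OF E]
  obtain x\<epsilon> where x\<epsilon>: "x\<epsilon> \<in> carrier (Ob M ?E)"
    "\<And>i. i \<in> Q \<Longrightarrow> snd i ?E x\<epsilon> = tensor_map K (fst i) ?E (\<lambda>n. sq K S \<zero>\<^bsub>K\<^esub> n) (snd i S x)"
    using limit_linear_transport[OF iso S E E.sq_zero_lin x] by blast
  have key: "f A a = tensor_map K W A (\<lambda>e. \<nu> (sq_snd K S e)) (f ?E x\<epsilon>)"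
    if A: "A \<in> comm_algebras K" and \<nu>: "lin K S A \<nu>" and a: "a \<in> carrier (Ob M A)"
      and av: "\<And>i. i \<in> Q \<Longrightarrow> snd i A a = tensor_map K (fst i) A \<nu> (snd i S x)"
      and W: "module K W" and f: "f \<in> mor K M (qc W)" for A \<nu> a W f
  proof -
    interpret A: algebra K A by (rule comm_algebras_algebra[OF A])
    interpret D: square_zero_ext A "self_alg A"
      by (rule dual_numbers_square_zero[OF A.M_cring infinite_universe])
    let ?D = "dual_numbers A" let ?DK = "base_alg K A ?D"
    have DC: "?D \<in> comm_algebras A" by (rule D.square_zero_closed)
    have DK: "?DK \<in> comm_algebras K" by (rule base_alg_closed[OF A DC])
    note DM = comm_algebras_module[OF DK] and DA = comm_algebras_algebra[OF DK]
    interpret MD: module ?DK "Ob M ?DK" by (rule Ob_module[OF DK])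
    let ?\<epsilon> = "dn A \<zero>\<^bsub>A\<^esub> \<one>\<^bsub>A\<^esub>"
    have \<epsilon>: "?\<epsilon> \<in> carrier ?DK" by simp
    define i where "i = structure_map A ?D"
    have i: "i \<in> alg_hom K A ?DK" unfolding i_def by (rule structure_map_base_alg[OF A DC])
    have i_apply: "i t = dn A t \<zero>\<^bsub>A\<^esub>" if "t \<in> carrier A" for t
      using that by (simp add: i_def D.sq_one D.sq_smult)
    define m where "m z = ?\<epsilon> \<otimes>\<^bsub>?DK\<^esub> z" for z
    have m_i: "m (i t) = dn A \<zero>\<^bsub>A\<^esub> t" if "t \<in> carrier A" for t
      using that by (simp add: m_def i_apply D.sq_mult)
    have ml: "lin K ?DK ?DK m" unfolding m_def by (rule algebra_lin_mult[OF DA \<epsilon>])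
    define \<beta> where "\<beta> = square_zero_hom K S A \<nu>"
    have \<beta>: "\<beta> \<in> alg_hom K ?E ?DK" unfolding \<beta>_def by (rule E.square_zero_hom_alg_hom[OF A \<nu>])
    note il = alg_hom_lin[OF i] and \<beta>l = alg_hom_lin[OF \<beta>]
    have \<beta>_sq: "\<beta> (sq K S r s) = dn A (r \<odot>\<^bsub>A\<^esub> \<one>\<^bsub>A\<^esub>) (\<nu> s)" if "r \<in> carrier K" "s \<in> carrier S" for r s
      using that by (simp add: \<beta>_def E.square_zero_hom_sq)
    have ma: "?\<epsilon> \<odot>\<^bsub>Ob M ?DK\<^esub> Ar M A ?DK i a \<in> carrier (Ob M ?DK)"
      by (rule MD.smult_closed[OF \<epsilon> Ar_closed[OF A DK i a]])
    have f_ma: "g ?DK (?\<epsilon> \<odot>\<^bsub>Ob M ?DK\<^esub> Ar M A ?DK i a) = tensor_map K V ?DK (\<lambda>t. m (i t)) (g A a)"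
      if V: "module K V" and g: "g \<in> mor K M (qc V)" for V g
    proof -
      note ga = qc_mor_closed[OF g A a]
      have "g ?DK (?\<epsilon> \<odot>\<^bsub>Ob M ?DK\<^esub> Ar M A ?DK i a) = ?\<epsilon> \<odot>\<^bsub>tensor K V ?DK\<^esub> tensor_map K V ?DK i (g A a)"
        using lin_smult[OF mor_lin[OF g DK] \<epsilon> Ar_closed[OF A DK i a]] mor_natural[OF g A DK i a] by simp
      also have "\<dots> = tensor_map K V ?DK m (tensor_map K V ?DK i (g A a))"
        unfolding tensor_smult_eq m_def ..
      also have "\<dots> = tensor_map K V ?DK (\<lambda>t. m (i t)) (g A a)"
        by (rule tensor_map_comp[OF V A.module DM DM il ml ga])
      finally show ?thesis .
    qed
    have eq: "Ar M ?E ?DK \<beta> x\<epsilon> = ?\<epsilon> \<odot>\<^bsub>Ob M ?DK\<^esub> Ar M A ?DK i a"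
    proof (rule limit_separated[OF iso DK Ar_closed[OF E DK \<beta> x\<epsilon>(1)] ma])
      fix j assume j: "j \<in> Q"
      note V = quotientD(1)[OF j] and g = quotientD(2)[OF j]
      note gx = quotient_closed[OF j S x]
      have "snd j ?DK (Ar M ?E ?DK \<beta> x\<epsilon>) = tensor_map K (fst j) ?DK (\<lambda>n. \<beta> (sq K S \<zero>\<^bsub>K\<^esub> n)) (snd j S x)"
        using mor_natural[OF g E DK \<beta> x\<epsilon>(1)] x\<epsilon>(2)[OF j] tensor_map_comp[OF V SM EM DM E.sq_zero_lin \<beta>l gx] by simp
      also have "\<dots> = tensor_map K (fst j) ?DK (\<lambda>n. m (i (\<nu> n))) (snd j S x)"
        by (rule tensor_map_cong[OF V SM DM lin_comp[OF lin_comp[OF \<nu> il] ml] _ gx])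
          (simp add: \<beta>_sq m_i lin_closed[OF \<nu>])
      also have "\<dots> = tensor_map K (fst j) ?DK (\<lambda>t. m (i t)) (snd j A a)"
        using tensor_map_comp[OF V SM A.module DM \<nu> lin_comp[OF il ml] gx] av[OF j] by simp
      finally show "snd j ?DK (Ar M ?E ?DK \<beta> x\<epsilon>) = snd j ?DK (?\<epsilon> \<odot>\<^bsub>Ob M ?DK\<^esub> Ar M A ?DK i a)"
        by (simp add: f_ma[OF V g])
    qed
    note fx = qc_mor_closed[OF f E x\<epsilon>(1)] and fa = qc_mor_closed[OF f A a]
    note sl = dual_numbers_snd_lin[OF A infinite_universe]
    have "f A a = tensor_map K W A (\<lambda>t. t) (f A a)" by (rule tensor_map_id[OF W A.module fa, symmetric])
    also have "\<dots> = tensor_map K W A (\<lambda>t. dn_snd A (m (i t))) (f A a)"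
      by (rule tensor_map_cong[OF W A.module A.module lin_comp[OF lin_comp[OF il ml] sl] _ fa])
        (simp add: m_i)
    also have "\<dots> = tensor_map K W A (dn_snd A) (f ?DK (Ar M ?E ?DK \<beta> x\<epsilon>))"
      unfolding eq f_ma[OF W f] by (rule tensor_map_comp[OF W A.module DM A.module lin_comp[OF il ml] sl fa, symmetric])
    also have "\<dots> = tensor_map K W A (\<lambda>e. dn_snd A (\<beta> e)) (f ?E x\<epsilon>)"
      using mor_natural[OF f E DK \<beta> x\<epsilon>(1)] tensor_map_comp[OF W EM DM A.module \<beta>l sl fx] by simp
    also have "\<dots> = tensor_map K W A (\<lambda>e. \<nu> (sq_snd K S e)) (f ?E x\<epsilon>)"
      by (rule tensor_map_cong[OF W EM A.module lin_comp[OF E.sq_snd_lin \<nu>] _ fx])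
        (auto elim!: E.sq_cases simp: \<beta>_sq lin_closed[OF \<nu>])
    finally show ?thesis .
  qed
  obtain y where y: "y \<in> carrier (Ob M K1)"
    "\<And>i. i \<in> Q \<Longrightarrow> snd i K1 y = tensor_map K (fst i) K1 \<xi> (snd i S x)"
    using limit_linear_transport[OF iso S K1_closed \<xi> x] by blast
  have "f K1 y = tensor_map K W K1 \<xi> (f S x)" if W: "module K W" and f: "f \<in> mor K M (qc W)" for W f
  proof -
    note fx = qc_mor_closed[OF f E x\<epsilon>(1)]
    have "snd i S x = tensor_map K (fst i) S (\<lambda>s. s) (snd i S x)" if "i \<in> Q" for i
      by (rule tensor_map_id[OF quotientD(1)[OF that] SM quotient_closed[OF that S x], symmetric])
    then have "f S x = tensor_map K W S (sq_snd K S) (f ?E x\<epsilon>)"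
      by (rule key[OF S lin_id x _ W f])
    then have "tensor_map K W K1 \<xi> (f S x) = tensor_map K W K1 (\<lambda>e. \<xi> (sq_snd K S e)) (f ?E x\<epsilon>)"
      using tensor_map_comp[OF W EM SM K1M E.sq_snd_lin \<xi> fx] by simp
    then show ?thesis using key[OF K1_closed \<xi> y W f] by simp
  qed
  with y(1) show "\<exists>y\<in>carrier (Ob M K1). \<forall>W f. module K W \<longrightarrow> f \<in> mor K M (qc W) \<longrightarrow>
      f K1 y = tensor_map K W K1 \<xi> (f S x)" by blast
qed

text \<open>
  An element of \<open>M\<^sup>*\<^sup>*(S)\<close> yields a compatible family on the quotients, and no two elements yield the
  same one since every functional comes from a quotient.
\<close>

theorem limit_imp_reflexive:
  assumes iso: "functor_iso K M (qc_limit K M) (to_qc_limit K M)"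
  shows "reflexive K M"
  unfolding reflexive_bij
proof (intro ballI)
  fix S assume S: "S \<in> comm_algebras K"
  note lift = limit_scalar_liftable[OF iso]
  have bij: "bij_betw (to_qc_limit K M S) (carrier (Ob M S)) (carrier (Ob (qc_limit K M) S))"
    using iso S by (simp add: limit_bij)
  have "inj_on (bidual_map K M S) (carrier (Ob M S))"
  proof (rule inj_onI)
    fix m m' assume m: "m \<in> carrier (Ob M S)" "m' \<in> carrier (Ob M S)"
      and eq: "bidual_map K M S m = bidual_map K M S m'"
    show "m = m'"
    proof (rule limit_separated[OF iso S m])
      fix i assume i: "i \<in> Q"
      note V = quotientD(1)[OF i] and f = quotientD(2)[OF i]
      show "snd i S m = snd i S m'"
        using represents_unique[OF S V quotient_closed[OF i S m(1)] quotient_closed[OF i S m(2)]]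
          bidual_represents[OF S V f m(1)] bidual_represents[OF S V f m(2)] eq by simp
    qed
  qed
  moreover have "\<exists>m \<in> carrier (Ob M S). bidual_map K M S m = \<Phi>" if \<Phi>: "\<Phi> \<in> carrier (DD S)" for \<Phi>
  proof -
    have "\<exists>z. z \<in> carrier (tensor K (fst i) S) \<and> represents S \<Phi> (fst i) (snd i) z" if "i \<in> Q" for i
      using represents_exists[OF S quotientD(1)[OF that] quotientD(2)[OF that] \<Phi>] by metis
    then obtain z where z: "\<And>i. i \<in> Q \<Longrightarrow> z i \<in> carrier (tensor K (fst i) S)"
      "\<And>i. i \<in> Q \<Longrightarrow> represents S \<Phi> (fst i) (snd i) (z i)" by metis
    have "restrict z Q \<in> carrier (Ob (qc_limit K M) S)"
    proof (rule limit_memI[OF S])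
      show "restrict z Q \<in> (\<Pi>\<^sub>E i \<in> Q. carrier (tensor K (fst i) S))" using z(1) by simp
      fix i j u assume *: "i \<in> Q" "j \<in> Q" "lin K (fst i) (fst j) u" "push K M (fst i) (fst j) u (snd i) = snd j"
      note Vi = quotientD(1)[OF *(1)] and Vj = quotientD(1)[OF *(2)]
      have "represents S \<Phi> (fst j) (snd j) (left_map K (fst i) S (fst j) u (z i))"
        using represents_push[OF S Vi Vj quotientD(2)[OF *(1)] *(3) z(1)[OF *(1)] z(2)[OF *(1)]] *(4) by simp
      then have "left_map K (fst i) S (fst j) u (z i) = z j"
        using represents_unique[OF S Vj left_map_closed[OF Vi comm_algebras_module[OF S] Vj *(3) z(1)[OF *(1)]] z(1)[OF *(2)]]
          z(2)[OF *(2)] by blast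
      then show "left_map K (fst i) S (fst j) u (restrict z Q i) = restrict z Q j" using * by simp
    qed
    then obtain m where m: "m \<in> carrier (Ob M S)" "to_qc_limit K M S m = restrict z Q"
      using bij unfolding bij_betw_def by (metis imageE)
    have mz: "snd i S m = z i" if "i \<in> Q" for i
      using fun_cong[OF m(2), of i] that S m(1) by (simp add: to_limit_apply)
    have "represents S (bidual_map K M S m) (fst i) (snd i) (z i)" if "i \<in> Q" for i
      using bidual_represents[OF S quotientD(1)[OF that] quotientD(2)[OF that] m(1)] mz[OF that] by simp
    then have "bidual_map K M S m = \<Phi>"
      using z(2) by (intro bidual_eqI[OF lift S bidual_map_closed[OF S m(1)] \<Phi>]) auto
    with m(1) show ?thesis by blast
  qed
  ultimately show "bij_betw (bidual_map K M S) (carrier (Ob M S)) (carrier (DD S))"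
    using bidual_map_closed[OF S] by (auto simp: bij_betw_def)
qed

section \<open>The system of quotients\<close>

lemma quotients_inverse_system:
  "inverse_system K Q (qc_ge K M) (\<lambda>i. quasi_coherent K (fst i)) (qc_transition K M)"
proof -
  have id: "qc_factors K M i i (id_mor K (qc (fst i)))" if i: "i \<in> Q" for i
  proof -
    note m = id_mor_mor[OF qc_functor[OF quotientD(1)[OF i]]]
    have "comp_mor K M (id_mor K (qc (fst i))) (snd i) = snd i"
      by (rule mor_eqI[OF comp_mor_mor[OF module_functor_axioms quotientD(2)[OF i] m] quotientD(2)[OF i]])
        (simp add: comp_mor_apply id_mor_def quotient_closed[OF i])
    with m show ?thesis by (simp add: qc_factors_def)
  qed
  have comp: "qc_factors K M i k (comp_mor K (qc (fst i)) (qc_transition K M j k) (qc_transition K M i j))"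
    if i: "i \<in> Q" and j: "j \<in> Q" and ij: "qc_ge K M i j" and jk: "qc_ge K M j k" for i j k
  proof -
    note f = transition_factors[OF i ij, unfolded qc_factors_def]
      and g = transition_factors[OF j jk, unfolded qc_factors_def]
    show ?thesis
      unfolding qc_factors_def
      using comp_mor_mor[OF qc_functor[OF quotientD(1)[OF i]] conjunct1[OF f] conjunct1[OF g]] f g
      by (simp add: comp_mor_assoc[OF quotientD(2)[OF i]])
  qed
  show ?thesis
    unfolding inverse_system_def
  proof (intro conjI ballI impI)
    fix i assume i: "i \<in> Q"
    show "module_functor K (qc (fst i))" by (rule qc_functor[OF quotientD(1)[OF i]])
    show "qc_ge K M i i" "qc_transition K M i i = id_mor K (qc (fst i))"
      by (rule transition_eqI[OF i id[OF i]])+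
    fix j assume j: "j \<in> Q"
    show "qc_transition K M i j \<in> mor K (qc (fst i)) (qc (fst j))" if "qc_ge K M i j"
      using transition_factors[OF i that] by (simp add: qc_factors_def)
    fix k
    assume ij: "qc_ge K M i j" and jk: "qc_ge K M j k"
    show "qc_ge K M i k"
      "qc_transition K M i k = comp_mor K (qc (fst i)) (qc_transition K M j k) (qc_transition K M i j)"
      by (rule transition_eqI[OF i comp[OF i j ij jk]])+
  qed
qed

end

theorem theorem4p4:
  fixes K :: "'u ring" and M :: "('u, 'm) mfunctor"
  assumes "field K"
    and "infinite (UNIV :: 'u set)"
    and "module_functor K M"
  shows "(reflexive K M \<longleftrightarrow> functor_iso K M (qc_limit K M) (to_qc_limit K M)) \<and>
         (reflexive K M \<longrightarrow> proquasi_coherent TYPE(('u, 'm) quotient) K M)"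
proof -
  interpret functor_over_field K M
    by (intro functor_over_field.intro functor_in_universe.intro functor_in_universe_axioms.intro assms)
  have "proquasi_coherent TYPE(('u, 'm) quotient) K M" if "reflexive K M"
    unfolding proquasi_coherent_def
    using quotientD(1) quotients_inverse_system reflexive_imp_limit[OF that]
    by (intro exI[of _ Q] exI[of _ "qc_ge K M"] exI[of _ fst] exI[of _ "qc_transition K M"]
        exI[of _ "to_qc_limit K M"]) (simp add: qc_limit_def)
  then show ?thesis
    using reflexive_imp_limit limit_imp_reflexive by blast
qed

end
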